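(* Let $V:\widetilde{H}^{-1/2}(\Gamma)\to H^{1/2}(\Gamma)$ be an elliptic isomorphism, let $f\in H^{1/2}(\Gamma)$, and let $\phi\in\widetilde{H}^{-1/2}(\Gamma)$ be the unique solution of $\langle V\phi\,;\,\psi\rangle=\langle f\,;\,\psi\rangle$ for all $\psi\in\widetilde{H}^{-1/2}(\Gamma)$. Let $\mathcal{T}_h$ be a mesh of $\Gamma$ with set of nodes $\mathcal{N}_h$, let $\mathcal{X}_h\subseteq L^2(\Gamma)$ be a discrete (finite-dimensional) subspace, and let $\phi_h\in\mathcal{X}_h$ be the unique Galerkin solution, i.e., $\int_\Gamma V\phi_h(x)\,\psi_h(x)\,dx=\int_\Gamma f(x)\,\psi_h(x)\,dx$ for all $\psi_h\in\mathcal{X}_h$. Let $r_h:=f-V\phi_h\in H^{1/2}(\Gamma)$ be the residual. Then there holds the efficiency estimate $$\eta_h:=\Big(\sum_{z\in\mathcal{N}_h}|r_h|_{H^{1/2}(\omega_h(z))}^2\Big)^{1/2}\le C_{\rm eff}\,\|\phi-\phi_h\|_{\widetilde{H}^{-1/2}(\Gamma)}.$$ If, moreover, $\mathcal{T}_h$ and $\mathcal{X}_h$ satisfy assumptions (A1)--(A2) (stated in the context) for some fixed integer $m\in\mathbb{N}_0$ and some constant $q\in(0,1]$, then also the reliability estimate $$\|\phi-\phi_h\|_{\widetilde{H}^{-1/2}(\Gamma)}\le C_{\rm rel}\,\eta_h$$ holds. The constant $C_{\rm eff}>0$ depends only on $V$, while $C_{\rm rel}>0$ depends additionally only on $\Gamma$,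 $m$, $\kappa(\mathcal{T}_h)$, and $q$.
   Context: **Boundary.** $\Omega\subset\mathbb{R}^2$ is a Lipschitz domain and $\Gamma\subseteq\partial\Omega$ is a compact, connected, piecewise smooth part of its boundary. Either $\Gamma=\partial\Omega$ ("closed $\Gamma$") is parametrized by a closed, continuous, piecewise two times continuously differentiable path $\gamma:[a,b]\to\Gamma$ such that $\gamma|_{[a,b)}$ is bijective (its $(b-a)$-periodic extension to $\mathbb{R}$ is also denoted by $\gamma$), or $\Gamma\subsetneqq\partial\Omega$ ("open $\Gamma$") is parametrized by a bijective, continuous, piecewise two times continuously differentiable path $\gamma:[a,b]\to\Gamma$. The left derivative satisfies $\gamma^{\prime_\ell}(t)\neq0$ for $t\in(a,b]$, the right derivative satisfies $\gamma^{\prime_r}(t)\neq0$ for $t\in[a,b)$, and $\gamma^{\prime_\ell}(t)+c\,\gamma^{\prime_r}(t)\neq0$ for all $c>0$ and all $t\in[a,b]$ (closed $\Gamma$) resp. $t\in(a,b)$ (open $\Gamma$). Integrals over subsets of $\Gamma$ are with respect to arclength, and $|\cdot|$ of a curve is its arclength. **Sobolev spaces.** For measurable $\omega\subseteq\Gamma$, $|u|_{H^{1/2}(\omega)}^2:=\int_\omega\int_\omega\frac{|u(x)-u(y)|^2}{|x-y|^2}\,dy\,dx$, $\|u\|_{H^{1/2}(\omega)}^2:=\|u\|_{L^2(\omega)}^2+|u|_{H^{1/2}(\omega)}^2$, and $H^{1/2}(\omega):=\{u\in L^2(\omega):\|u\|_{H^{1/2}(\omega)}<\infty\}$. $\widetilde{H}^{-1/2}(\omega)$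 is the dual space of $H^{1/2}(\omega)$, where the duality $\langle\cdot\,;\,\cdot\rangle$ extends the $L^2(\omega)$-scalar product $\langle u\,;\,\phi\rangle=\int_\omega u\phi\,dx$. **Elliptic isomorphism.** $V$ is a bounded linear bijection with bounded inverse and there is $c>0$ such that $\langle V\psi\,;\,\psi\rangle\ge c\,\|\psi\|^2_{\widetilde{H}^{-1/2}(\Gamma)}$ for all $\psi\in\widetilde{H}^{-1/2}(\Gamma)$. **Mesh.** $\mathcal{T}_h=\{T_1,\dots,T_n\}$ is a partition of $\Gamma$ into compact connected segments $T_j=\gamma([\check z_{j-1},\check z_j])$ with $a=\check z_0<\check z_1<\dots<\check z_n=b$. The nodes are $z_j=\gamma(\check z_j)$, with $\mathcal{N}_h=\{z_1,\dots,z_n\}$ for closed $\Gamma$ and $\mathcal{N}_h=\{z_0,\dots,z_n\}$ for open $\Gamma$. $h_T$ is the arclength of $T$, $h:=\max_{T\in\mathcal{T}_h}h_T$, and for closed $\Gamma$ it is assumed that $h\le|\Gamma|/4$. The shape regularity constant is $\kappa(\mathcal{T}_h):=\max\{h_T/h_{T'}:T,T'\in\mathcal{T}_h,\ T\cap T'\neq\emptyset\}$. The node patch of $z\in\mathcal{N}_h$ is $\omega_h(z):=\bigcup\{T\in\mathcal{T}_h:z\in T\}$. For $T\in\mathcal{T}_h$, patches of order $m\in\mathbb{N}_0$ are defined inductively by $\omega_h^0(T):=T$ and $\omega_h^{m+1}(T):=\bigcup\{T'\in\mathcal{T}_h:T'\cap\omega_h^m(T)\neq\emptyset\}$. **Assumptions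 (A1)--(A2)** on $\mathcal{T}_h$ and $\mathcal{X}_h$ (for a fixed integer $m\in\mathbb{N}_0$): (A1) For each $T\in\mathcal{T}_h$ there exists some fixed function $\psi_T\in\mathcal{X}_h$ with connected support $\mathrm{supp}(\psi_T)$ such that $T\subseteq\mathrm{supp}(\psi_T)\subseteq\omega_h^m(T)$. (A2) There exists a constant $q\in(0,1]$ such that $\|1-\psi_T\|_{L^2(\mathrm{supp}(\psi_T))}^2\le(1-q)\,|\mathrm{supp}(\psi_T)|$ for all $T\in\mathcal{T}_h$. *)

theory Defs
  imports "HOL-Analysis.Analysis"
begin

section \<open>The boundary curve\<close>

text \<open>
  Open connected sets that are locally, in suitable orthonormal coordinates, the region below
  the graph of a Lipschitz function. Boundedness is not required.
\<close>

definition lipschitz_domain :: "(real^2) set \<Rightarrow> bool" where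
  "lipschitz_domain \<Omega> \<longleftrightarrow>
     open \<Omega> \<and> connected \<Omega> \<and> \<Omega> \<noteq> {} \<and>
     (\<forall>p\<in>frontier \<Omega>. \<exists>W e1 e2 g L.
        open W \<and> p \<in> W \<and> norm e1 = 1 \<and> norm e2 = 1 \<and> e1 \<bullet> e2 = 0 \<and>
        L-lipschitz_on UNIV (g :: real \<Rightarrow> real) \<and>
        \<Omega> \<inter> W = {x \<in> W. x \<bullet> e2 < g (x \<bullet> e1)})"

text \<open>
  The derivatives at the end points of each piece are one-sided, so every piece is twice
  continuously differentiable up to its end points.
\<close>

definition C2_on_interval :: "real \<Rightarrow> real \<Rightarrow> (real \<Rightarrow> real^2) \<Rightarrow> bool" where
  "C2_on_interval s t \<gamma> \<longleftrightarrow>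
     (\<exists>\<gamma>1 \<gamma>2.
        (\<forall>x\<in>{s..t}. (\<gamma> has_vector_derivative \<gamma>1 x) (at x within {s..t})) \<and>
        (\<forall>x\<in>{s..t}. (\<gamma>1 has_vector_derivative \<gamma>2 x) (at x within {s..t})) \<and>
        continuous_on {s..t} \<gamma>2)"

definition piecewise_C2 :: "real \<Rightarrow> real \<Rightarrow> (real \<Rightarrow> real^2) \<Rightarrow> bool" where
  "piecewise_C2 a b \<gamma> \<longleftrightarrow>
     continuous_on {a..b} \<gamma> \<and>
     (\<exists>(N::nat) p. p 0 = a \<and> p N = b \<and>
        (\<forall>i<N. p i < p (Suc i) \<and> C2_on_interval (p i) (p (Suc i)) \<gamma>))"

definition left_deriv :: "(real \<Rightarrow> real^2) \<Rightarrow> real \<Rightarrow> real^2" where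
  "left_deriv \<gamma> t = vector_derivative \<gamma> (at_left t)"

definition right_deriv :: "(real \<Rightarrow> real^2) \<Rightarrow> real \<Rightarrow> real^2" where
  "right_deriv \<gamma> t = vector_derivative \<gamma> (at_right t)"

text \<open>
  The curve \<open>\<Gamma>\<close> is closed precisely if \<open>\<Gamma> = frontier \<Omega>\<close>. In that case the total function
  \<open>\<gamma>\<close> is the periodic extension of the path, so that the one-sided derivatives at \<open>a\<close> and \<open>b\<close>
  are meaningful. For open \<open>\<Gamma>\<close> the values of \<open>\<gamma>\<close> outside \<open>{a..b}\<close> play no role.
\<close>

definition boundary_curve ::
  "(real^2) set \<Rightarrow> (real^2) set \<Rightarrow> (real \<Rightarrow> real^2) \<Rightarrow> real \<Rightarrow> real \<Rightarrow> bool" where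
  "boundary_curve \<Omega> \<Gamma> \<gamma> a b \<longleftrightarrow>
     lipschitz_domain \<Omega> \<and> \<Gamma> \<subseteq> frontier \<Omega> \<and> compact \<Gamma> \<and> connected \<Gamma> \<and>
     a < b \<and> piecewise_C2 a b \<gamma> \<and>
     (if \<Gamma> = frontier \<Omega>
      then \<gamma> a = \<gamma> b \<and> bij_betw \<gamma> {a..<b} \<Gamma> \<and> (\<forall>t. \<gamma> (t + (b - a)) = \<gamma> t)
      else bij_betw \<gamma> {a..b} \<Gamma>) \<and>
     (\<forall>t\<in>{a<..b}. left_deriv \<gamma> t \<noteq> 0) \<and>
     (\<forall>t\<in>{a..<b}. right_deriv \<gamma> t \<noteq> 0) \<and>
     (\<forall>t\<in>(if \<Gamma> = frontier \<Omega> then {a..b} else {a<..<b}). \<forall>c>0.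
        left_deriv \<gamma> t + c *\<^sub>R right_deriv \<gamma> t \<noteq> 0)"

text \<open>
  Arclength as a measure with space \<open>\<Gamma> = \<gamma> ` {a..b}\<close> and the Borel sets of \<open>\<Gamma>\<close>: the image under
  \<open>\<gamma>\<close> of the measure with density \<open>norm \<gamma>'\<close>. The finitely many points where \<open>\<gamma>'\<close> does not
  exist form a null set.
\<close>

definition arclength :: "(real \<Rightarrow> real^2) \<Rightarrow> real \<Rightarrow> real \<Rightarrow> (real^2) measure" where
  "arclength \<gamma> a b =
     distr
       (density (restrict_space lborel {a..b})
          (\<lambda>t. ennreal (norm (vector_derivative \<gamma> (at t within {a..b})))))
       (restrict_space borel (\<gamma> ` {a..b})) \<gamma>"


section \<open>Sobolev spaces\<close>

text \<open>
  All spaces are those of a measure \<open>M\<close>, to be instantiated with arclength on \<open>\<Gamma>\<close>. The spaces for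
  a measurable part \<open>\<omega>\<close> of \<open>\<Gamma>\<close> arise from \<open>restrict_space M \<omega>\<close>. Elements of \<open>L\<^sup>2\<close> and
  \<open>H\<^sup>1\<^sup>/\<^sup>2\<close> are represented by functions, and equality in these spaces is equality almost
  everywhere.
\<close>

definition L2_sq :: "'a measure \<Rightarrow> ('a \<Rightarrow> real) \<Rightarrow> ennreal" where
  "L2_sq M u = (\<integral>\<^sup>+x. ennreal ((u x)\<^sup>2) \<partial>M)"

definition L2_space :: "'a measure \<Rightarrow> ('a \<Rightarrow> real) set" where
  "L2_space M = {u \<in> borel_measurable M. L2_sq M u < \<infinity>}"

text \<open>On the diagonal the integrand is \<open>0 / 0 = 0\<close>.\<close>

definition H12_semi_sq :: "('a::metric_space) measure \<Rightarrow> ('a \<Rightarrow> real) \<Rightarrow> ennreal" where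
  "H12_semi_sq M u = (\<integral>\<^sup>+x. (\<integral>\<^sup>+y. ennreal (\<bar>u x - u y\<bar>\<^sup>2 / (dist x y)\<^sup>2) \<partial>M) \<partial>M)"

definition H12_space :: "('a::metric_space) measure \<Rightarrow> ('a \<Rightarrow> real) set" where
  "H12_space M = {u \<in> L2_space M. L2_sq M u + H12_semi_sq M u < \<infinity>}"

text \<open>
  The following two real numbers are meaningful for \<open>u \<in> H12_space M\<close> only, since
  \<open>enn2real \<infinity> = 0\<close>.
\<close>

definition H12_seminorm :: "('a::metric_space) measure \<Rightarrow> ('a \<Rightarrow> real) \<Rightarrow> real" where
  "H12_seminorm M u = sqrt (enn2real (H12_semi_sq M u))"

definition H12_norm :: "('a::metric_space) measure \<Rightarrow> ('a \<Rightarrow> real) \<Rightarrow> real" where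
  "H12_norm M u = sqrt (enn2real (L2_sq M u + H12_semi_sq M u))"

text \<open>
  The dual space of \<open>H\<^sup>1\<^sup>/\<^sup>2\<close>: bounded linear functionals, made extensional so that equality of
  functionals is equality in HOL. Boundedness implies that they do not distinguish functions that
  are equal almost everywhere. The duality pairing of \<open>u\<close> and \<open>F\<close> is the value \<open>F u\<close>.
\<close>

definition dual_space :: "('a::metric_space) measure \<Rightarrow> (('a \<Rightarrow> real) \<Rightarrow> real) set" where
  "dual_space M = {F \<in> extensional (H12_space M).
     (\<forall>u\<in>H12_space M. \<forall>v\<in>H12_space M. F (\<lambda>x. u x + v x) = F u + F v) \<and>
     (\<forall>c. \<forall>u\<in>H12_space M. F (\<lambda>x. c * u x) = c * F u) \<and>
     (\<exists>C. \<forall>u\<in>H12_space M. \<bar>F u\<bar> \<le> C * H12_norm M u)}"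

definition dual_norm :: "('a::metric_space) measure \<Rightarrow> (('a \<Rightarrow> real) \<Rightarrow> real) \<Rightarrow> real" where
  "dual_norm M F = (SUP u\<in>{u \<in> H12_space M. H12_norm M u \<le> 1}. \<bar>F u\<bar>)"

definition dual_add ::
  "('a::metric_space) measure \<Rightarrow> (('a \<Rightarrow> real) \<Rightarrow> real) \<Rightarrow> (('a \<Rightarrow> real) \<Rightarrow> real) \<Rightarrow> ('a \<Rightarrow> real) \<Rightarrow> real"
  where "dual_add M F G = (\<lambda>u\<in>H12_space M. F u + G u)"

definition dual_scale ::
  "('a::metric_space) measure \<Rightarrow> real \<Rightarrow> (('a \<Rightarrow> real) \<Rightarrow> real) \<Rightarrow> ('a \<Rightarrow> real) \<Rightarrow> real"
  where "dual_scale M c F = (\<lambda>u\<in>H12_space M. c * F u)"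

definition dual_diff ::
  "('a::metric_space) measure \<Rightarrow> (('a \<Rightarrow> real) \<Rightarrow> real) \<Rightarrow> (('a \<Rightarrow> real) \<Rightarrow> real) \<Rightarrow> ('a \<Rightarrow> real) \<Rightarrow> real"
  where "dual_diff M F G = (\<lambda>u\<in>H12_space M. F u - G u)"

text \<open>The embedding of \<open>L\<^sup>2\<close> into the dual space by means of the \<open>L\<^sup>2\<close> scalar product.\<close>

definition L2_to_dual :: "('a::metric_space) measure \<Rightarrow> ('a \<Rightarrow> real) \<Rightarrow> ('a \<Rightarrow> real) \<Rightarrow> real" where
  "L2_to_dual M \<phi> = (\<lambda>u\<in>H12_space M. \<integral>x. u x * \<phi> x \<partial>M)"

definition elliptic_isomorphism ::
  "('a::metric_space) measure \<Rightarrow> ((('a \<Rightarrow> real) \<Rightarrow> real) \<Rightarrow> 'a \<Rightarrow> real) \<Rightarrow> bool" where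
  "elliptic_isomorphism M V \<longleftrightarrow>
     (\<forall>F\<in>dual_space M. V F \<in> H12_space M) \<and>
     (\<forall>F\<in>dual_space M. \<forall>G\<in>dual_space M.
        AE x in M. V (dual_add M F G) x = V F x + V G x) \<and>
     (\<forall>c. \<forall>F\<in>dual_space M. AE x in M. V (dual_scale M c F) x = c * V F x) \<and>
     (\<exists>C. \<forall>F\<in>dual_space M. H12_norm M (V F) \<le> C * dual_norm M F) \<and>
     (\<forall>F\<in>dual_space M. \<forall>G\<in>dual_space M. (AE x in M. V F x = V G x) \<longrightarrow> F = G) \<and>
     (\<forall>u\<in>H12_space M. \<exists>F\<in>dual_space M. AE x in M. V F x = u x) \<and>
     (\<exists>C. \<forall>F\<in>dual_space M. dual_norm M F \<le> C * H12_norm M (V F)) \<and>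
     (\<exists>c>0. \<forall>F\<in>dual_space M. F (V F) \<ge> c * (dual_norm M F)\<^sup>2)"


section \<open>Meshes\<close>

text \<open>
  A mesh is given by its parameters \<open>z 0 < \<dots> < z n\<close> in \<open>{a..b}\<close>. For closed \<open>\<Gamma>\<close> the points
  \<open>\<gamma> (z 0)\<close> and \<open>\<gamma> (z n)\<close> coincide, so that \<open>mesh_nodes\<close> covers both the closed and the open case.
\<close>

definition mesh_elements :: "(real \<Rightarrow> real^2) \<Rightarrow> (nat \<Rightarrow> real) \<Rightarrow> nat \<Rightarrow> (real^2) set set" where
  "mesh_elements \<gamma> z n = (\<lambda>j. \<gamma> ` {z (j - 1)..z j}) ` {1..n}"

definition mesh_nodes :: "(real \<Rightarrow> real^2) \<Rightarrow> (nat \<Rightarrow> real) \<Rightarrow> nat \<Rightarrow> (real^2) set" where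
  "mesh_nodes \<gamma> z n = (\<lambda>j. \<gamma> (z j)) ` {0..n}"

definition mesh_width :: "'a measure \<Rightarrow> 'a set set \<Rightarrow> real" where
  "mesh_width M \<T> = Max (measure M ` \<T>)"

definition is_mesh ::
  "(real^2) set \<Rightarrow> (real^2) set \<Rightarrow> (real \<Rightarrow> real^2) \<Rightarrow> real \<Rightarrow> real \<Rightarrow> (nat \<Rightarrow> real) \<Rightarrow> nat \<Rightarrow> bool" where
  "is_mesh \<Omega> \<Gamma> \<gamma> a b z n \<longleftrightarrow>
     z 0 = a \<and> z n = b \<and> (\<forall>j<n. z j < z (Suc j)) \<and>
     (\<Gamma> = frontier \<Omega> \<longrightarrow>
        mesh_width (arclength \<gamma> a b) (mesh_elements \<gamma> z n) \<le> measure (arclength \<gamma> a b) \<Gamma> / 4)"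

definition shape_regularity :: "'a measure \<Rightarrow> 'a set set \<Rightarrow> real" where
  "shape_regularity M \<T> =
     Max {measure M T / measure M T' | T T'. T \<in> \<T> \<and> T' \<in> \<T> \<and> T \<inter> T' \<noteq> {}}"

definition node_patch :: "'a set set \<Rightarrow> 'a \<Rightarrow> 'a set" where
  "node_patch \<T> z = \<Union>{T \<in> \<T>. z \<in> T}"

primrec elem_patch :: "'a set set \<Rightarrow> nat \<Rightarrow> 'a set \<Rightarrow> 'a set" where
  "elem_patch \<T> 0 T = T"
| "elem_patch \<T> (Suc m) T = \<Union>{T' \<in> \<T>. T' \<inter> elem_patch \<T> m T \<noteq> {}}"


section \<open>Galerkin discretization\<close>

definition weak_solution ::
  "('a::metric_space) measure \<Rightarrow> ((('a \<Rightarrow> real) \<Rightarrow> real) \<Rightarrow> 'a \<Rightarrow> real) \<Rightarrow> ('a \<Rightarrow> real) \<Rightarrow>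
     (('a \<Rightarrow> real) \<Rightarrow> real) \<Rightarrow> bool" where
  "weak_solution M V f \<phi> \<longleftrightarrow> \<phi> \<in> dual_space M \<and> (\<forall>\<psi>\<in>dual_space M. \<psi> (V \<phi>) = \<psi> f)"

text \<open>Finite dimension is understood modulo equality almost everywhere.\<close>

definition discrete_subspace :: "'a measure \<Rightarrow> ('a \<Rightarrow> real) set \<Rightarrow> bool" where
  "discrete_subspace M X \<longleftrightarrow>
     X \<subseteq> L2_space M \<and> (\<lambda>x. 0) \<in> X \<and>
     (\<forall>u\<in>X. \<forall>v\<in>X. (\<lambda>x. u x + v x) \<in> X) \<and>
     (\<forall>c. \<forall>u\<in>X. (\<lambda>x. c * u x) \<in> X) \<and>
     (\<exists>B. finite B \<and> B \<subseteq> X \<and> (\<forall>u\<in>X. \<exists>c. AE x in M. u x = (\<Sum>w\<in>B. c w * w x)))"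

definition galerkin_solution ::
  "('a::metric_space) measure \<Rightarrow> ((('a \<Rightarrow> real) \<Rightarrow> real) \<Rightarrow> 'a \<Rightarrow> real) \<Rightarrow> ('a \<Rightarrow> real) \<Rightarrow>
     ('a \<Rightarrow> real) set \<Rightarrow> ('a \<Rightarrow> real) \<Rightarrow> bool" where
  "galerkin_solution M V f X \<phi>h \<longleftrightarrow>
     \<phi>h \<in> X \<and>
     (\<forall>\<psi>h\<in>X. (\<integral>x. V (L2_to_dual M \<phi>h) x * \<psi>h x \<partial>M) = (\<integral>x. f x * \<psi>h x \<partial>M))"

definition residual ::
  "('a::metric_space) measure \<Rightarrow> ((('a \<Rightarrow> real) \<Rightarrow> real) \<Rightarrow> 'a \<Rightarrow> real) \<Rightarrow> ('a \<Rightarrow> real) \<Rightarrow>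
     ('a \<Rightarrow> real) \<Rightarrow> 'a \<Rightarrow> real" where
  "residual M V f \<phi>h = (\<lambda>x. f x - V (L2_to_dual M \<phi>h) x)"

definition error_estimator ::
  "('a::metric_space) measure \<Rightarrow> 'a set set \<Rightarrow> 'a set \<Rightarrow> ('a \<Rightarrow> real) \<Rightarrow> real" where
  "error_estimator M \<T> \<N> r =
     sqrt (\<Sum>z\<in>\<N>. (H12_seminorm (restrict_space M (node_patch \<T> z)) r)\<^sup>2)"

text \<open>
  The support of an \<open>L\<^sup>2\<close> function, i.e. the complement of the largest relatively open subset of
  \<open>space M\<close> on which the function vanishes almost everywhere.
\<close>

definition ess_supp :: "('a::topological_space) measure \<Rightarrow> ('a \<Rightarrow> real) \<Rightarrow> 'a set" where
  "ess_supp M \<psi> =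
     {x \<in> space M. \<forall>U. open U \<and> x \<in> U \<longrightarrow> \<not> (AE y in M. y \<in> U \<longrightarrow> \<psi> y = 0)}"

definition assumption_A1 ::
  "('a::metric_space) measure \<Rightarrow> 'a set set \<Rightarrow> ('a \<Rightarrow> real) set \<Rightarrow> nat \<Rightarrow> ('a set \<Rightarrow> 'a \<Rightarrow> real) \<Rightarrow> bool"
  where
  "assumption_A1 M \<T> X m \<psi> \<longleftrightarrow>
     (\<forall>T\<in>\<T>. \<psi> T \<in> X \<and> connected (ess_supp M (\<psi> T)) \<and>
        T \<subseteq> ess_supp M (\<psi> T) \<and> ess_supp M (\<psi> T) \<subseteq> elem_patch \<T> m T)"

definition assumption_A2 ::
  "('a::metric_space) measure \<Rightarrow> 'a set set \<Rightarrow> real \<Rightarrow> ('a set \<Rightarrow> 'a \<Rightarrow> real) \<Rightarrow> bool" where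
  "assumption_A2 M \<T> q \<psi> \<longleftrightarrow>
     (\<forall>T\<in>\<T>. L2_sq (restrict_space M (ess_supp M (\<psi> T))) (\<lambda>x. 1 - \<psi> T x)
        \<le> ennreal ((1 - q) * measure M (ess_supp M (\<psi> T))))"

end

theory Submission
  imports Defs
begin

text \<open>
  The residual \<open>r\<close> equals \<open>V\<close> applied to the error almost everywhere
  (\<open>operator_error_eq_residual\<close>). As \<open>V\<close> is an isomorphism, the error in the dual norm is equivalent
  to the norm of \<open>r\<close> in \<open>H\<^sup>1\<^sup>/\<^sup>2\<close> on the whole curve, and the theorem becomes a comparison of this
  norm with the sum of the seminorms of \<open>r\<close> on the node patches.

  Efficiency is a counting argument: a point of the curve lies in boundedly many node patches
  (\<open>sum_node_patches_le\<close>).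

  Reliability requires localizing a nonlocal norm. Pairs of points in elements that touch are seen
  by a node patch. For the other pairs, \<open>(r x - r y)\<^sup>2 \<le> 2 (r x)\<^sup>2 + 2 (r y)\<^sup>2\<close> is inserted; the kernel,
  integrated over all points at distance at least \<open>\<rho>\<close>, is of order \<open>1 / \<rho>\<close> because arclength is
  one-dimensional (\<open>inverse_square_tail\<close>), and \<open>\<rho>\<close> is of the order of the length \<open>h\<close> of the element.
  This leaves the sum of \<open>h\<^sup>-\<^sup>1\<close> times the squared \<open>L\<^sup>2\<close> norm of \<open>r\<close> over the elements
  (\<open>H12_semi_sq_le\<close>), which also dominates the global \<open>L\<^sup>2\<close> norm.

  Here Galerkin orthogonality enters. The residual is orthogonal to a discrete function that is
  close to \<open>1\<close> on its support \<open>S\<close>, hence its distance from every constant in \<open>L\<^sup>2\<close> of \<open>S\<close> is at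
  least a fixed fraction of its norm there (\<open>orthogonal_far_from_constants\<close>). Taking for the constant
  the values of \<open>r\<close> on the element and averaging, the \<open>L\<^sup>2\<close> norm is bounded by the oscillation of
  \<open>r\<close> between the element and the patch of order \<open>m\<close>. This in turn is bounded by the node patch
  seminorms, by induction on \<open>m\<close> along chains of touching elements (\<open>oscillation_via\<close>,
  \<open>sum_oscillation_patches\<close>).

  All this is carried out for abstract graded partitions of a metric measure space. That a mesh on
  the boundary curve is one rests on the chord-arc property (\<open>chord_arc\<close>): the distance of two points
  of the curve is bounded below by a multiple of the length of the shorter arc between them. Locally
  this follows from the absence of cusps, and globally from injectivity and compactness.
\<close>

section \<open>Square-integrable functions\<close>

lemma L2_sq_integral:
  assumes "u \<in> L2_space M"
  shows "integrable M (\<lambda>x. (u x)\<^sup>2)" "L2_sq M u = ennreal (\<integral>x. (u x)\<^sup>2 \<partial>M)"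
proof -
  show 1: "integrable M (\<lambda>x. (u x)\<^sup>2)"
    using assms unfolding L2_space_def L2_sq_def
    by (intro integrableI_nonneg) auto
  show "L2_sq M u = ennreal (\<integral>x. (u x)\<^sup>2 \<partial>M)"
    unfolding L2_sq_def by (rule nn_integral_eq_integral[OF 1]) auto
qed

lemma L2_integrable_mult:
  assumes "u \<in> L2_space M" "v \<in> L2_space M"
  shows "integrable M (\<lambda>x. u x * v x)"
proof (rule Bochner_Integration.integrable_bound)
  show "integrable M (\<lambda>x. (u x)\<^sup>2 + (v x)\<^sup>2)"
    using L2_sq_integral(1)[OF assms(1)] L2_sq_integral(1)[OF assms(2)] by simp
  show "(\<lambda>x. u x * v x) \<in> borel_measurable M"
    using assms by (auto simp: L2_space_def)
  have "\<bar>s * t\<bar> \<le> s\<^sup>2 + t\<^sup>2" for s t :: real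
  proof -
    have "0 \<le> (\<bar>s\<bar> - \<bar>t\<bar>)\<^sup>2" by simp
    then have "2 * (\<bar>s\<bar> * \<bar>t\<bar>) \<le> s\<^sup>2 + t\<^sup>2" by (simp add: power2_diff)
    moreover have "0 \<le> \<bar>s\<bar> * \<bar>t\<bar>" by simp
    ultimately show ?thesis by (simp only: abs_mult)
  qed
  then show "AE x in M. norm (u x * v x) \<le> norm ((u x)\<^sup>2 + (v x)\<^sup>2)"
    by (auto simp: abs_mult)
qed

lemma L2_Cauchy_Schwarz:
  assumes u: "u \<in> L2_space M" and v: "v \<in> L2_space M"
  shows "(\<integral>x. u x * v x \<partial>M)\<^sup>2 \<le> (\<integral>x. (u x)\<^sup>2 \<partial>M) * (\<integral>x. (v x)\<^sup>2 \<partial>M)"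
proof -
  define J where "J = (\<integral>x. \<bar>u x * v x\<bar> \<partial>M)"
  have J0: "0 \<le> J" unfolding J_def by simp
  have "ennreal J = (\<integral>\<^sup>+x. ennreal \<bar>u x * v x\<bar> \<partial>M)"
    unfolding J_def by (rule nn_integral_eq_integral[symmetric]) (use L2_integrable_mult[OF u v] in auto)
  also have "\<dots> = (\<integral>\<^sup>+x. ennreal \<bar>u x\<bar> * ennreal \<bar>v x\<bar> \<partial>M)"
    by (simp add: abs_mult ennreal_mult)
  finally have "(ennreal J)\<^sup>2 \<le> (\<integral>\<^sup>+x. (ennreal \<bar>u x\<bar>)\<^sup>2 \<partial>M) * (\<integral>\<^sup>+x. (ennreal \<bar>v x\<bar>)\<^sup>2 \<partial>M)"
    using u v by (simp only:) (intro Cauchy_Schwarz_nn_integral, auto simp: L2_space_def)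
  also have "\<dots> = L2_sq M u * L2_sq M v" by (simp add: L2_sq_def ennreal_power)
  finally have "J\<^sup>2 \<le> (\<integral>x. (u x)\<^sup>2 \<partial>M) * (\<integral>x. (v x)\<^sup>2 \<partial>M)"
    using J0 by (simp add: L2_sq_integral(2)[OF u] L2_sq_integral(2)[OF v] ennreal_power ennreal_mult[symmetric])
  moreover have "\<bar>\<integral>x. u x * v x \<partial>M\<bar> \<le> J" unfolding J_def by (rule integral_abs_bound)
  then have "(\<integral>x. u x * v x \<partial>M)\<^sup>2 \<le> J\<^sup>2" using power_mono[of "\<bar>\<integral>x. u x * v x \<partial>M\<bar>" J 2] by simp
  ultimately show ?thesis by linarith
qed

lemma L2_space_add:
  assumes "u \<in> L2_space M" "v \<in> L2_space M"
  shows "(\<lambda>x. u x + v x) \<in> L2_space M"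
proof -
  note I = L2_sq_integral(1)[OF assms(1)] L2_sq_integral(1)[OF assms(2)] L2_integrable_mult[OF assms]
  have "integrable M (\<lambda>x. (u x)\<^sup>2 + (v x)\<^sup>2 + 2 * (u x * v x))" using I by simp
  then have "integrable M (\<lambda>x. (u x + v x)\<^sup>2)"
    by (simp add: power2_sum algebra_simps)
  then have "(\<integral>\<^sup>+x. ennreal ((u x + v x)\<^sup>2) \<partial>M) < \<infinity>"
    by (subst nn_integral_eq_integral) auto
  then show ?thesis using assms unfolding L2_space_def L2_sq_def by auto
qed

lemma L2_space_scale:
  assumes "u \<in> L2_space M"
  shows "(\<lambda>x. c * u x) \<in> L2_space M"
proof -
  have "integrable M (\<lambda>x. c\<^sup>2 * (u x)\<^sup>2)" using L2_sq_integral(1)[OF assms] by simp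
  then have "(\<integral>\<^sup>+x. ennreal ((c * u x)\<^sup>2) \<partial>M) < \<infinity>"
    by (subst nn_integral_eq_integral) (auto simp: power_mult_distrib)
  then show ?thesis using assms unfolding L2_space_def L2_sq_def by auto
qed

lemma L2_space_diff:
  assumes "u \<in> L2_space M" "v \<in> L2_space M"
  shows "(\<lambda>x. u x - v x) \<in> L2_space M"
  using L2_space_add[OF assms(1) L2_space_scale[OF assms(2), of "-1"]] by simp

text \<open>
  \<open>L\<^sup>2\<close> functions separate \<open>L\<^sup>2\<close>: it suffices to test \<open>u - v\<close> against itself.
\<close>
lemma L2_eq_by_testing:
  assumes "u \<in> L2_space M" "v \<in> L2_space M"
    and "\<And>w. w \<in> L2_space M \<Longrightarrow> (\<integral>x. u x * w x \<partial>M) = (\<integral>x. v x * w x \<partial>M)"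
  shows "AE x in M. u x = v x"
proof -
  define g where "g = (\<lambda>x. u x - v x)"
  have g: "g \<in> L2_space M" unfolding g_def by (rule L2_space_diff[OF assms(1,2)])
  have "(\<integral>x. (g x)\<^sup>2 \<partial>M) = (\<integral>x. u x * g x - v x * g x \<partial>M)"
    by (rule Bochner_Integration.integral_cong) (auto simp: g_def power2_eq_square algebra_simps)
  also have "\<dots> = 0"
    using L2_integrable_mult[OF assms(1) g] L2_integrable_mult[OF assms(2) g] assms(3)[OF g] by simp
  finally have "AE x in M. (g x)\<^sup>2 = 0"
    using integral_nonneg_eq_0_iff_AE[OF L2_sq_integral(1)[OF g]] by simp
  then show ?thesis by (auto simp: g_def)
qed

section \<open>The space \<open>H\<^sup>1\<^sup>/\<^sup>2\<close> and its dual\<close>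

lemma H12_subset_L2: "u \<in> H12_space M \<Longrightarrow> u \<in> L2_space M"
  unfolding H12_space_def by auto

lemma nn_integral_le_affine:
  fixes f g h :: "'a \<Rightarrow> ennreal"
  assumes "\<And>x. f x \<le> c * g x + c * h x"
    and [measurable]: "g \<in> borel_measurable M" "h \<in> borel_measurable M"
  shows "(\<integral>\<^sup>+x. f x \<partial>M) \<le> c * (\<integral>\<^sup>+x. g x \<partial>M) + c * (\<integral>\<^sup>+x. h x \<partial>M)"
proof -
  have "(\<integral>\<^sup>+x. f x \<partial>M) \<le> (\<integral>\<^sup>+x. c * g x + c * h x \<partial>M)"
    by (rule nn_integral_mono) (rule assms(1))
  also have "\<dots> = c * (\<integral>\<^sup>+x. g x \<partial>M) + c * (\<integral>\<^sup>+x. h x \<partial>M)"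
    by (subst nn_integral_add) (auto simp: nn_integral_cmult)
  finally show ?thesis .
qed

abbreviation quotient_sq :: "('a::metric_space \<Rightarrow> real) \<Rightarrow> 'a \<Rightarrow> 'a \<Rightarrow> ennreal" where
  "quotient_sq u x y \<equiv> ennreal (\<bar>u x - u y\<bar>\<^sup>2 / (dist x y)\<^sup>2)"

abbreviation L2_sq_on :: "'a measure \<Rightarrow> ('a \<Rightarrow> real) \<Rightarrow> 'a set \<Rightarrow> ennreal" where
  "L2_sq_on M u P \<equiv> \<integral>\<^sup>+x\<in>P. ennreal ((u x)\<^sup>2) \<partial>M"

abbreviation far_from_constants :: "'a measure \<Rightarrow> real \<Rightarrow> ('a \<Rightarrow> real) \<Rightarrow> 'a set \<Rightarrow> bool" where
  "far_from_constants M q u P \<equiv> \<forall>c. ennreal q * L2_sq_on M u P \<le> L2_sq_on M (\<lambda>x. u x - c) P"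

lemma H12_space_iff: "u \<in> H12_space M \<longleftrightarrow> u \<in> L2_space M \<and> H12_semi_sq M u < \<infinity>"
  unfolding H12_space_def L2_space_def by (auto simp: less_top[symmetric])

lemma H12_norm_cong_AE:
  assumes "AE x in M. u x = v x"
  shows "H12_norm M u = H12_norm M v"
proof -
  have "L2_sq M u = L2_sq M v"
    unfolding L2_sq_def using assms by (intro nn_integral_cong_AE) auto
  moreover have "H12_semi_sq M u = H12_semi_sq M v"
    unfolding H12_semi_sq_def
  proof (rule nn_integral_cong_AE)
    show "AE x in M. (\<integral>\<^sup>+y. quotient_sq u x y \<partial>M)
        = (\<integral>\<^sup>+y. quotient_sq v x y \<partial>M)"
      using assms
    proof eventually_elim
      case (elim x)
      show ?case
      proof (rule nn_integral_cong_AE)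
        show "AE y in M. quotient_sq u x y = quotient_sq v x y"
          using assms by eventually_elim (simp add: elim)
      qed
    qed
  qed
  ultimately show ?thesis unfolding H12_norm_def by simp
qed

lemma dual_diff_eq:
  "G \<in> dual_space M \<Longrightarrow> dual_diff M F G = dual_add M F (dual_scale M (-1) G)"
  by (auto simp: dual_diff_def dual_add_def dual_scale_def fun_eq_iff)

lemma dual_norm_nonneg:
  assumes "F \<in> dual_space M"
  shows "0 \<le> dual_norm M F"
proof -
  obtain C where C: "\<And>u. u \<in> H12_space M \<Longrightarrow> \<bar>F u\<bar> \<le> C * H12_norm M u"
    using assms unfolding dual_space_def by blast
  have bdd: "bdd_above ((\<lambda>u. \<bar>F u\<bar>) ` {u \<in> H12_space M. H12_norm M u \<le> 1})"
  proof (intro bdd_aboveI2)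
    fix u assume u: "u \<in> {u \<in> H12_space M. H12_norm M u \<le> 1}"
    have "0 \<le> H12_norm M u" by (simp add: H12_norm_def)
    have "\<bar>F u\<bar> \<le> C * H12_norm M u" using C u by auto
    also have "\<dots> \<le> \<bar>C\<bar> * 1" using u \<open>0 \<le> H12_norm M u\<close> by (intro mult_mono) auto
    finally show "\<bar>F u\<bar> \<le> \<bar>C\<bar>" by simp
  qed
  have "(\<lambda>x. 0) \<in> {u \<in> H12_space M. H12_norm M u \<le> 1}"
    by (simp add: H12_space_def L2_space_def L2_sq_def H12_semi_sq_def H12_norm_def)
  from cSUP_upper2[OF bdd this, of 0] show ?thesis
    unfolding dual_norm_def by simp
qed

locale sigma_finite_borel = sigma_finite_measure M
  for M :: "'a::{metric_space,second_countable_topology} measure" +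
  assumes borel_id: "(\<lambda>x. x) \<in> M \<rightarrow>\<^sub>M borel"
begin

lemma borel_measurable_dist_pair:
  shows "(\<lambda>p. dist (fst p) (snd p)) \<in> borel_measurable (M \<Otimes>\<^sub>M M)"
proof -
  have 1: "(\<lambda>p. fst p) \<in> (M \<Otimes>\<^sub>M M) \<rightarrow>\<^sub>M borel"
    using measurable_compose[OF measurable_fst borel_id] .
  have 2: "(\<lambda>p. snd p) \<in> (M \<Otimes>\<^sub>M M) \<rightarrow>\<^sub>M borel"
    using measurable_compose[OF measurable_snd borel_id] .
  show ?thesis by (rule borel_measurable_dist[OF 1 2])
qed

lemma borel_measurable_Gagliardo_kernel:
  assumes [measurable]: "u \<in> borel_measurable M"
  shows "(\<lambda>(x, y). quotient_sq u x y) \<in> borel_measurable (M \<Otimes>\<^sub>M M)"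
proof -
  note [measurable] = borel_measurable_dist_pair
  have "(\<lambda>p. ennreal (\<bar>u (fst p) - u (snd p)\<bar>\<^sup>2 / (dist (fst p) (snd p))\<^sup>2)) \<in> borel_measurable (M \<Otimes>\<^sub>M M)"
    by measurable
  then show ?thesis by (simp add: case_prod_unfold)
qed

text \<open>
  The parallelogram bound \<open>(s + t)\<^sup>2 \<le> 2 s\<^sup>2 + 2 t\<^sup>2\<close> under the two integral signs.
\<close>
lemma H12_semi_sq_add:
  assumes [measurable]: "u \<in> borel_measurable M" "v \<in> borel_measurable M"
  shows "H12_semi_sq M (\<lambda>x. u x + v x) \<le> 2 * H12_semi_sq M u + 2 * H12_semi_sq M v"
proof -
  note mu = borel_measurable_Gagliardo_kernel[OF assms(1)]
  note mv = borel_measurable_Gagliardo_kernel[OF assms(2)]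
  have twice: "ennreal (2 * s + 2 * t) = 2 * ennreal s + 2 * ennreal t" if "0 \<le> s" "0 \<le> t" for s t
    using that by (simp add: ennreal_plus ennreal_mult)
  have sq: "ennreal (\<bar>u x + v x - (u y + v y)\<bar>\<^sup>2 / (dist x y)\<^sup>2)
      \<le> 2 * quotient_sq u x y + 2 * quotient_sq v x y" for x y
  proof -
    have "(s + t)\<^sup>2 \<le> 2 * s\<^sup>2 + 2 * t\<^sup>2" for s t :: real
      using sum_squares_bound[of s t] by (simp add: power2_sum)
    from this[of "u x - u y" "v x - v y"]
    have "\<bar>u x + v x - (u y + v y)\<bar>\<^sup>2 \<le> 2 * \<bar>u x - u y\<bar>\<^sup>2 + 2 * \<bar>v x - v y\<bar>\<^sup>2"
      by (simp add: algebra_simps)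
    then have "\<bar>u x + v x - (u y + v y)\<bar>\<^sup>2 / (dist x y)\<^sup>2
        \<le> 2 * (\<bar>u x - u y\<bar>\<^sup>2 / (dist x y)\<^sup>2) + 2 * (\<bar>v x - v y\<bar>\<^sup>2 / (dist x y)\<^sup>2)"
      using divide_right_mono[of _ _ "(dist x y)\<^sup>2"] by (fastforce simp: add_divide_distrib)
    then have "ennreal (\<bar>u x + v x - (u y + v y)\<bar>\<^sup>2 / (dist x y)\<^sup>2)
        \<le> ennreal (2 * (\<bar>u x - u y\<bar>\<^sup>2 / (dist x y)\<^sup>2) + 2 * (\<bar>v x - v y\<bar>\<^sup>2 / (dist x y)\<^sup>2))"
      by (rule ennreal_leI)
    also have "\<dots> = 2 * quotient_sq u x y + 2 * quotient_sq v x y"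
      by (rule twice) auto
    finally show ?thesis .
  qed
  have inner: "(\<integral>\<^sup>+y. ennreal (\<bar>u x + v x - (u y + v y)\<bar>\<^sup>2 / (dist x y)\<^sup>2) \<partial>M)
      \<le> 2 * (\<integral>\<^sup>+y. quotient_sq u x y \<partial>M)
        + 2 * (\<integral>\<^sup>+y. quotient_sq v x y \<partial>M)" if "x \<in> space M" for x
    by (rule nn_integral_le_affine[OF sq])
      (use measurable_compose_Pair1[OF that mu] measurable_compose_Pair1[OF that mv] in auto)
  have "H12_semi_sq M (\<lambda>x. u x + v x)
      \<le> (\<integral>\<^sup>+x. 2 * (\<integral>\<^sup>+y. quotient_sq u x y \<partial>M)
        + 2 * (\<integral>\<^sup>+y. quotient_sq v x y \<partial>M) \<partial>M)"
    unfolding H12_semi_sq_def by (rule nn_integral_mono) (rule inner)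
  also have "\<dots> \<le> 2 * H12_semi_sq M u + 2 * H12_semi_sq M v"
    unfolding H12_semi_sq_def
    by (rule nn_integral_le_affine[OF order_refl])
      (use borel_measurable_nn_integral[OF mu] borel_measurable_nn_integral[OF mv] in auto)
  finally show ?thesis .
qed

lemma H12_semi_sq_scale:
  assumes [measurable]: "u \<in> borel_measurable M"
  shows "H12_semi_sq M (\<lambda>x. c * u x) = ennreal (c\<^sup>2) * H12_semi_sq M u"
proof -
  note mu = borel_measurable_Gagliardo_kernel[OF assms(1)]
  have eq: "ennreal (\<bar>c * u x - c * u y\<bar>\<^sup>2 / (dist x y)\<^sup>2)
      = ennreal (c\<^sup>2) * quotient_sq u x y" for x y
  proof -
    have "\<bar>c * u x - c * u y\<bar>\<^sup>2 = c\<^sup>2 * \<bar>u x - u y\<bar>\<^sup>2"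
      by (simp add: right_diff_distrib[symmetric] power_mult_distrib)
    then show ?thesis by (simp add: ennreal_mult[symmetric])
  qed
  have "H12_semi_sq M (\<lambda>x. c * u x)
    = (\<integral>\<^sup>+x. ennreal (c\<^sup>2) * (\<integral>\<^sup>+y. quotient_sq u x y \<partial>M) \<partial>M)"
    unfolding H12_semi_sq_def eq
    by (intro nn_integral_cong nn_integral_cmult)
      (use measurable_compose_Pair1[OF _ mu] in auto)
  also have "\<dots> = ennreal (c\<^sup>2) * H12_semi_sq M u"
    unfolding H12_semi_sq_def by (rule nn_integral_cmult) (use borel_measurable_nn_integral[OF mu] in auto)
  finally show ?thesis .
qed

lemma H12_space_add:
  assumes "u \<in> H12_space M" "v \<in> H12_space M"
  shows "(\<lambda>x. u x + v x) \<in> H12_space M"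
proof -
  have m: "u \<in> borel_measurable M" "v \<in> borel_measurable M"
    using assms by (auto simp: H12_space_iff L2_space_def)
  have "2 * H12_semi_sq M u + 2 * H12_semi_sq M v < \<infinity>"
    using assms by (auto simp: H12_space_iff ennreal_mult_less_top)
  with H12_semi_sq_add[OF m] have "H12_semi_sq M (\<lambda>x. u x + v x) < \<infinity>"
    by (rule order_le_less_trans)
  then show ?thesis using assms L2_space_add by (auto simp: H12_space_iff)
qed

lemma H12_space_scale:
  assumes "u \<in> H12_space M"
  shows "(\<lambda>x. c * u x) \<in> H12_space M"
  using assms H12_semi_sq_scale[of u c] L2_space_scale[of u M c]
  by (auto simp: H12_space_iff ennreal_mult_less_top L2_space_def)

lemma H12_space_diff:
  assumes "u \<in> H12_space M" "v \<in> H12_space M"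
  shows "(\<lambda>x. u x - v x) \<in> H12_space M"
  using H12_space_add[OF assms(1) H12_space_scale[OF assms(2), of "-1"]] by simp

lemma dual_spaceI_L2:
  assumes p: "p \<in> L2_space M"
  shows "L2_to_dual M p \<in> dual_space M"
proof -
  have add: "L2_to_dual M p (\<lambda>x. u x + v x) = L2_to_dual M p u + L2_to_dual M p v"
    if "u \<in> H12_space M" "v \<in> H12_space M" for u v
    using that H12_space_add[OF that]
      L2_integrable_mult[OF H12_subset_L2[OF that(1)] p] L2_integrable_mult[OF H12_subset_L2[OF that(2)] p]
    by (simp add: L2_to_dual_def distrib_right)
  have scale: "L2_to_dual M p (\<lambda>x. c * u x) = c * L2_to_dual M p u" if "u \<in> H12_space M" for c u
    using that H12_space_scale[OF that]
    by (simp add: L2_to_dual_def mult.assoc)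
  have bound: "\<bar>L2_to_dual M p u\<bar> \<le> sqrt (\<integral>x. (p x)\<^sup>2 \<partial>M) * H12_norm M u"
    if u: "u \<in> H12_space M" for u
  proof -
    have "L2_sq M u + H12_semi_sq M u < \<infinity>" using u unfolding H12_space_def by auto
    then have "enn2real (L2_sq M u) \<le> enn2real (L2_sq M u + H12_semi_sq M u)"
      by (intro enn2real_mono) auto
    then have le: "(\<integral>x. (u x)\<^sup>2 \<partial>M) \<le> (H12_norm M u)\<^sup>2"
      unfolding H12_norm_def using L2_sq_integral(2)[OF H12_subset_L2[OF u]] by simp
    have "\<bar>L2_to_dual M p u\<bar> = sqrt ((\<integral>x. u x * p x \<partial>M)\<^sup>2)"
      using u by (simp add: L2_to_dual_def)
    also have "\<dots> \<le> sqrt ((\<integral>x. (u x)\<^sup>2 \<partial>M) * (\<integral>x. (p x)\<^sup>2 \<partial>M))"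
      using L2_Cauchy_Schwarz[OF H12_subset_L2[OF u] p] by (rule real_sqrt_le_mono)
    also have "\<dots> \<le> sqrt ((H12_norm M u)\<^sup>2 * (\<integral>x. (p x)\<^sup>2 \<partial>M))"
      using le by (intro real_sqrt_le_mono mult_right_mono) auto
    also have "\<dots> = sqrt (\<integral>x. (p x)\<^sup>2 \<partial>M) * H12_norm M u"
      by (simp add: real_sqrt_mult H12_norm_def)
    finally show ?thesis .
  qed
  show ?thesis
    unfolding dual_space_def mem_Collect_eq
  proof (intro conjI ballI allI)
    show "L2_to_dual M p \<in> extensional (H12_space M)" by (simp add: L2_to_dual_def)
    show "\<exists>C. \<forall>u\<in>H12_space M. \<bar>L2_to_dual M p u\<bar> \<le> C * H12_norm M u" using bound by blast
  qed (use add scale in auto)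
qed

lemma dual_space_scale:
  assumes F: "F \<in> dual_space M"
  shows "dual_scale M c F \<in> dual_space M"
proof -
  obtain C where C: "\<And>u. u \<in> H12_space M \<Longrightarrow> \<bar>F u\<bar> \<le> C * H12_norm M u"
    using F unfolding dual_space_def by blast
  have "\<exists>C. \<forall>u\<in>H12_space M. \<bar>dual_scale M c F u\<bar> \<le> C * H12_norm M u"
  proof (intro exI ballI)
    fix u assume u: "u \<in> H12_space M"
    show "\<bar>dual_scale M c F u\<bar> \<le> (\<bar>c\<bar> * C) * H12_norm M u"
      using mult_left_mono[OF C[OF u] abs_ge_zero[of c]] u
      by (simp add: dual_scale_def abs_mult mult.assoc)
  qed
  then show ?thesis
    using F H12_space_add H12_space_scale
    by (auto simp: dual_space_def dual_scale_def distrib_left)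
qed

lemma dual_space_add:
  assumes F: "F \<in> dual_space M" and G: "G \<in> dual_space M"
  shows "dual_add M F G \<in> dual_space M"
proof -
  obtain C where C: "\<And>u. u \<in> H12_space M \<Longrightarrow> \<bar>F u\<bar> \<le> C * H12_norm M u"
    using F unfolding dual_space_def by blast
  obtain D where D: "\<And>u. u \<in> H12_space M \<Longrightarrow> \<bar>G u\<bar> \<le> D * H12_norm M u"
    using G unfolding dual_space_def by blast
  have "\<exists>C. \<forall>u\<in>H12_space M. \<bar>dual_add M F G u\<bar> \<le> C * H12_norm M u"
  proof (intro exI ballI)
    fix u assume u: "u \<in> H12_space M"
    show "\<bar>dual_add M F G u\<bar> \<le> (C + D) * H12_norm M u"
      using C[OF u] D[OF u] u by (simp add: dual_add_def distrib_right)
  qed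
  then show ?thesis
    using F G H12_space_add H12_space_scale
    by (auto simp: dual_space_def dual_add_def distrib_left)
qed

text \<open>
  The residual is the image of the error under \<open>V\<close>. Hence the error in the dual norm is
  equivalent to the residual in the norm of \<open>H\<^sup>1\<^sup>/\<^sup>2\<close>.
\<close>
lemma operator_error_eq_residual:
  assumes V: "elliptic_isomorphism M V" and f: "f \<in> H12_space M"
    and phi: "weak_solution M V f \<phi>" and p: "p \<in> L2_space M"
  shows "dual_diff M \<phi> (L2_to_dual M p) \<in> dual_space M"
    and "AE x in M. V (dual_diff M \<phi> (L2_to_dual M p)) x = residual M V f p x"
    and "residual M V f p \<in> H12_space M"
proof -
  note dual = dual_spaceI_L2
  have phiD: "\<phi> \<in> dual_space M" using phi by (simp add: weak_solution_def)
  note scale = dual_space_scale[OF dual[OF p], of "-1"]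
  show "dual_diff M \<phi> (L2_to_dual M p) \<in> dual_space M"
    using dual_space_add[OF phiD scale] dual_diff_eq[OF dual[OF p], of \<phi>] by simp
  have VH: "V F \<in> H12_space M" if "F \<in> dual_space M" for F
    using V that unfolding elliptic_isomorphism_def by blast
  have "AE x in M. V \<phi> x = f x"
  proof (rule L2_eq_by_testing)
    show "V \<phi> \<in> L2_space M" "f \<in> L2_space M" using VH[OF phiD] f by (auto simp: H12_space_iff)
    fix w assume "w \<in> L2_space M"
    then have "L2_to_dual M w (V \<phi>) = L2_to_dual M w f"
      using phi dual by (auto simp: weak_solution_def)
    then show "(\<integral>x. V \<phi> x * w x \<partial>M) = (\<integral>x. f x * w x \<partial>M)"
      using VH[OF phiD] f by (simp add: L2_to_dual_def)
  qed
  moreover have "AE x in M. V (dual_add M \<phi> (dual_scale M (-1) (L2_to_dual M p))) x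
      = V \<phi> x + V (dual_scale M (-1) (L2_to_dual M p)) x"
    using V phiD scale unfolding elliptic_isomorphism_def by blast
  moreover have "AE x in M. V (dual_scale M (-1) (L2_to_dual M p)) x = (-1) * V (L2_to_dual M p) x"
    using V dual[OF p] unfolding elliptic_isomorphism_def by blast
  ultimately show "AE x in M. V (dual_diff M \<phi> (L2_to_dual M p)) x = residual M V f p x"
    unfolding dual_diff_eq[OF dual[OF p], of \<phi>] residual_def by eventually_elim simp
  show "residual M V f p \<in> H12_space M"
    unfolding residual_def by (rule H12_space_diff[OF f VH[OF dual[OF p]]])
qed

end

section \<open>Essential supports and Galerkin orthogonality\<close>

lemma ess_supp_measurable:
  assumes [measurable]: "(\<lambda>x. x) \<in> M \<rightarrow>\<^sub>M (borel :: ('a::topological_space) measure)"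
  shows "ess_supp M \<psi> \<in> sets M"
proof -
  define W where "W = \<Union>{U. open U \<and> (AE y in M. y \<in> U \<longrightarrow> \<psi> y = 0)}"
  have "open W" unfolding W_def by auto
  then have "(\<lambda>x. x) -` W \<inter> space M \<in> sets M" by (intro measurable_sets[OF assms]) auto
  moreover have "ess_supp M \<psi> = space M - ((\<lambda>x. x) -` W \<inter> space M)"
    unfolding ess_supp_def W_def by blast
  ultimately show ?thesis by (simp add: sets.compl_sets)
qed

text \<open>
  The largest open set on which \<open>\<psi>\<close> vanishes is a union of countably many basic open sets.
\<close>
lemma AE_zero_outside_ess_supp:
  fixes M :: "('a::second_countable_topology) measure"
  shows "AE x in M. x \<notin> ess_supp M \<psi> \<longrightarrow> \<psi> x = 0"
proof -
  obtain B :: "'a set set" where B: "countable B" "topological_basis B"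
    using ex_countable_basis by blast
  define B' where "B' = {U \<in> B. AE y in M. y \<in> U \<longrightarrow> \<psi> y = 0}"
  have "countable B'" using B(1) unfolding B'_def by simp
  then have "AE y in M. \<forall>U\<in>B'. y \<in> U \<longrightarrow> \<psi> y = 0"
    by (subst AE_ball_countable) (auto simp: B'_def)
  then show ?thesis
  proof (rule AE_mp, intro AE_I2 impI)
    fix x assume x: "x \<in> space M" "\<forall>U\<in>B'. x \<in> U \<longrightarrow> \<psi> x = 0" "x \<notin> ess_supp M \<psi>"
    then obtain U where U: "open U" "x \<in> U" "AE y in M. y \<in> U \<longrightarrow> \<psi> y = 0"
      unfolding ess_supp_def by blast
    obtain W where W: "W \<in> B" "x \<in> W" "W \<subseteq> U"
      using topological_basisE[OF B(2) U(1,2)] by blast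
    have "AE y in M. y \<in> W \<longrightarrow> \<psi> y = 0" using U(3) by eventually_elim (use W(3) in auto)
    with W x show "\<psi> x = 0" unfolding B'_def by blast
  qed
qed

text \<open>
  If \<open>u\<close> is orthogonal to a \<open>\<psi>\<close> that is close to \<open>1\<close> on its support \<open>S\<close>, then \<open>u\<close> is far from
  every constant there: the integral of \<open>u\<close> over \<open>S\<close> equals that of \<open>u * (1 - \<psi>)\<close>, so by
  Cauchy--Schwarz the mean of \<open>u\<close> carries at most the fraction \<open>1 - q\<close> of the squared \<open>L\<^sup>2\<close> norm.
\<close>
lemma orthogonal_far_from_constants:
  fixes M :: "('a::second_countable_topology) measure"
  assumes "finite_measure M" "(\<lambda>x. x) \<in> M \<rightarrow>\<^sub>M borel"
    and u: "u \<in> L2_space M" and psi: "\<psi> \<in> L2_space M" and orth: "(\<integral>x. u x * \<psi> x \<partial>M) = 0"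
    and S: "S = ess_supp M \<psi>" and pos: "0 < measure M S"
    and A2: "L2_sq (restrict_space M S) (\<lambda>x. 1 - \<psi> x) \<le> ennreal ((1 - q) * measure M S)"
    and q: "q \<le> 1"
  shows "ennreal q * (\<integral>\<^sup>+y\<in>S. ennreal ((u y)\<^sup>2) \<partial>M) \<le> (\<integral>\<^sup>+y\<in>S. ennreal ((u y - c)\<^sup>2) \<partial>M)"
proof -
  interpret finite_measure M by fact
  have Sm[measurable]: "S \<in> sets M" unfolding S by (rule ess_supp_measurable[OF assms(2)])
  define R where "R = restrict_space M S"
  have Ssp: "S \<inter> space M \<in> sets M" using Sm by auto
  interpret R: finite_measure R
    unfolding R_def by (rule finite_measure_restrict_space) (use Ssp finite_measure_axioms in auto)
  have spR: "space R = S" unfolding R_def space_restrict_space using sets.sets_into_space[OF Sm] by auto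
  have mR: "measure R S = measure M S"
    unfolding R_def using measure_restrict_space[OF Ssp order_refl] by simp
  have L2R: "v \<in> L2_space R" if "v \<in> L2_space M" for v
  proof -
    have "(\<integral>\<^sup>+x. ennreal ((v x)\<^sup>2) \<partial>R) \<le> (\<integral>\<^sup>+x. ennreal ((v x)\<^sup>2) \<partial>M)"
      unfolding R_def
      by (subst nn_integral_restrict_space[OF Ssp]) (auto intro!: nn_integral_mono simp: indicator_def)
    then show ?thesis
      using that unfolding L2_space_def L2_sq_def R_def
      by (auto intro: measurable_restrict_space1 elim: order_le_less_trans)
  qed
  have const: "(\<lambda>x. c) \<in> L2_space R" for c
    using R.emeasure_finite by (auto simp: L2_space_def L2_sq_def ennreal_mult_eq_top_iff less_top[symmetric])
  note uR = L2R[OF u] and pR = L2R[OF psi]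
  have oR: "(\<lambda>x. 1 - \<psi> x) \<in> L2_space R" by (rule L2_space_diff[OF const pR])
  define A B m where "A = (\<integral>x. (u x)\<^sup>2 \<partial>R)" and "B = (\<integral>x. u x \<partial>R)" and "m = measure M S"
  have iu: "integrable R u" using L2_integrable_mult[OF uR const[of 1]] by simp
  have "(\<integral>x. u x * \<psi> x \<partial>R) = (\<integral>x. indicator S x *\<^sub>R (u x * \<psi> x) \<partial>M)"
    unfolding R_def by (rule integral_restrict_space[OF Ssp])
  also have "\<dots> = (\<integral>x. u x * \<psi> x \<partial>M)"
  proof (rule integral_cong_AE)
    have "AE x in M. x \<notin> S \<longrightarrow> \<psi> x = 0"
      unfolding S by (rule AE_zero_outside_ess_supp)
    then show "AE x in M. indicator S x *\<^sub>R (u x * \<psi> x) = u x * \<psi> x"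
      by eventually_elim (auto simp: indicator_def)
  qed (use u psi in \<open>auto simp: L2_space_def\<close>)
  finally have "(\<integral>x. u x * \<psi> x \<partial>R) = 0" using orth by simp
  moreover have "(\<integral>x. u x * (1 - \<psi> x) \<partial>R) = B - (\<integral>x. u x * \<psi> x \<partial>R)"
    using iu L2_integrable_mult[OF uR pR] by (simp add: B_def right_diff_distrib)
  ultimately have "B\<^sup>2 \<le> A * (\<integral>x. (1 - \<psi> x)\<^sup>2 \<partial>R)"
    using L2_Cauchy_Schwarz[OF uR oR] by (simp add: A_def)
  also have "(\<integral>x. (1 - \<psi> x)\<^sup>2 \<partial>R) \<le> (1 - q) * m"
    using A2 L2_sq_integral(2)[OF oR] q pos by (simp add: R_def m_def ennreal_le_iff)
  finally have B2: "B\<^sup>2 \<le> A * ((1 - q) * m)"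
    by (simp add: A_def mult_left_mono)
  have m: "0 < m" using pos by (simp add: m_def)
  have int_eq: "(\<integral>x. (u x - c)\<^sup>2 \<partial>R) = A - 2 * c * B + c\<^sup>2 * m"
  proof -
    have "(\<integral>x. (u x - c)\<^sup>2 \<partial>R) = (\<integral>x. (u x)\<^sup>2 - 2 * c * u x + c\<^sup>2 \<partial>R)"
      by (simp add: power2_diff algebra_simps)
    also have "\<dots> = A - 2 * c * B + c\<^sup>2 * m"
      using iu L2_sq_integral(1)[OF uR] by (simp add: A_def B_def m_def mR spR)
    finally show ?thesis .
  qed
  have "m * (q * A) \<le> m * A - B\<^sup>2" using B2 by (simp add: algebra_simps)
  also have "\<dots> \<le> m * A - B\<^sup>2 + (B - c * m)\<^sup>2" by simp
  also have "\<dots> = m * (A - 2 * c * B + c\<^sup>2 * m)" by (simp add: power2_eq_square algebra_simps)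
  finally have key: "q * A \<le> A - 2 * c * B + c\<^sup>2 * m" using m by simp
  have set_eq: "(\<integral>\<^sup>+y\<in>S. g y \<partial>M) = (\<integral>\<^sup>+y. g y \<partial>R)" for g
    unfolding R_def by (rule nn_integral_restrict_space[OF Ssp, symmetric])
  have "ennreal q * (\<integral>\<^sup>+y\<in>S. ennreal ((u y)\<^sup>2) \<partial>M) = ennreal q * ennreal A"
    unfolding set_eq A_def using L2_sq_integral(2)[OF uR] by (simp add: L2_sq_def)
  also have "\<dots> = ennreal (q * A)"
    by (rule ennreal_mult''[symmetric]) (simp add: A_def)
  also have "\<dots> \<le> ennreal (\<integral>x. (u x - c)\<^sup>2 \<partial>R)"
    using key int_eq by (intro ennreal_leI) simp
  also have "\<dots> = (\<integral>\<^sup>+y\<in>S. ennreal ((u y - c)\<^sup>2) \<partial>M)"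
    unfolding set_eq using L2_sq_integral(2)[OF L2_space_diff[OF uR const[of c]]] by (simp add: L2_sq_def)
  finally show ?thesis .
qed

lemma galerkin_orthogonality:
  assumes "f \<in> L2_space M" "V (L2_to_dual M p) \<in> L2_space M" "X \<subseteq> L2_space M"
    and "galerkin_solution M V f X p" "\<psi> \<in> X"
  shows "(\<integral>x. residual M V f p x * \<psi> x \<partial>M) = 0"
proof -
  have psi: "\<psi> \<in> L2_space M" using assms by auto
  show ?thesis
    using assms(4,5) L2_integrable_mult[OF assms(1) psi] L2_integrable_mult[OF assms(2) psi]
    by (simp add: galerkin_solution_def residual_def left_diff_distrib)
qed

section \<open>Graded partitions\<close>

text \<open>
  Double counting: an entry \<open>g z\<close> is repeated as often as there are indices related to \<open>z\<close>.
\<close>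
lemma sum_related_le:
  fixes g :: "'b \<Rightarrow> ennreal"
  assumes "finite I" "finite B" and card: "\<And>z. z \<in> B \<Longrightarrow> card {i \<in> I. R i z} \<le> N"
  shows "(\<Sum>i\<in>I. \<Sum>z\<in>{z \<in> B. R i z}. g z) \<le> of_nat N * (\<Sum>z\<in>B. g z)"
proof -
  have "(\<Sum>i\<in>I. \<Sum>z\<in>{z \<in> B. R i z}. g z) = (\<Sum>z\<in>B. of_nat (card {i \<in> I. R i z}) * g z)"
    by (subst sum.swap_restrict[OF assms(1,2)]) simp
  also have "\<dots> \<le> (\<Sum>z\<in>B. of_nat N * g z)"
    by (intro sum_mono mult_right_mono of_nat_mono card) auto
  finally show ?thesis by (simp only: sum_distrib_left)
qed

lemma double_sum_over_common_points:
  fixes g :: "'b \<Rightarrow> ennreal"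
  assumes fin: "finite \<T>" "finite \<N>" and card: "\<And>z. z \<in> \<N> \<Longrightarrow> card {T \<in> \<T>. z \<in> T} \<le> N"
  shows "(\<Sum>T\<in>\<T>. \<Sum>T'\<in>\<T>. \<Sum>z\<in>{z \<in> \<N>. z \<in> T \<inter> T'}. g z) \<le> of_nat (N * N) * (\<Sum>z\<in>\<N>. g z)"
proof -
  have "(\<Sum>T'\<in>\<T>. \<Sum>z\<in>{z \<in> \<N>. z \<in> T \<inter> T'}. g z) \<le> of_nat N * (\<Sum>z\<in>{z \<in> \<N>. z \<in> T}. g z)" for T
    using sum_related_le[of \<T> "{z \<in> \<N>. z \<in> T}" "\<lambda>T' z. z \<in> T'" N g] fin card by (simp add: conj_assoc)
  then have "(\<Sum>T\<in>\<T>. \<Sum>T'\<in>\<T>. \<Sum>z\<in>{z \<in> \<N>. z \<in> T \<inter> T'}. g z)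
      \<le> of_nat N * (\<Sum>T\<in>\<T>. \<Sum>z\<in>{z \<in> \<N>. z \<in> T}. g z)"
    unfolding sum_distrib_left by (rule sum_mono)
  also have "\<dots> \<le> of_nat N * (of_nat N * (\<Sum>z\<in>\<N>. g z))"
    by (intro mult_left_mono sum_related_le fin card) auto
  finally show ?thesis by (simp add: mult.assoc)
qed

text \<open>
  What the estimate needs to know about a mesh on a curve, in terms of the metric and the measure
  only. Elements may be listed around a closed curve or along an open one: the combinatorics enters
  through the bound \<open>N\<close> on incidences and through \<open>meet_in_node\<close>. The length of an element serves
  as the local length scale: \<open>\<kappa>\<close> compares the scales of elements that touch, \<open>D\<close> bounds diameters,
  \<open>\<delta>\<close> measures the separation of elements that do not touch, and \<open>A\<close> is the constant of upper
  one-dimensional Ahlfors regularity.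
\<close>
locale graded_partition = sigma_finite_borel M + finite_measure M
  for M :: "'a::{metric_space,second_countable_topology} measure" +
  fixes \<T> :: "'a set set" and \<N> :: "'a set" and N :: nat and \<kappa> D \<delta> A :: real
  assumes finite_elements: "finite \<T>" and finite_nodes: "finite \<N>"
    and element_sets: "T \<in> \<T> \<Longrightarrow> T \<in> sets M"
    and element_pos: "T \<in> \<T> \<Longrightarrow> 0 < measure M T"
    and cover: "space M \<subseteq> \<Union>\<T>"
    and nodes_space: "\<N> \<subseteq> space M"
    and overlap: "x \<in> space M \<Longrightarrow> card {T \<in> \<T>. x \<in> T} \<le> N"
    and few_nodes: "T \<in> \<T> \<Longrightarrow> card {z \<in> \<N>. z \<in> T} \<le> N"
    and meet_in_node: "T \<in> \<T> \<Longrightarrow> T' \<in> \<T> \<Longrightarrow> T \<inter> T' \<noteq> {} \<Longrightarrow> \<exists>z\<in>\<N>. z \<in> T \<inter> T'"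
    and graded: "T \<in> \<T> \<Longrightarrow> T' \<in> \<T> \<Longrightarrow> T \<inter> T' \<noteq> {} \<Longrightarrow> measure M T \<le> \<kappa> * measure M T'"
    and diameter: "T \<in> \<T> \<Longrightarrow> x \<in> T \<Longrightarrow> y \<in> T \<Longrightarrow> dist x y \<le> D * measure M T"
    and separated: "T \<in> \<T> \<Longrightarrow> T' \<in> \<T> \<Longrightarrow> T \<inter> T' = {} \<Longrightarrow> x \<in> T \<Longrightarrow> y \<in> T' \<Longrightarrow> \<delta> * measure M T \<le> dist x y"
    and upper_regular: "x \<in> space M \<Longrightarrow> 0 < R \<Longrightarrow> emeasure M (cball x R \<inter> space M) \<le> ennreal (A * R)"
    and kappa: "1 \<le> \<kappa>" and diameter_const: "0 \<le> D" and delta: "0 < \<delta>" and regular_const: "0 \<le> A"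
begin

lemma element_space: "T \<in> \<T> \<Longrightarrow> T \<subseteq> space M"
  using element_sets sets.sets_into_space by blast

lemma element_nonempty: "T \<in> \<T> \<Longrightarrow> T \<noteq> {}"
  using element_pos by force

lemma emeasure_element: "T \<in> \<T> \<Longrightarrow> emeasure M T = ennreal (measure M T)"
  by (rule emeasure_eq_measure)

lemma node_patch_sets [measurable]: "node_patch \<T> z \<in> sets M"
  unfolding node_patch_def using finite_elements element_sets by (intro sets.finite_Union) auto

lemma elem_patch_sets: "T \<in> \<T> \<Longrightarrow> elem_patch \<T> m T \<in> sets M"
  using finite_elements element_sets by (cases m) (auto intro!: sets.finite_Union)

abbreviation neighbours :: "'a set \<Rightarrow> 'a set set" where
  "neighbours T \<equiv> {T' \<in> \<T>. T \<inter> T' \<noteq> {}}"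

lemma card_neighbours:
  assumes T: "T \<in> \<T>"
  shows "card (neighbours T) \<le> N * N"
proof -
  have "neighbours T \<subseteq> (\<Union>z\<in>{z \<in> \<N>. z \<in> T}. {T' \<in> \<T>. z \<in> T'})"
    using meet_in_node[OF T] by blast
  then have "card (neighbours T) \<le> card (\<Union>z\<in>{z \<in> \<N>. z \<in> T}. {T' \<in> \<T>. z \<in> T'})"
    using finite_elements finite_nodes by (intro card_mono) auto
  also have "\<dots> \<le> (\<Sum>z\<in>{z \<in> \<N>. z \<in> T}. card {T' \<in> \<T>. z \<in> T'})"
    using finite_nodes by (intro card_UN_le) auto
  also have "\<dots> \<le> (\<Sum>z\<in>{z \<in> \<N>. z \<in> T}. N)"
    using overlap nodes_space by (intro sum_mono) auto
  also have "\<dots> \<le> N * N" using few_nodes[OF T] by simp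
  finally show ?thesis .
qed

text \<open>
  Patches can be built from the inside as well as from the outside; this turns the recursion on
  the order into a recursion on the starting element.
\<close>
lemma elem_patch_Suc_subset:
  assumes "T \<in> \<T>"
  shows "elem_patch \<T> (Suc m) T \<subseteq> (\<Union>T'\<in>neighbours T. elem_patch \<T> m T')"
proof (induction m)
  case 0
  show ?case by auto
next
  case (Suc m)
  show ?case
  proof
    fix x assume "x \<in> elem_patch \<T> (Suc (Suc m)) T"
    then obtain S where S: "S \<in> \<T>" "S \<inter> elem_patch \<T> (Suc m) T \<noteq> {}" "x \<in> S"
      unfolding elem_patch.simps(2)[of \<T> "Suc m"] by blast
    with Suc.IH obtain T' where "T' \<in> \<T>" "T \<inter> T' \<noteq> {}" "S \<inter> elem_patch \<T> m T' \<noteq> {}" by blast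
    then show "x \<in> (\<Union>T'\<in>neighbours T. elem_patch \<T> (Suc m) T')"
      using S by auto
  qed
qed

lemma measure_elem_patch:
  "T \<in> \<T> \<Longrightarrow> measure M (elem_patch \<T> m T) \<le> (real (N * N) * \<kappa>) ^ m * measure M T"
proof (induction m arbitrary: T)
  case 0
  then show ?case by simp
next
  case (Suc m)
  let ?nb = "neighbours T"
  have fin: "finite ?nb" using finite_elements by simp
  have "measure M (elem_patch \<T> (Suc m) T) \<le> measure M (\<Union>T'\<in>?nb. elem_patch \<T> m T')"
    by (rule finite_measure_mono[OF elem_patch_Suc_subset[OF Suc.prems]])
      (use fin elem_patch_sets in auto)
  also have "\<dots> \<le> (\<Sum>T'\<in>?nb. measure M (elem_patch \<T> m T'))"
    by (rule finite_measure_subadditive_finite[OF fin]) (use elem_patch_sets in auto)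
  also have "\<dots> \<le> (\<Sum>T'\<in>?nb. (real (N * N) * \<kappa>) ^ m * (\<kappa> * measure M T))"
  proof (rule sum_mono)
    fix T' assume T': "T' \<in> ?nb"
    then have "measure M T' \<le> \<kappa> * measure M T" using graded[of T' T] Suc.prems by blast
    then have "(real (N * N) * \<kappa>) ^ m * measure M T' \<le> (real (N * N) * \<kappa>) ^ m * (\<kappa> * measure M T)"
      using kappa by (intro mult_left_mono) auto
    with Suc.IH[of T'] T' show "measure M (elem_patch \<T> m T') \<le> (real (N * N) * \<kappa>) ^ m * (\<kappa> * measure M T)"
      by (auto intro: order_trans)
  qed
  also have "\<dots> = real (card ?nb) * ((real (N * N) * \<kappa>) ^ m * (\<kappa> * measure M T))" by simp
  also have "\<dots> \<le> real (N * N) * ((real (N * N) * \<kappa>) ^ m * (\<kappa> * measure M T))"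
    using card_neighbours[OF Suc.prems] kappa by (intro mult_right_mono) (auto simp del: of_nat_mult)
  also have "\<dots> = (real (N * N) * \<kappa>) ^ Suc m * measure M T" by simp
  finally show ?case .
qed

end

section \<open>Local oscillations\<close>

text \<open>
  The numerator of the \<open>H\<^sup>1\<^sup>/\<^sup>2\<close> seminorm without the singular kernel. It makes sense for sets that
  are far apart and allows chains of elements to be traversed without taking means of \<open>u\<close>.
\<close>
definition oscillation :: "'a measure \<Rightarrow> ('a \<Rightarrow> real) \<Rightarrow> 'a set \<Rightarrow> 'a set \<Rightarrow> ennreal" where
  "oscillation M u P Q = (\<integral>\<^sup>+x\<in>P. (\<integral>\<^sup>+y\<in>Q. ennreal ((u x - u y)\<^sup>2) \<partial>M) \<partial>M)"

context sigma_finite_measure begin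

lemma borel_measurable_set_nn_integral:
  assumes [measurable]: "(\<lambda>(x, y). f x y) \<in> borel_measurable (M \<Otimes>\<^sub>M M)" "Q \<in> sets M"
  shows "(\<lambda>x. \<integral>\<^sup>+y\<in>Q. f x y \<partial>M) \<in> borel_measurable M"
  by measurable

lemma set_nn_integral_swap:
  assumes [measurable]: "(\<lambda>(x, y). f x y) \<in> borel_measurable (M \<Otimes>\<^sub>M M)" "P \<in> sets M" "Q \<in> sets M"
  shows "(\<integral>\<^sup>+x\<in>P. (\<integral>\<^sup>+y\<in>Q. f x y \<partial>M) \<partial>M) = (\<integral>\<^sup>+y\<in>Q. (\<integral>\<^sup>+x\<in>P. f x y \<partial>M) \<partial>M)"
proof -
  interpret pair_sigma_finite M M by standard
  have m: "(\<lambda>(x, y). f x y * indicator Q y * indicator P x) \<in> borel_measurable (M \<Otimes>\<^sub>M M)"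
    by measurable
  have "(\<integral>\<^sup>+x\<in>P. (\<integral>\<^sup>+y\<in>Q. f x y \<partial>M) \<partial>M)
      = (\<integral>\<^sup>+x. (\<integral>\<^sup>+y. f x y * indicator Q y * indicator P x \<partial>M) \<partial>M)"
    by (intro nn_integral_cong nn_integral_multc[symmetric]) auto
  also have "\<dots> = (\<integral>\<^sup>+y. (\<integral>\<^sup>+x. f x y * indicator Q y * indicator P x \<partial>M) \<partial>M)"
    using Fubini'[OF m] by simp
  also have "\<dots> = (\<integral>\<^sup>+y\<in>Q. (\<integral>\<^sup>+x\<in>P. f x y \<partial>M) \<partial>M)"
  proof (rule nn_integral_cong)
    fix y assume "y \<in> space M"
    have "(\<integral>\<^sup>+x. f x y * indicator Q y * indicator P x \<partial>M)
        = (\<integral>\<^sup>+x. (f x y * indicator P x) * indicator Q y \<partial>M)" by (intro nn_integral_cong) (simp add: ac_simps)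
    also have "\<dots> = (\<integral>\<^sup>+x\<in>P. f x y \<partial>M) * indicator Q y"
      using \<open>y \<in> space M\<close> by (intro nn_integral_multc) auto
    finally show "(\<integral>\<^sup>+x. f x y * indicator Q y * indicator P x \<partial>M)
        = (\<integral>\<^sup>+x\<in>P. f x y \<partial>M) * indicator Q y" .
  qed
  finally show ?thesis .
qed

text \<open>
  Averaging \<open>(u x - u y)\<^sup>2 \<le> 2 (u x - u w)\<^sup>2 + 2 (u w - u y)\<^sup>2\<close> over an intermediate set of points
  \<open>w\<close> compares values of \<open>u\<close> on sets that do not touch.
\<close>
lemma oscillation_via:
  assumes [measurable]: "u \<in> borel_measurable M" "P \<in> sets M" "Q \<in> sets M" "W \<in> sets M"
  shows "emeasure M Q * oscillation M u P W
    \<le> 2 * emeasure M W * oscillation M u P Q + 2 * emeasure M P * oscillation M u Q W"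
proof -
  let ?s = "\<lambda>x y. ennreal ((u x - u y)\<^sup>2)"
  have tri: "?s x y \<le> 2 * ?s x w + 2 * ?s w y" for x y w
  proof -
    have "(u x - u y)\<^sup>2 \<le> 2 * (u x - u w)\<^sup>2 + 2 * (u w - u y)\<^sup>2"
      using sum_squares_bound[of "u x - u w" "u w - u y"] by (simp add: power2_eq_square algebra_simps)
    then have "?s x y \<le> ennreal (2 * (u x - u w)\<^sup>2 + 2 * (u w - u y)\<^sup>2)" by (rule ennreal_leI)
    also have "\<dots> = 2 * ?s x w + 2 * ?s w y" by (simp add: ennreal_plus ennreal_mult)
    finally show ?thesis .
  qed
  have inner: "emeasure M Q * (\<integral>\<^sup>+y\<in>W. ?s x y \<partial>M)
      \<le> 2 * emeasure M W * (\<integral>\<^sup>+w\<in>Q. ?s x w \<partial>M) + 2 * oscillation M u Q W" for x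
  proof -
    have pt: "emeasure M Q * ?s x y \<le> 2 * (\<integral>\<^sup>+w\<in>Q. ?s x w \<partial>M) + 2 * (\<integral>\<^sup>+w\<in>Q. ?s w y \<partial>M)" for y
    proof -
      have "emeasure M Q * ?s x y = ?s x y * emeasure M Q" by (rule mult.commute)
      also have "\<dots> = (\<integral>\<^sup>+w\<in>Q. ?s x y \<partial>M)" by (simp add: nn_integral_cmult_indicator)
      also have "\<dots> \<le> (\<integral>\<^sup>+w. 2 * (?s x w * indicator Q w) + 2 * (?s w y * indicator Q w) \<partial>M)"
        using tri by (intro nn_integral_mono) (auto simp: indicator_def)
      also have "\<dots> = 2 * (\<integral>\<^sup>+w\<in>Q. ?s x w \<partial>M) + 2 * (\<integral>\<^sup>+w\<in>Q. ?s w y \<partial>M)"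
        by (subst nn_integral_add) (auto simp: nn_integral_cmult)
      finally show ?thesis .
    qed
    have "emeasure M Q * (\<integral>\<^sup>+y\<in>W. ?s x y \<partial>M) = (\<integral>\<^sup>+y. emeasure M Q * ?s x y * indicator W y \<partial>M)"
      by (subst nn_integral_cmult[symmetric]) (auto simp: mult.assoc)
    also have "\<dots> \<le> (\<integral>\<^sup>+y. (2 * (\<integral>\<^sup>+w\<in>Q. ?s x w \<partial>M)) * indicator W y
        + 2 * ((\<integral>\<^sup>+w\<in>Q. ?s w y \<partial>M) * indicator W y) \<partial>M)"
      using pt by (intro nn_integral_mono) (auto simp: indicator_def)
    also have "\<dots> = 2 * (\<integral>\<^sup>+w\<in>Q. ?s x w \<partial>M) * emeasure M W + 2 * (\<integral>\<^sup>+y\<in>W. (\<integral>\<^sup>+w\<in>Q. ?s w y \<partial>M) \<partial>M)"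
      by (subst nn_integral_add) (auto simp: nn_integral_cmult nn_integral_cmult_indicator)
    also have "(\<integral>\<^sup>+y\<in>W. (\<integral>\<^sup>+w\<in>Q. ?s w y \<partial>M) \<partial>M) = oscillation M u Q W"
      unfolding oscillation_def by (rule set_nn_integral_swap[symmetric]) measurable
    finally show ?thesis by (simp add: ac_simps)
  qed
  have "emeasure M Q * oscillation M u P W
      = (\<integral>\<^sup>+x. emeasure M Q * (\<integral>\<^sup>+y\<in>W. ?s x y \<partial>M) * indicator P x \<partial>M)"
    unfolding oscillation_def by (subst nn_integral_cmult[symmetric]) (auto simp: mult.assoc)
  also have "\<dots> \<le> (\<integral>\<^sup>+x. 2 * emeasure M W * ((\<integral>\<^sup>+w\<in>Q. ?s x w \<partial>M) * indicator P x)
      + 2 * oscillation M u Q W * indicator P x \<partial>M)"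
    using inner by (intro nn_integral_mono) (auto simp: indicator_def)
  also have "\<dots> = 2 * emeasure M W * oscillation M u P Q + 2 * oscillation M u Q W * emeasure M P"
    unfolding oscillation_def
    by (subst nn_integral_add) (auto simp: nn_integral_cmult nn_integral_cmult_indicator)
  finally show ?thesis by (simp add: ac_simps)
qed

end

lemma H12_semi_sq_restrict:
  fixes M :: "('a::metric_space) measure"
  assumes "P \<in> sets M"
  shows "H12_semi_sq (restrict_space M P) u
    = (\<integral>\<^sup>+x\<in>P. (\<integral>\<^sup>+y\<in>P. quotient_sq u x y \<partial>M) \<partial>M)"
proof -
  have P: "P \<inter> space M \<in> sets M" using assms by auto
  show ?thesis unfolding H12_semi_sq_def nn_integral_restrict_space[OF P] ..
qed

lemma set_nn_integral_mono_set:
  "P \<subseteq> P' \<Longrightarrow> (\<And>x. x \<in> P \<Longrightarrow> f x \<le> g x) \<Longrightarrow> (\<integral>\<^sup>+x\<in>P. f x \<partial>M) \<le> (\<integral>\<^sup>+x\<in>P'. g x \<partial>M)"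
  by (intro nn_integral_mono) (auto simp: indicator_def)

lemma set_nn_integral_cover:
  assumes "finite I" "P \<subseteq> (\<Union>i\<in>I. Q i)" "\<And>i. i \<in> I \<Longrightarrow> Q i \<in> sets M" "f \<in> borel_measurable M"
  shows "(\<integral>\<^sup>+x\<in>P. f x \<partial>M) \<le> (\<Sum>i\<in>I. \<integral>\<^sup>+x\<in>Q i. f x \<partial>M)"
proof -
  have "(\<integral>\<^sup>+x\<in>P. f x \<partial>M) \<le> (\<integral>\<^sup>+x. (\<Sum>i\<in>I. f x * indicator (Q i) x) \<partial>M)"
  proof (rule nn_integral_mono)
    fix x
    show "f x * indicator P x \<le> (\<Sum>i\<in>I. f x * indicator (Q i) x)"
    proof (cases "x \<in> P")
      case True
      then obtain i where i: "i \<in> I" "x \<in> Q i" using assms(2) by blast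
      have "f x * indicator (Q i) x \<le> (\<Sum>i\<in>I. f x * indicator (Q i) x)"
        by (rule member_le_sum) (use i assms(1) in auto)
      with i True show ?thesis by simp
    qed simp
  qed
  also have "\<dots> = (\<Sum>i\<in>I. \<integral>\<^sup>+x\<in>Q i. f x \<partial>M)"
    using assms(3,4) by (intro nn_integral_sum borel_measurable_times_ennreal) auto
  finally show ?thesis .
qed

lemma set_nn_integral_overlap:
  fixes Q :: "'i \<Rightarrow> 'a set"
  assumes "finite I" "\<And>x. x \<in> space M \<Longrightarrow> card {i \<in> I. x \<in> Q i} \<le> N"
    and "\<And>i. i \<in> I \<Longrightarrow> Q i \<in> sets M" "\<And>i. i \<in> I \<Longrightarrow> Q i \<subseteq> P" "f \<in> borel_measurable M" "P \<in> sets M"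
  shows "(\<Sum>i\<in>I. \<integral>\<^sup>+x\<in>Q i. f x \<partial>M) \<le> of_nat N * (\<integral>\<^sup>+x\<in>P. f x \<partial>M)"
proof -
  have "(\<Sum>i\<in>I. \<integral>\<^sup>+x\<in>Q i. f x \<partial>M) = (\<integral>\<^sup>+x. (\<Sum>i\<in>I. f x * indicator (Q i) x) \<partial>M)"
    using assms(3,5) by (intro nn_integral_sum[symmetric] borel_measurable_times_ennreal) auto
  also have "\<dots> \<le> (\<integral>\<^sup>+x. of_nat N * (f x * indicator P x) \<partial>M)"
  proof (rule nn_integral_mono)
    fix x assume x: "x \<in> space M"
    have "(\<Sum>i\<in>I. f x * indicator (Q i) x) = (\<Sum>i\<in>I. if x \<in> Q i then f x * indicator P x else 0)"
      using assms(4) by (intro sum.cong) (auto simp: indicator_def)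
    also have "\<dots> = (\<Sum>i\<in>{i \<in> I. x \<in> Q i}. f x * indicator P x)"
      using assms(1) by (simp only: sum.inter_filter)
    also have "\<dots> = of_nat (card {i \<in> I. x \<in> Q i}) * (f x * indicator P x)" by simp
    also have "\<dots> \<le> of_nat N * (f x * indicator P x)"
      by (intro mult_right_mono of_nat_mono assms(2) x) simp
    finally show "(\<Sum>i\<in>I. f x * indicator (Q i) x) \<le> of_nat N * (f x * indicator P x)" .
  qed
  also have "\<dots> = of_nat N * (\<integral>\<^sup>+x\<in>P. f x \<partial>M)"
    using assms(5,6) by (intro nn_integral_cmult) auto
  finally show ?thesis .
qed


section \<open>Local error quantities are controlled by the node patches\<close>

text \<open>
  The recursion mirrors the growth of patches: one more layer costs a comparison of touching
  elements, weighted with the relative size of a patch of order \<open>m\<close>, and the oscillation over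
  patches of order \<open>m\<close> around all neighbours.
\<close>
fun oscillation_const :: "nat \<Rightarrow> real \<Rightarrow> real \<Rightarrow> nat \<Rightarrow> real" where
  "oscillation_const N \<kappa> D 0 = real (N * N) * (D * (1 + \<kappa>))\<^sup>2"
| "oscillation_const N \<kappa> D (Suc m) =
     2 * (real (N * N) * \<kappa>) ^ m * (real (N * N) * (D * (1 + \<kappa>))\<^sup>2)
     + 2 * (\<kappa> * real (N * N)) * oscillation_const N \<kappa> D m"

lemma oscillation_const_nonneg:
  "0 \<le> \<kappa> \<Longrightarrow> 0 \<le> oscillation_const N \<kappa> D m"
  by (induction m) auto

context graded_partition begin

abbreviation node_seminorm_sq :: "('a \<Rightarrow> real) \<Rightarrow> 'a \<Rightarrow> ennreal" where
  "node_seminorm_sq u z \<equiv> H12_semi_sq (restrict_space M (node_patch \<T> z)) u"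

abbreviation interaction :: "('a \<Rightarrow> real) \<Rightarrow> 'a set \<Rightarrow> 'a set \<Rightarrow> ennreal" where
  "interaction u P Q \<equiv> \<integral>\<^sup>+x\<in>P. (\<integral>\<^sup>+y\<in>Q. quotient_sq u x y \<partial>M) \<partial>M"

abbreviation scaled_osc :: "('a \<Rightarrow> real) \<Rightarrow> 'a set \<Rightarrow> 'a set \<Rightarrow> ennreal" where
  "scaled_osc u P Q \<equiv> ennreal (1 / (measure M P)\<^sup>2) * oscillation M u P Q"

abbreviation scaled_L2_sq :: "('a \<Rightarrow> real) \<Rightarrow> ennreal" where
  "scaled_L2_sq u \<equiv> \<Sum>T\<in>\<T>. ennreal (1 / measure M T) * L2_sq_on M u T"

abbreviation shared_seminorm_sq :: "('a \<Rightarrow> real) \<Rightarrow> 'a set \<Rightarrow> 'a set \<Rightarrow> ennreal" where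
  "shared_seminorm_sq u T T' \<equiv> \<Sum>z\<in>{z \<in> \<N>. z \<in> T \<inter> T'}. node_seminorm_sq u z"

lemma node_card: "z \<in> \<N> \<Longrightarrow> card {T \<in> \<T>. z \<in> T} \<le> N"
  using overlap nodes_space by auto

lemma kernel_meeting_le:
  assumes "T \<in> \<T>" "T' \<in> \<T>" "T \<inter> T' \<noteq> {}" and u: "u \<in> borel_measurable M"
  shows "interaction u T T'
    \<le> shared_seminorm_sq u T T'"
proof -
  obtain z where z: "z \<in> \<N>" "z \<in> T \<inter> T'" using meet_in_node[OF assms(1-3)] by blast
  have "T \<subseteq> node_patch \<T> z" "T' \<subseteq> node_patch \<T> z"
    using assms(1,2) z by (auto simp: node_patch_def)
  then have "interaction u T T' \<le> node_seminorm_sq u z"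
    unfolding H12_semi_sq_restrict[OF node_patch_sets]
    by (intro set_nn_integral_mono_set order_refl)
  also have "\<dots> \<le> shared_seminorm_sq u T T'"
    by (rule member_le_sum) (use z finite_nodes in auto)
  finally show ?thesis .
qed

text \<open>
  Two elements that touch have a joint diameter of the order of their length, which absorbs the
  denominator of the kernel.
\<close>
lemma oscillation_meeting_le:
  assumes T: "T \<in> \<T>" "T' \<in> \<T>" "T \<inter> T' \<noteq> {}" and u: "u \<in> borel_measurable M"
  shows "oscillation M u T T'
    \<le> ennreal ((D * (1 + \<kappa>))\<^sup>2 * (measure M T)\<^sup>2) * shared_seminorm_sq u T T'"
proof -
  define K where "K = D * (1 + \<kappa>) * measure M T"
  obtain z where z: "z \<in> T" "z \<in> T'" using T by blast
  note kernel = borel_measurable_Gagliardo_kernel[OF u]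
  have T': "measure M T' \<le> \<kappa> * measure M T" using graded[of T' T] T by blast
  have pt: "ennreal ((u x - u y)\<^sup>2) \<le> ennreal (K\<^sup>2) * quotient_sq u x y"
    if "x \<in> T" "y \<in> T'" for x y
  proof (cases "x = y")
    case False
    have "dist x y \<le> dist x z + dist z y" by (rule dist_triangle)
    also have "\<dots> \<le> D * measure M T + D * measure M T'"
      using diameter[OF T(1) that(1) z(1)] diameter[OF T(2) z(2) that(2)] by simp
    also have "\<dots> \<le> K"
      using mult_left_mono[OF T' diameter_const] by (simp add: K_def algebra_simps)
    finally have "(dist x y)\<^sup>2 \<le> K\<^sup>2" by (intro power_mono) auto
    then have "(u x - u y)\<^sup>2 * (dist x y)\<^sup>2 \<le> K\<^sup>2 * (u x - u y)\<^sup>2"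
      by (subst mult.commute) (rule mult_right_mono, auto)
    then have "(u x - u y)\<^sup>2 \<le> K\<^sup>2 * (\<bar>u x - u y\<bar>\<^sup>2 / (dist x y)\<^sup>2)"
      using False by (simp add: pos_le_divide_eq)
    then show ?thesis by (simp add: ennreal_mult[symmetric] ennreal_leI)
  qed simp
  have "oscillation M u T T'
      \<le> (\<integral>\<^sup>+x\<in>T. ennreal (K\<^sup>2) * (\<integral>\<^sup>+y\<in>T'. quotient_sq u x y \<partial>M) \<partial>M)"
    unfolding oscillation_def
  proof (rule set_nn_integral_mono_set[OF order_refl])
    fix x assume x: "x \<in> T"
    then have xs: "x \<in> space M" using element_space T by blast
    have "(\<integral>\<^sup>+y\<in>T'. ennreal ((u x - u y)\<^sup>2) \<partial>M)
        \<le> (\<integral>\<^sup>+y\<in>T'. ennreal (K\<^sup>2) * quotient_sq u x y \<partial>M)"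
      by (rule set_nn_integral_mono_set[OF order_refl]) (rule pt[OF x])
    also have "\<dots> = ennreal (K\<^sup>2) * (\<integral>\<^sup>+y\<in>T'. quotient_sq u x y \<partial>M)"
      unfolding mult.assoc
      by (intro nn_integral_cmult borel_measurable_times_ennreal borel_measurable_indicator element_sets T)
        (use measurable_compose_Pair1[OF xs kernel] in simp)
    finally show "(\<integral>\<^sup>+y\<in>T'. ennreal ((u x - u y)\<^sup>2) \<partial>M)
        \<le> ennreal (K\<^sup>2) * (\<integral>\<^sup>+y\<in>T'. quotient_sq u x y \<partial>M)" .
  qed
  also have "\<dots> = ennreal (K\<^sup>2) * interaction u T T'"
    unfolding mult.assoc
    by (intro nn_integral_cmult borel_measurable_times_ennreal borel_measurable_indicator element_sets T
        borel_measurable_set_nn_integral[OF kernel])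
  also have "\<dots> \<le> ennreal (K\<^sup>2) * shared_seminorm_sq u T T'"
    by (intro mult_left_mono kernel_meeting_le assms) simp
  finally show ?thesis by (simp add: K_def power_mult_distrib)
qed

text \<open>
  Every pair of touching elements is charged to a common node, and a node is charged by at most
  \<open>N * N\<close> pairs.
\<close>
lemma sum_oscillation_neighbours:
  assumes u: "u \<in> borel_measurable M"
  shows "(\<Sum>T\<in>\<T>. \<Sum>T'\<in>neighbours T. scaled_osc u T T')
    \<le> ennreal (real (N * N) * (D * (1 + \<kappa>))\<^sup>2) * (\<Sum>z\<in>\<N>. node_seminorm_sq u z)"
proof -
  define G where "G = (D * (1 + \<kappa>))\<^sup>2"
  have "(\<Sum>T\<in>\<T>. \<Sum>T'\<in>neighbours T. scaled_osc u T T')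
    \<le> (\<Sum>T\<in>\<T>. \<Sum>T'\<in>\<T>. ennreal G * shared_seminorm_sq u T T')"
  proof (intro sum_mono)
    fix T assume T: "T \<in> \<T>"
    have "(\<Sum>T'\<in>neighbours T. scaled_osc u T T')
      \<le> (\<Sum>T'\<in>neighbours T. ennreal G * shared_seminorm_sq u T T')"
    proof (rule sum_mono)
      fix T' assume T': "T' \<in> neighbours T"
      have "scaled_osc u T T'
        \<le> ennreal (1 / (measure M T)\<^sup>2)
          * (ennreal (G * (measure M T)\<^sup>2) * shared_seminorm_sq u T T')"
        unfolding G_def by (intro mult_left_mono oscillation_meeting_le T u) (use T' in auto)
      also have "\<dots> = ennreal G * shared_seminorm_sq u T T'"
        using element_pos[OF T] unfolding mult.assoc[symmetric]
        by (subst ennreal_mult[symmetric]) (auto simp: G_def)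
      finally show "scaled_osc u T T'
        \<le> ennreal G * shared_seminorm_sq u T T'" .
    qed
    also have "\<dots> \<le> (\<Sum>T'\<in>\<T>. ennreal G * shared_seminorm_sq u T T')"
      by (rule sum_mono2) (use finite_elements in auto)
    finally show "(\<Sum>T'\<in>neighbours T. scaled_osc u T T')
      \<le> (\<Sum>T'\<in>\<T>. ennreal G * shared_seminorm_sq u T T')" .
  qed
  also have "\<dots> = ennreal G * (\<Sum>T\<in>\<T>. \<Sum>T'\<in>\<T>. \<Sum>z\<in>{z \<in> \<N>. z \<in> T \<inter> T'}. node_seminorm_sq u z)"
    by (simp only: sum_distrib_left)
  also have "\<dots> \<le> ennreal G * (of_nat (N * N) * (\<Sum>z\<in>\<N>. node_seminorm_sq u z))"
    by (intro mult_left_mono double_sum_over_common_points finite_elements finite_nodes node_card) auto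
  also have "\<dots> = ennreal (real (N * N) * G) * (\<Sum>z\<in>\<N>. node_seminorm_sq u z)"
    by (subst ennreal_mult') (auto simp: ac_simps ennreal_of_nat_eq_real_of_nat G_def)
  finally show ?thesis by (simp only: G_def)
qed

lemma sum_over_neighbours:
  fixes g :: "'a set \<Rightarrow> ennreal"
  shows "(\<Sum>T\<in>\<T>. \<Sum>T'\<in>neighbours T. g T') \<le> of_nat (N * N) * (\<Sum>T\<in>\<T>. g T)"
  by (intro sum_related_le finite_elements) (use card_neighbours in \<open>simp add: Int_commute\<close>)

text \<open>
  The values of \<open>u\<close> on \<open>T\<close> are compared with those on a patch around the neighbour \<open>T'\<close> by passing
  through \<open>T'\<close> itself. Both weights are of the same order because the lengths of \<open>T\<close> and \<open>T'\<close> are.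
\<close>
lemma oscillation_patch_step:
  assumes T: "T \<in> \<T>" "T' \<in> \<T>" "T \<inter> T' \<noteq> {}" and u: "u \<in> borel_measurable M"
  shows "scaled_osc u T (elem_patch \<T> m T')
    \<le> ennreal (2 * (real (N * N) * \<kappa>) ^ m) * (scaled_osc u T T')
      + ennreal (2 * \<kappa>) * (scaled_osc u T' (elem_patch \<T> m T'))"
proof -
  define K where "K = (real (N * N) * \<kappa>) ^ m"
  define W where "W = elem_patch \<T> m T'"
  define h h' where "h = measure M T" and "h' = measure M T'"
  have h: "0 < h" "0 < h'" using element_pos T by (auto simp: h_def h'_def)
  have K: "0 \<le> K" using kappa by (simp add: K_def)
  have W: "W \<in> sets M" unfolding W_def by (rule elem_patch_sets[OF T(2)])
  have mW: "emeasure M W \<le> ennreal (K * h')"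
    using measure_elem_patch[OF T(2), of m] unfolding W_def K_def h'_def
    by (simp add: emeasure_eq_measure ennreal_leI)
  have hh: "h' \<le> \<kappa> * h" using graded[of T' T] T by (auto simp: h_def h'_def)
  have "ennreal h' * oscillation M u T W
      \<le> 2 * emeasure M W * oscillation M u T T' + 2 * ennreal h * oscillation M u T' W"
    using oscillation_via[OF u element_sets[OF T(1)] element_sets[OF T(2)] W]
    by (simp add: emeasure_element T h_def h'_def)
  also have "\<dots> \<le> 2 * ennreal (K * h') * oscillation M u T T' + 2 * ennreal h * oscillation M u T' W"
    by (intro add_right_mono mult_right_mono mult_left_mono mW) auto
  finally have "ennreal (1 / (h' * h\<^sup>2)) * (ennreal h' * oscillation M u T W)
      \<le> ennreal (1 / (h' * h\<^sup>2))
        * (2 * ennreal (K * h') * oscillation M u T T' + 2 * ennreal h * oscillation M u T' W)"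
    by (rule mult_left_mono) simp
  also have "ennreal (1 / (h' * h\<^sup>2)) * (ennreal h' * oscillation M u T W) = ennreal (1 / h\<^sup>2) * oscillation M u T W"
    using h unfolding mult.assoc[symmetric] by (subst ennreal_mult[symmetric]) auto
  also have "ennreal (1 / (h' * h\<^sup>2))
        * (2 * ennreal (K * h') * oscillation M u T T' + 2 * ennreal h * oscillation M u T' W)
      = ennreal (2 * K) * (ennreal (1 / h\<^sup>2) * oscillation M u T T')
        + ennreal (2 / (h' * h)) * oscillation M u T' W"
  proof -
    have two: "(2::ennreal) = ennreal 2" by simp
    have 1: "ennreal (1 / (h' * h\<^sup>2)) * 2 * ennreal (K * h') = ennreal (2 * K) * ennreal (1 / h\<^sup>2)"
      unfolding two using h K by (simp add: ennreal_mult[symmetric] del: ennreal_numeral)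
    have 2: "ennreal (1 / (h' * h\<^sup>2)) * 2 * ennreal h = ennreal (2 / (h' * h))"
      unfolding two using h by (simp add: ennreal_mult[symmetric] power2_eq_square del: ennreal_numeral)
    show ?thesis unfolding distrib_left mult.assoc[symmetric] 1 2 ..
  qed
  also have "\<dots> \<le> ennreal (2 * K) * (ennreal (1 / h\<^sup>2) * oscillation M u T T')
        + ennreal (2 * \<kappa>) * (ennreal (1 / h'\<^sup>2) * oscillation M u T' W)"
  proof (rule add_left_mono)
    have "2 / (h' * h) \<le> 2 * \<kappa> * (1 / h'\<^sup>2)"
      using h hh by (simp add: field_simps power2_eq_square)
    then have "ennreal (2 / (h' * h)) \<le> ennreal (2 * \<kappa> * (1 / h'\<^sup>2))" by (rule ennreal_leI)
    also have "\<dots> = ennreal (2 * \<kappa>) * ennreal (1 / h'\<^sup>2)"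
      using kappa by (intro ennreal_mult) auto
    finally show "ennreal (2 / (h' * h)) * oscillation M u T' W
      \<le> ennreal (2 * \<kappa>) * (ennreal (1 / h'\<^sup>2) * oscillation M u T' W)"
      unfolding mult.assoc[symmetric] by (rule mult_right_mono) simp
  qed
  finally show ?thesis by (simp only: h_def h'_def K_def W_def)
qed

lemma sum_oscillation_patches:
  assumes u: "u \<in> borel_measurable M"
  shows "(\<Sum>T\<in>\<T>. scaled_osc u T (elem_patch \<T> m T))
    \<le> ennreal (oscillation_const N \<kappa> D m) * (\<Sum>z\<in>\<N>. node_seminorm_sq u z)"
proof (induction m)
  case 0
  have "(\<Sum>T\<in>\<T>. scaled_osc u T (elem_patch \<T> 0 T))
    \<le> (\<Sum>T\<in>\<T>. \<Sum>T'\<in>neighbours T. scaled_osc u T T')"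
  proof (rule sum_mono)
    fix T assume T: "T \<in> \<T>"
    show "scaled_osc u T (elem_patch \<T> 0 T)
      \<le> (\<Sum>T'\<in>neighbours T. scaled_osc u T T')"
      unfolding elem_patch.simps
      by (rule member_le_sum[of T _ "\<lambda>T'. scaled_osc u T T'"])
        (use T element_nonempty finite_elements in auto)
  qed
  also note sum_oscillation_neighbours[OF u]
  finally show ?case by simp
next
  case (Suc m)
  define K where "K = (real (N * N) * \<kappa>) ^ m"
  define C where "C = oscillation_const N \<kappa> D m"
  define G where "G = real (N * N) * (D * (1 + \<kappa>))\<^sup>2"
  define S where "S = (\<Sum>z\<in>\<N>. node_seminorm_sq u z)"
  have nonneg: "0 \<le> K" "0 \<le> C" "0 \<le> G"
    using kappa oscillation_const_nonneg by (auto simp: K_def C_def G_def)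
  have "(\<Sum>T\<in>\<T>. scaled_osc u T (elem_patch \<T> (Suc m) T))
    \<le> (\<Sum>T\<in>\<T>. \<Sum>T'\<in>neighbours T. ennreal (2 * K) * (scaled_osc u T T')
        + ennreal (2 * \<kappa>) * (scaled_osc u T' (elem_patch \<T> m T')))"
  proof (rule sum_mono)
    fix T assume T: "T \<in> \<T>"
    have fin: "finite (neighbours T)" using finite_elements by simp
    have "oscillation M u T (elem_patch \<T> (Suc m) T)
      \<le> (\<integral>\<^sup>+x\<in>T. (\<Sum>T'\<in>neighbours T. \<integral>\<^sup>+y\<in>elem_patch \<T> m T'. ennreal ((u x - u y)\<^sup>2) \<partial>M) \<partial>M)"
      unfolding oscillation_def
      by (intro set_nn_integral_mono_set[OF order_refl] set_nn_integral_cover[OF fin elem_patch_Suc_subset[OF T]])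
        (use u elem_patch_sets in auto)
    also have "\<dots> = (\<Sum>T'\<in>neighbours T. oscillation M u T (elem_patch \<T> m T'))"
      unfolding oscillation_def sum_distrib_right
    proof (rule nn_integral_sum)
      fix T' assume T': "T' \<in> neighbours T"
      note [measurable] = u elem_patch_sets element_sets[OF T]
      have [measurable]: "elem_patch \<T> m T' \<in> sets M" using T' by (auto intro: elem_patch_sets)
      show "(\<lambda>x. (\<integral>\<^sup>+y\<in>elem_patch \<T> m T'. ennreal ((u x - u y)\<^sup>2) \<partial>M) * indicator T x) \<in> borel_measurable M"
        by (intro borel_measurable_times_ennreal borel_measurable_set_nn_integral) measurable
    qed
    finally have "scaled_osc u T (elem_patch \<T> (Suc m) T)
      \<le> (\<Sum>T'\<in>neighbours T. scaled_osc u T (elem_patch \<T> m T'))"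
      unfolding sum_distrib_left[symmetric] by (rule mult_left_mono) simp
    also have "\<dots> \<le> (\<Sum>T'\<in>neighbours T. ennreal (2 * K) * (scaled_osc u T T')
        + ennreal (2 * \<kappa>) * (scaled_osc u T' (elem_patch \<T> m T')))"
      unfolding K_def by (intro sum_mono oscillation_patch_step T u) auto
    finally show "scaled_osc u T (elem_patch \<T> (Suc m) T)
      \<le> (\<Sum>T'\<in>neighbours T. ennreal (2 * K) * (scaled_osc u T T')
        + ennreal (2 * \<kappa>) * (scaled_osc u T' (elem_patch \<T> m T')))" .
  qed
  also have "\<dots> = ennreal (2 * K) * (\<Sum>T\<in>\<T>. \<Sum>T'\<in>neighbours T. scaled_osc u T T')
      + ennreal (2 * \<kappa>) * (\<Sum>T\<in>\<T>. \<Sum>T'\<in>neighbours T. scaled_osc u T' (elem_patch \<T> m T'))"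
    by (simp only: sum.distrib sum_distrib_left)
  also have "\<dots> \<le> ennreal (2 * K) * (ennreal G * S) + ennreal (2 * \<kappa>) * (of_nat (N * N) * (ennreal C * S))"
  proof (intro add_mono mult_left_mono)
    show "(\<Sum>T\<in>\<T>. \<Sum>T'\<in>neighbours T. scaled_osc u T T') \<le> ennreal G * S"
      unfolding G_def S_def by (rule sum_oscillation_neighbours[OF u])
    have "(\<Sum>T\<in>\<T>. \<Sum>T'\<in>neighbours T. scaled_osc u T' (elem_patch \<T> m T'))
        \<le> of_nat (N * N) * (\<Sum>T\<in>\<T>. scaled_osc u T (elem_patch \<T> m T))"
      by (rule sum_over_neighbours)
    also have "\<dots> \<le> of_nat (N * N) * (ennreal C * S)"
      using Suc.IH unfolding C_def S_def by (rule mult_left_mono) simp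
    finally show "(\<Sum>T\<in>\<T>. \<Sum>T'\<in>neighbours T. scaled_osc u T' (elem_patch \<T> m T'))
        \<le> of_nat (N * N) * (ennreal C * S)" .
  qed auto
  also have "\<dots> = ennreal (2 * K * G + 2 * (\<kappa> * real (N * N)) * C) * S"
    using nonneg kappa
    by (simp add: ennreal_plus ennreal_mult ennreal_of_nat_eq_real_of_nat[symmetric] distrib_right mult.assoc
        del: of_nat_mult)
  finally show ?case by (simp only: K_def G_def C_def S_def oscillation_const.simps)
qed

text \<open>
  Averaging the distance of \<open>u\<close> from constants over the constants \<open>u x\<close> with \<open>x\<close> in the element
  turns the hypothesis into a bound of the \<open>L\<^sup>2\<close> norm by the oscillation.
\<close>
lemma sum_L2_elements:
  assumes u: "u \<in> borel_measurable M" and q: "0 < q"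
    and far: "\<And>T. T \<in> \<T> \<Longrightarrow> \<exists>S. T \<subseteq> S \<and> S \<subseteq> elem_patch \<T> m T \<and>
      far_from_constants M q u S"
  shows "scaled_L2_sq u
    \<le> ennreal (oscillation_const N \<kappa> D m / q) * (\<Sum>z\<in>\<N>. node_seminorm_sq u z)"
proof -
  have local: "ennreal (1 / measure M T) * L2_sq_on M u T
      \<le> ennreal (1 / q) * (scaled_osc u T (elem_patch \<T> m T))"
    if T: "T \<in> \<T>" for T
  proof -
    define h where "h = measure M T"
    define I where "I = L2_sq_on M u T"
    have h: "0 < h" using element_pos[OF T] by (simp add: h_def)
    obtain S where S: "T \<subseteq> S" "S \<subseteq> elem_patch \<T> m T"
      and c: "\<And>c. ennreal q * L2_sq_on M u S \<le> (\<integral>\<^sup>+y\<in>S. ennreal ((u y - c)\<^sup>2) \<partial>M)"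
      using far[OF T] by blast
    have "ennreal h * (ennreal q * I) = (ennreal q * I) * emeasure M T"
      by (simp only: emeasure_element[OF T] h_def mult.commute)
    also have "\<dots> = (\<integral>\<^sup>+x\<in>T. ennreal q * I \<partial>M)"
      using element_sets[OF T] by (simp add: nn_integral_cmult_indicator)
    also have "\<dots> \<le> oscillation M u T (elem_patch \<T> m T)"
      unfolding oscillation_def
    proof (rule set_nn_integral_mono_set[OF order_refl])
      fix x
      have "ennreal q * I \<le> ennreal q * L2_sq_on M u S"
        unfolding I_def by (intro mult_left_mono set_nn_integral_mono_set S) auto
      also have "\<dots> \<le> (\<integral>\<^sup>+y\<in>S. ennreal ((u y - u x)\<^sup>2) \<partial>M)" by (rule c)
      also have "\<dots> \<le> (\<integral>\<^sup>+y\<in>elem_patch \<T> m T. ennreal ((u x - u y)\<^sup>2) \<partial>M)"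
        by (intro set_nn_integral_mono_set S) (simp add: power2_commute)
      finally show "ennreal q * I \<le> (\<integral>\<^sup>+y\<in>elem_patch \<T> m T. ennreal ((u x - u y)\<^sup>2) \<partial>M)" .
    qed
    finally have "ennreal (1 / (q * h\<^sup>2)) * (ennreal h * (ennreal q * I))
        \<le> ennreal (1 / (q * h\<^sup>2)) * oscillation M u T (elem_patch \<T> m T)"
      by (rule mult_left_mono) simp
    moreover have "ennreal (1 / (q * h\<^sup>2)) * (ennreal h * (ennreal q * I)) = ennreal (1 / h) * I"
    proof -
      have "ennreal (1 / (q * h\<^sup>2)) * (ennreal h * ennreal q) = ennreal (1 / h)"
        using h q by (simp add: ennreal_mult[symmetric] power2_eq_square)
      then show ?thesis by (simp only: mult.assoc[symmetric])
    qed
    moreover have "ennreal (1 / (q * h\<^sup>2)) = ennreal (1 / q) * ennreal (1 / h\<^sup>2)"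
      using h q by (simp add: ennreal_mult[symmetric])
    ultimately show ?thesis by (simp only: mult.assoc I_def h_def)
  qed
  have "scaled_L2_sq u
    \<le> ennreal (1 / q) * (\<Sum>T\<in>\<T>. scaled_osc u T (elem_patch \<T> m T))"
    unfolding sum_distrib_left by (rule sum_mono) (rule local)
  also have "\<dots> \<le> ennreal (1 / q) * (ennreal (oscillation_const N \<kappa> D m) * (\<Sum>z\<in>\<N>. node_seminorm_sq u z))"
    by (intro mult_left_mono sum_oscillation_patches u) simp
  also have "\<dots> = ennreal (oscillation_const N \<kappa> D m / q) * (\<Sum>z\<in>\<N>. node_seminorm_sq u z)"
    using q kappa oscillation_const_nonneg[of \<kappa> N D m]
    by (simp add: mult.assoc[symmetric] ennreal_mult[symmetric])
  finally show ?thesis .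
qed

end

section \<open>Distant elements and the global norm\<close>

context graded_partition begin

text \<open>
  On the dyadic annulus of radius \<open>2 ^ k * \<rho>\<close> the kernel is at most \<open>(2 ^ k * \<rho>)\<^sup>-\<^sup>2\<close>, while the measure
  of the annulus grows only linearly in its radius.
\<close>
lemma inverse_square_tail:
  assumes x: "x \<in> space M" and rho: "0 < \<rho>"
  shows "(\<integral>\<^sup>+y\<in>{y \<in> space M. \<rho> \<le> dist x y}. ennreal (1 / (dist x y)\<^sup>2) \<partial>M) \<le> ennreal (4 * A / \<rho>)"
proof -
  define B where "B k = cball x (2 ^ Suc k * \<rho>) \<inter> space M" for k :: nat
  define c where "c k = 1 / (2 ^ k * \<rho>)\<^sup>2" for k :: nat
  have B[measurable]: "B k \<in> sets M" for k
  proof -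
    have "(\<lambda>y. y) -` cball x (2 ^ Suc k * \<rho>) \<inter> space M \<in> sets M"
      by (intro measurable_sets[OF borel_id]) auto
    then show ?thesis by (simp add: B_def)
  qed
  have term_le: "f k \<le> (\<Sum>k. f k)" for f :: "nat \<Rightarrow> ennreal" and k
    using sum_le_suminf[OF summableI, of "{k}" f] by simp
  have pt: "ennreal (1 / (dist x y)\<^sup>2) * indicator {y \<in> space M. \<rho> \<le> dist x y} y
      \<le> (\<Sum>k. ennreal (c k) * indicator (B k) y)" for y
  proof (cases "y \<in> space M \<and> \<rho> \<le> dist x y")
    case True
    define P where "P n \<longleftrightarrow> dist x y < 2 ^ n * \<rho>" for n :: nat
    obtain n0 where "dist x y / \<rho> < 2 ^ n0" using real_arch_pow[of 2 "dist x y / \<rho>"] by auto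
    then have "P n0" using rho by (simp add: P_def pos_divide_less_eq)
    moreover have "\<not> P 0" using True by (simp add: P_def)
    moreover have "\<not> P n" if "\<not> P 0" "\<And>k. \<not> P k \<Longrightarrow> \<not> P (Suc k)" for n
      using that by (induction n) auto
    ultimately obtain k where k: "\<not> P k" "P (Suc k)" by blast
    have "2 ^ k * \<rho> \<le> dist x y" using k(1) by (simp add: P_def)
    moreover have "0 < 2 ^ k * \<rho>" using rho by simp
    ultimately have pos: "0 < dist x y" and le: "2 ^ k * \<rho> \<le> dist x y" by linarith+
    from le have "1 / (dist x y)\<^sup>2 \<le> c k"
      unfolding c_def using rho pos by (intro divide_left_mono power_mono mult_pos_pos) auto
    moreover have "y \<in> B k" using k(2) True by (simp add: B_def P_def)
    ultimately have "ennreal (1 / (dist x y)\<^sup>2) * indicator {y \<in> space M. \<rho> \<le> dist x y} y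
        \<le> ennreal (c k) * indicator (B k) y" using True by (simp add: ennreal_leI)
    also have "\<dots> \<le> (\<Sum>k. ennreal (c k) * indicator (B k) y)"
      by (rule term_le)
    finally show ?thesis .
  qed (auto simp: indicator_def)
  have "(\<integral>\<^sup>+y\<in>{y \<in> space M. \<rho> \<le> dist x y}. ennreal (1 / (dist x y)\<^sup>2) \<partial>M)
      \<le> (\<integral>\<^sup>+y. (\<Sum>k. ennreal (c k) * indicator (B k) y) \<partial>M)"
    by (rule nn_integral_mono) (rule pt)
  also have "\<dots> = (\<Sum>k. ennreal (c k) * emeasure M (B k))"
    by (subst nn_integral_suminf) (auto simp: nn_integral_cmult_indicator)
  also have "\<dots> \<le> (\<Sum>k. ennreal (2 * A / \<rho> * (1 / 2) ^ k))"
  proof (rule suminf_le)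
    fix k
    have "emeasure M (B k) \<le> ennreal (A * (2 ^ Suc k * \<rho>))"
      unfolding B_def using x rho by (intro upper_regular) auto
    then have "ennreal (c k) * emeasure M (B k) \<le> ennreal (c k) * ennreal (A * (2 ^ Suc k * \<rho>))"
      by (rule mult_left_mono) simp
    also have "\<dots> = ennreal (c k * (A * (2 ^ Suc k * \<rho>)))"
      using rho regular_const by (intro ennreal_mult[symmetric]) (auto simp: c_def)
    also have "c k * (A * (2 ^ Suc k * \<rho>)) = 2 * A / \<rho> * (1 / 2) ^ k"
      using rho by (simp add: c_def power2_eq_square power_one_over field_simps)
    finally show "ennreal (c k) * emeasure M (B k) \<le> ennreal (2 * A / \<rho> * (1 / 2) ^ k)" .
  qed auto
  also have "\<dots> = ennreal (2 * A / \<rho> * 2)"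
  proof (rule suminf_ennreal_eq)
    show "0 \<le> 2 * A / \<rho> * (1 / 2) ^ k" for k :: nat using rho regular_const by simp
    have "(\<lambda>k. (1 / 2 :: real) ^ k) sums 2" using geometric_sums[of "1 / 2 :: real"] by simp
    then show "(\<lambda>k. 2 * A / \<rho> * (1 / 2) ^ k) sums (2 * A / \<rho> * 2)" by (rule sums_mult)
  qed
  finally show ?thesis by simp
qed

lemma borel_measurable_weighted_kernel:
  assumes [measurable]: "u \<in> borel_measurable M"
  shows "(\<lambda>(x, y). ennreal ((u x)\<^sup>2) * ennreal (1 / (dist x y)\<^sup>2)) \<in> borel_measurable (M \<Otimes>\<^sub>M M)"
proof -
  note [measurable] = borel_measurable_dist_pair
  have "(\<lambda>p. ennreal ((u (fst p))\<^sup>2) * ennreal (1 / (dist (fst p) (snd p))\<^sup>2)) \<in> borel_measurable (M \<Otimes>\<^sub>M M)"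
    by measurable
  then show ?thesis by (simp add: case_prod_unfold)
qed

text \<open>
  For disjoint elements \<open>(u x - u y)\<^sup>2\<close> is split into its two summands. Each is integrated against
  the tail of the kernel, whose integral is of the order of the reciprocal length of the element.
\<close>
lemma sum_kernel_disjoint:
  assumes u: "u \<in> borel_measurable M"
  shows "(\<Sum>T\<in>\<T>. \<Sum>T'\<in>{T' \<in> \<T>. T \<inter> T' = {}}. interaction u T T')
    \<le> ennreal (16 * real N * A / \<delta>) * scaled_L2_sq u"
proof -
  define w where "w x y = ennreal (1 / (dist x y)\<^sup>2)" for x y :: 'a
  define s where "s x = ennreal ((u x)\<^sup>2)" for x
  define F where "F T T' = (\<integral>\<^sup>+x\<in>T. (\<integral>\<^sup>+y\<in>T'. s x * w x y \<partial>M) \<partial>M)" for T T'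
  let ?far = "\<lambda>T. {T' \<in> \<T>. T \<inter> T' = {}}"
  note wk = borel_measurable_weighted_kernel[OF u, folded s_def w_def]
  have sm[measurable]: "s \<in> borel_measurable M" using u unfolding s_def by measurable
  have wm: "w x \<in> borel_measurable M" if "x \<in> space M" for x
  proof -
    have [measurable]: "(\<lambda>y. dist x y) \<in> borel_measurable M"
      by (intro borel_measurable_dist borel_id measurable_const) simp
    show ?thesis unfolding w_def by measurable
  qed
  have pair: "interaction u T T' \<le> 2 * F T T' + 2 * F T' T"
    if T: "T \<in> \<T>" "T' \<in> \<T>" for T T'
  proof -
    note [measurable] = element_sets[OF T(1)] element_sets[OF T(2)]
    have pt: "quotient_sq u x y \<le> 2 * (s x * w x y) + 2 * (s y * w y x)" for x y
    proof -
      have "(u x - u y)\<^sup>2 \<le> 2 * (u x)\<^sup>2 + 2 * (u y)\<^sup>2"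
        using sum_squares_bound[of "u x" "- u y"] by (simp add: power2_diff)
      then have "\<bar>u x - u y\<bar>\<^sup>2 / (dist x y)\<^sup>2 \<le> (2 * (u x)\<^sup>2 + 2 * (u y)\<^sup>2) / (dist x y)\<^sup>2"
        by (intro divide_right_mono) auto
      also have "\<dots> = 2 * ((u x)\<^sup>2 * (1 / (dist x y)\<^sup>2)) + 2 * ((u y)\<^sup>2 * (1 / (dist y x)\<^sup>2))"
        by (simp add: add_divide_distrib dist_commute)
      finally have "quotient_sq u x y
        \<le> ennreal (2 * ((u x)\<^sup>2 * (1 / (dist x y)\<^sup>2)) + 2 * ((u y)\<^sup>2 * (1 / (dist y x)\<^sup>2)))"
        by (rule ennreal_leI)
      also have "\<dots> = ennreal (2 * ((u x)\<^sup>2 * (1 / (dist x y)\<^sup>2))) + ennreal (2 * ((u y)\<^sup>2 * (1 / (dist y x)\<^sup>2)))"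
        by (rule ennreal_plus) auto
      also have "\<dots> = 2 * (s x * w x y) + 2 * (s y * w y x)"
        unfolding s_def w_def by (simp only: ennreal_mult ennreal_numeral zero_le_power2 zero_le_numeral
          mult_nonneg_nonneg divide_nonneg_nonneg zero_le_one)
      finally show ?thesis .
    qed
    have m1: "(\<lambda>(x, y). s y * w y x) \<in> borel_measurable (M \<Otimes>\<^sub>M M)"
      using measurable_pair_swap[OF wk] by (simp add: case_prod_unfold)
    have swap: "F T' T = (\<integral>\<^sup>+x\<in>T. (\<integral>\<^sup>+y\<in>T'. s y * w y x \<partial>M) \<partial>M)"
      unfolding F_def by (rule set_nn_integral_swap[OF wk]) auto
    have "interaction u T T'
      \<le> (\<integral>\<^sup>+x. 2 * ((\<integral>\<^sup>+y\<in>T'. s x * w x y \<partial>M) * indicator T x)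
          + 2 * ((\<integral>\<^sup>+y\<in>T'. s y * w y x \<partial>M) * indicator T x) \<partial>M)"
    proof (rule nn_integral_mono)
      fix x assume x: "x \<in> space M"
      have 1: "(\<lambda>y. s x * w x y * indicator T' y) \<in> borel_measurable M"
        using measurable_compose_Pair1[OF x wk]
        by (intro borel_measurable_times_ennreal[of "\<lambda>y. s x * w x y"]) auto
      have 2: "(\<lambda>y. s y * w y x * indicator T' y) \<in> borel_measurable M"
        using measurable_compose_Pair1[OF x m1]
        by (intro borel_measurable_times_ennreal[of "\<lambda>y. s y * w y x"]) auto
      have "(\<integral>\<^sup>+y\<in>T'. quotient_sq u x y \<partial>M)
        \<le> 2 * (\<integral>\<^sup>+y\<in>T'. s x * w x y \<partial>M) + 2 * (\<integral>\<^sup>+y\<in>T'. s y * w y x \<partial>M)"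
        using pt by (intro nn_integral_le_affine 1 2) (auto simp: indicator_def)
      then show "(\<integral>\<^sup>+y\<in>T'. quotient_sq u x y \<partial>M) * indicator T x
        \<le> 2 * ((\<integral>\<^sup>+y\<in>T'. s x * w x y \<partial>M) * indicator T x)
          + 2 * ((\<integral>\<^sup>+y\<in>T'. s y * w y x \<partial>M) * indicator T x)"
        by (simp add: indicator_def)
    qed
    also have "\<dots> \<le> 2 * F T T' + 2 * F T' T"
      unfolding swap unfolding F_def
      by (intro nn_integral_le_affine order_refl borel_measurable_times_ennreal
          borel_measurable_set_nn_integral[OF wk] borel_measurable_set_nn_integral[OF m1]) auto
    finally show ?thesis .
  qed
  have row: "(\<Sum>T'\<in>?far T. F T T') \<le> ennreal (4 * real N * A / \<delta>) * (ennreal (1 / measure M T) * (\<integral>\<^sup>+x\<in>T. s x \<partial>M))"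
    if T: "T \<in> \<T>" for T
  proof -
    define h where "h = measure M T"
    have h: "0 < h" using element_pos[OF T] by (simp add: h_def)
    note [measurable] = element_sets[OF T]
    have "(\<Sum>T'\<in>?far T. F T T') = (\<integral>\<^sup>+x\<in>T. (\<Sum>T'\<in>?far T. \<integral>\<^sup>+y\<in>T'. s x * w x y \<partial>M) \<partial>M)"
      unfolding F_def sum_distrib_right
      by (intro nn_integral_sum[symmetric] borel_measurable_times_ennreal
          borel_measurable_set_nn_integral[OF wk]) (auto intro: element_sets)
    also have "\<dots> \<le> (\<integral>\<^sup>+x\<in>T. ennreal (4 * real N * A / \<delta>) * ennreal (1 / h) * s x \<partial>M)"
    proof (rule set_nn_integral_mono_set[OF order_refl])
      fix x assume xT: "x \<in> T"
      then have x: "x \<in> space M" using element_space T by blast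
      note [measurable] = wm[OF x]
      define P where "P = {y \<in> space M. \<delta> * h \<le> dist x y}"
      have "(\<lambda>y. y) -` {y. \<delta> * h \<le> dist x y} \<inter> space M \<in> sets M"
        by (intro measurable_sets[OF borel_id] borel_closed closed_Collect_le) (auto intro!: continuous_intros)
      then have [measurable]: "P \<in> sets M"
        by (simp add: P_def Int_def vimage_def conj_commute)
      have "(\<Sum>T'\<in>?far T. \<integral>\<^sup>+y\<in>T'. s x * w x y \<partial>M) = (\<Sum>T'\<in>?far T. s x * (\<integral>\<^sup>+y\<in>T'. w x y \<partial>M))"
        unfolding mult.assoc
        by (intro sum.cong refl nn_integral_cmult borel_measurable_times_ennreal borel_measurable_indicator)
          (auto intro: element_sets wm x)
      also have "\<dots> = s x * (\<Sum>T'\<in>?far T. \<integral>\<^sup>+y\<in>T'. w x y \<partial>M)" by (simp only: sum_distrib_left)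
      also have "\<dots> \<le> s x * (of_nat N * (\<integral>\<^sup>+y\<in>P. w x y \<partial>M))"
      proof (intro mult_left_mono set_nn_integral_overlap)
        fix y assume y: "y \<in> space M"
        have "card {T' \<in> ?far T. y \<in> T'} \<le> card {T' \<in> \<T>. y \<in> T'}"
          using finite_elements by (intro card_mono) auto
        also have "\<dots> \<le> N" by (rule overlap[OF y])
        finally show "card {T' \<in> ?far T. y \<in> T'} \<le> N" .
      next
        fix T' assume "T' \<in> ?far T"
        then show "T' \<subseteq> P" "T' \<in> sets M"
          using separated[OF T _ _ xT, of T'] element_space[of T'] element_sets
          by (auto simp: P_def h_def)
      qed (use finite_elements in auto)
      also have "\<dots> \<le> s x * (of_nat N * ennreal (4 * A / (\<delta> * h)))"
        unfolding P_def w_def using x delta h by (intro mult_left_mono inverse_square_tail) auto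
      also have "\<dots> = ennreal (4 * real N * A / \<delta>) * ennreal (1 / h) * s x"
      proof -
        have "of_nat N * ennreal (4 * A / (\<delta> * h)) = ennreal (4 * real N * A / \<delta>) * ennreal (1 / h)"
          using regular_const delta h
          by (simp add: ennreal_of_nat_eq_real_of_nat ennreal_mult[symmetric] ac_simps)
        then show ?thesis by (simp only: ac_simps)
      qed
      finally show "(\<Sum>T'\<in>?far T. \<integral>\<^sup>+y\<in>T'. s x * w x y \<partial>M)
        \<le> ennreal (4 * real N * A / \<delta>) * ennreal (1 / h) * s x" .
    qed
    also have "\<dots> = ennreal (4 * real N * A / \<delta>) * ennreal (1 / h) * (\<integral>\<^sup>+x\<in>T. s x \<partial>M)"
      by (subst nn_integral_cmult[symmetric]) (auto simp: mult.assoc)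
    finally show ?thesis by (simp only: h_def mult.assoc)
  qed
  define Z where "Z = (\<Sum>T\<in>\<T>. ennreal (1 / measure M T) * (\<integral>\<^sup>+x\<in>T. s x \<partial>M))"
  have rows: "(\<Sum>T\<in>\<T>. \<Sum>T'\<in>?far T. F T T') \<le> ennreal (4 * real N * A / \<delta>) * Z"
    unfolding Z_def sum_distrib_left by (rule sum_mono) (rule row)
  have cols: "(\<Sum>T\<in>\<T>. \<Sum>T'\<in>?far T. F T' T) = (\<Sum>T\<in>\<T>. \<Sum>T'\<in>?far T. F T T')"
    by (subst sum.swap_restrict[OF finite_elements finite_elements]) (simp add: Int_commute)
  have "(\<Sum>T\<in>\<T>. \<Sum>T'\<in>?far T. interaction u T T')
    \<le> (\<Sum>T\<in>\<T>. \<Sum>T'\<in>?far T. 2 * F T T' + 2 * F T' T)"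
    by (intro sum_mono pair) auto
  also have "\<dots> = 2 * (\<Sum>T\<in>\<T>. \<Sum>T'\<in>?far T. F T T') + 2 * (\<Sum>T\<in>\<T>. \<Sum>T'\<in>?far T. F T' T)"
    by (simp only: sum.distrib sum_distrib_left)
  also have "\<dots> = ennreal 4 * (\<Sum>T\<in>\<T>. \<Sum>T'\<in>?far T. F T T')"
    unfolding cols by (simp add: distrib_right[symmetric])
  also have "\<dots> \<le> ennreal 4 * (ennreal (4 * real N * A / \<delta>) * Z)"
    by (intro mult_left_mono rows) simp
  also have "\<dots> = ennreal (16 * real N * A / \<delta>) * Z"
    using regular_const delta unfolding mult.assoc[symmetric]
    by (subst ennreal_mult[symmetric]) (auto simp: mult.assoc)
  finally show ?thesis by (simp only: Z_def s_def)
qed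

text \<open>
  Pairs of points in touching elements are seen by a node patch. For all other pairs the kernel is
  not singular and the \<open>L\<^sup>2\<close> norm suffices, scaled by the reciprocal length of the element.
\<close>
lemma H12_semi_sq_le:
  assumes u: "u \<in> borel_measurable M"
  shows "H12_semi_sq M u \<le> of_nat (N * N) * (\<Sum>z\<in>\<N>. node_seminorm_sq u z)
    + ennreal (16 * real N * A / \<delta>) * scaled_L2_sq u"
proof -
  note kernel = borel_measurable_Gagliardo_kernel[OF u]
  define k where "k x y = quotient_sq u x y" for x y
  note km = kernel[folded k_def]
  define I where "I T T' = (\<integral>\<^sup>+x\<in>T. (\<integral>\<^sup>+y\<in>T'. k x y \<partial>M) \<partial>M)" for T T'
  have cov: "space M \<subseteq> (\<Union>T\<in>\<T>. T)" using cover by simp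
  have "H12_semi_sq M u = (\<integral>\<^sup>+x\<in>space M. (\<integral>\<^sup>+y\<in>space M. k x y \<partial>M) \<partial>M)"
    unfolding H12_semi_sq_def k_def by (intro nn_integral_cong) (simp cong: nn_integral_cong)
  also have "\<dots> \<le> (\<Sum>T\<in>\<T>. \<integral>\<^sup>+x\<in>T. (\<integral>\<^sup>+y\<in>space M. k x y \<partial>M) \<partial>M)"
    by (intro set_nn_integral_cover[OF finite_elements cov] borel_measurable_set_nn_integral[OF km])
      (auto intro: element_sets)
  also have "\<dots> \<le> (\<Sum>T\<in>\<T>. \<integral>\<^sup>+x\<in>T. (\<Sum>T'\<in>\<T>. \<integral>\<^sup>+y\<in>T'. k x y \<partial>M) \<partial>M)"
    by (intro sum_mono set_nn_integral_mono_set[OF order_refl] set_nn_integral_cover[OF finite_elements cov])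
      (use element_space element_sets measurable_compose_Pair1[OF _ km] in auto)
  also have "\<dots> = (\<Sum>T\<in>\<T>. \<Sum>T'\<in>\<T>. I T T')"
    unfolding I_def sum_distrib_right
    by (intro sum.cong refl nn_integral_sum borel_measurable_times_ennreal
        borel_measurable_set_nn_integral[OF km] borel_measurable_indicator) (auto intro: element_sets)
  also have "\<dots> = (\<Sum>T\<in>\<T>. (\<Sum>T'\<in>neighbours T. I T T') + (\<Sum>T'\<in>{T' \<in> \<T>. T \<inter> T' = {}}. I T T'))"
  proof (rule sum.cong[OF refl])
    fix T
    have "\<T> = neighbours T \<union> {T' \<in> \<T>. T \<inter> T' = {}}" by blast
    then have "(\<Sum>T'\<in>\<T>. I T T') = (\<Sum>T'\<in>neighbours T \<union> {T' \<in> \<T>. T \<inter> T' = {}}. I T T')" by simp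
    also have "\<dots> = (\<Sum>T'\<in>neighbours T. I T T') + (\<Sum>T'\<in>{T' \<in> \<T>. T \<inter> T' = {}}. I T T')"
      by (rule sum.union_disjoint) (use finite_elements in auto)
    finally show "(\<Sum>T'\<in>\<T>. I T T')
      = (\<Sum>T'\<in>neighbours T. I T T') + (\<Sum>T'\<in>{T' \<in> \<T>. T \<inter> T' = {}}. I T T')" .
  qed
  also have "\<dots> = (\<Sum>T\<in>\<T>. \<Sum>T'\<in>neighbours T. I T T')
      + (\<Sum>T\<in>\<T>. \<Sum>T'\<in>{T' \<in> \<T>. T \<inter> T' = {}}. I T T')" by (rule sum.distrib)
  also have "\<dots> \<le> of_nat (N * N) * (\<Sum>z\<in>\<N>. node_seminorm_sq u z)
    + ennreal (16 * real N * A / \<delta>) * scaled_L2_sq u"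
  proof (rule add_mono)
    have "(\<Sum>T\<in>\<T>. \<Sum>T'\<in>neighbours T. I T T')
      \<le> (\<Sum>T\<in>\<T>. \<Sum>T'\<in>\<T>. \<Sum>z\<in>{z \<in> \<N>. z \<in> T \<inter> T'}. node_seminorm_sq u z)"
    proof (rule sum_mono)
      fix T assume T: "T \<in> \<T>"
      have "(\<Sum>T'\<in>neighbours T. I T T')
        \<le> (\<Sum>T'\<in>neighbours T. \<Sum>z\<in>{z \<in> \<N>. z \<in> T \<inter> T'}. node_seminorm_sq u z)"
        unfolding I_def k_def by (intro sum_mono kernel_meeting_le T u) auto
      also have "\<dots> \<le> (\<Sum>T'\<in>\<T>. shared_seminorm_sq u T T')"
        by (rule sum_mono2) (use finite_elements in auto)
      finally show "(\<Sum>T'\<in>neighbours T. I T T')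
        \<le> (\<Sum>T'\<in>\<T>. shared_seminorm_sq u T T')" .
    qed
    also have "\<dots> \<le> of_nat (N * N) * (\<Sum>z\<in>\<N>. node_seminorm_sq u z)"
      by (intro double_sum_over_common_points finite_elements finite_nodes node_card)
    finally show "(\<Sum>T\<in>\<T>. \<Sum>T'\<in>neighbours T. I T T')
      \<le> of_nat (N * N) * (\<Sum>z\<in>\<N>. node_seminorm_sq u z)" .
  qed (unfold I_def k_def, rule sum_kernel_disjoint[OF u])
  finally show ?thesis .
qed

lemma L2_sq_le:
  assumes u: "u \<in> borel_measurable M"
  shows "L2_sq M u \<le> ennreal (measure M (space M))
    * scaled_L2_sq u"
proof -
  have "L2_sq M u = (\<integral>\<^sup>+x\<in>space M. ennreal ((u x)\<^sup>2) \<partial>M)"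
    unfolding L2_sq_def by (intro nn_integral_cong) simp
  also have "\<dots> \<le> (\<Sum>T\<in>\<T>. \<integral>\<^sup>+x\<in>T. ennreal ((u x)\<^sup>2) \<partial>M)"
    by (rule set_nn_integral_cover[OF finite_elements]) (use cover u element_sets in auto)
  also have "\<dots> \<le> (\<Sum>T\<in>\<T>. ennreal (measure M (space M))
    * (ennreal (1 / measure M T) * L2_sq_on M u T))"
  proof (rule sum_mono)
    fix T assume T: "T \<in> \<T>"
    have "measure M T \<le> measure M (space M)" by (rule bounded_measure)
    then have "1 \<le> measure M (space M) * (1 / measure M T)" using element_pos[OF T] by simp
    then have "ennreal 1 \<le> ennreal (measure M (space M) * (1 / measure M T))" by (rule ennreal_leI)
    then have "1 \<le> ennreal (measure M (space M)) * ennreal (1 / measure M T)"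
      by (subst (asm) ennreal_mult) auto
    from mult_right_mono[OF this, of "\<integral>\<^sup>+x\<in>T. ennreal ((u x)\<^sup>2) \<partial>M"]
    show "L2_sq_on M u T \<le> ennreal (measure M (space M))
      * (ennreal (1 / measure M T) * L2_sq_on M u T)"
      by (simp add: mult.assoc)
  qed
  finally show ?thesis by (simp only: sum_distrib_left)
qed

text \<open>
  The seminorms on node patches control the full norm of functions that are locally far from
  constants; for constants the right-hand side vanishes, so some such condition is unavoidable.
\<close>
theorem H12_norm_sq_le_node_patches:
  assumes u: "u \<in> borel_measurable M" and q: "0 < q"
    and far: "\<And>T. T \<in> \<T> \<Longrightarrow> \<exists>S. T \<subseteq> S \<and> S \<subseteq> elem_patch \<T> m T \<and>
      far_from_constants M q u S"
  shows "L2_sq M u + H12_semi_sq M u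
    \<le> ennreal (real (N * N) + (measure M (space M) + 16 * real N * A / \<delta>) * (oscillation_const N \<kappa> D m / q))
      * (\<Sum>z\<in>\<N>. node_seminorm_sq u z)"
proof -
  define Z where "Z = scaled_L2_sq u"
  define S where "S = (\<Sum>z\<in>\<N>. node_seminorm_sq u z)"
  define mu where "mu = measure M (space M)"
  define a where "a = 16 * real N * A / \<delta>"
  define c where "c = oscillation_const N \<kappa> D m / q"
  have nn: "0 \<le> a" "0 \<le> c" "0 \<le> mu"
    using regular_const delta q kappa oscillation_const_nonneg[of \<kappa> N D m] by (auto simp: a_def c_def mu_def)
  have Z: "Z \<le> ennreal c * S" unfolding Z_def S_def c_def by (rule sum_L2_elements[OF u q far])
  have "L2_sq M u + H12_semi_sq M u \<le> ennreal mu * Z + (of_nat (N * N) * S + ennreal a * Z)"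
    unfolding Z_def S_def mu_def a_def by (rule add_mono[OF L2_sq_le[OF u] H12_semi_sq_le[OF u]])
  also have "\<dots> \<le> ennreal mu * (ennreal c * S) + (of_nat (N * N) * S + ennreal a * (ennreal c * S))"
    by (intro add_mono mult_left_mono Z order_refl) auto
  also have "\<dots> = (ennreal mu * ennreal c + (of_nat (N * N) + ennreal a * ennreal c)) * S"
    by (simp only: distrib_right mult.assoc)
  also have "ennreal mu * ennreal c + (of_nat (N * N) + ennreal a * ennreal c)
      = ennreal (real (N * N) + (mu + a) * c)"
    using nn by (simp add: ennreal_of_nat_eq_real_of_nat ennreal_mult[symmetric] ennreal_plus[symmetric] algebra_simps
        del: ennreal_plus)
  finally show ?thesis by (simp only: S_def mu_def a_def c_def)
qed

text \<open>
  A point lies in boundedly many node patches, because it lies in boundedly many elements and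
  each of them has boundedly many nodes.
\<close>
theorem sum_node_patches_le:
  assumes u: "u \<in> borel_measurable M"
  shows "(\<Sum>z\<in>\<N>. node_seminorm_sq u z) \<le> of_nat (N * N) * H12_semi_sq M u"
proof -
  note kernel = borel_measurable_Gagliardo_kernel[OF u]
  define g where "g x = (\<integral>\<^sup>+y. quotient_sq u x y \<partial>M)" for x
  have g: "g \<in> borel_measurable M" unfolding g_def using borel_measurable_nn_integral[OF kernel] by simp
  have "(\<Sum>z\<in>\<N>. node_seminorm_sq u z) \<le> (\<Sum>z\<in>\<N>. \<integral>\<^sup>+x\<in>node_patch \<T> z. g x \<partial>M)"
    unfolding H12_semi_sq_restrict[OF node_patch_sets] g_def
    by (intro sum_mono set_nn_integral_mono_set order_refl nn_integral_mono) (auto simp: indicator_def)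
  also have "\<dots> \<le> of_nat (N * N) * (\<integral>\<^sup>+x\<in>space M. g x \<partial>M)"
  proof (rule set_nn_integral_overlap[OF finite_nodes])
    fix x assume x: "x \<in> space M"
    have "{z \<in> \<N>. x \<in> node_patch \<T> z} = (\<Union>T\<in>{T \<in> \<T>. x \<in> T}. {z \<in> \<N>. z \<in> T})"
      by (auto simp: node_patch_def)
    then have "card {z \<in> \<N>. x \<in> node_patch \<T> z} \<le> (\<Sum>T\<in>{T \<in> \<T>. x \<in> T}. card {z \<in> \<N>. z \<in> T})"
      using finite_elements by (simp only:) (intro card_UN_le, auto)
    also have "\<dots> \<le> (\<Sum>T\<in>{T \<in> \<T>. x \<in> T}. N)" by (intro sum_mono few_nodes) auto
    also have "\<dots> \<le> N * N" using overlap[OF x] by simp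
    finally show "card {z \<in> \<N>. x \<in> node_patch \<T> z} \<le> N * N" .
  next
    show "node_patch \<T> z \<subseteq> space M" for z by (rule sets.sets_into_space) simp
  qed (use g in auto)
  also have "(\<integral>\<^sup>+x\<in>space M. g x \<partial>M) = H12_semi_sq M u"
    unfolding H12_semi_sq_def g_def by (intro nn_integral_cong) simp
  finally show ?thesis .
qed

end

section \<open>Strict one-sided derivatives and the chord-arc property\<close>

abbreviation increments_near ::
  "real set \<Rightarrow> (real \<Rightarrow> real^2) \<Rightarrow> real \<Rightarrow> real^2 \<Rightarrow> real \<Rightarrow> real \<Rightarrow> bool" where
  "increments_near S \<gamma> t0 v \<epsilon> \<delta> \<equiv>
     \<forall>s\<in>S. \<forall>t\<in>S. s \<le> t \<longrightarrow> \<bar>s - t0\<bar> < \<delta> \<longrightarrow> \<bar>t - t0\<bar> < \<delta> \<longrightarrow>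
        norm (\<gamma> t - \<gamma> s - (t - s) *\<^sub>R v) \<le> \<epsilon> * (t - s)"

text \<open>
  Strict differentiability relative to \<open>S\<close>: both end points of the increment may move. With
  \<open>S = {t0..}\<close> and \<open>S = {..t0}\<close> these are one-sided derivatives that control chords near \<open>t0\<close>,
  which the difference quotients at the single point \<open>t0\<close> would not.
\<close>
definition strict_deriv_on :: "real set \<Rightarrow> (real \<Rightarrow> real^2) \<Rightarrow> real \<Rightarrow> real^2 \<Rightarrow> bool" where
  "strict_deriv_on S \<gamma> t0 v \<longleftrightarrow>
     (\<forall>\<epsilon>>0. \<exists>\<delta>>0. increments_near S \<gamma> t0 v \<epsilon> \<delta>)"

text \<open>
  The mean value inequality for the path minus the linear motion with velocity \<open>v\<close>.
\<close>
lemma increment_bound: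
  fixes \<gamma> :: "real \<Rightarrow> real^2"
  assumes "s \<le> t"
    and deriv: "\<And>x. x \<in> {s..t} \<Longrightarrow> (\<gamma> has_vector_derivative \<gamma>' x) (at x within {s..t})"
    and bound: "\<And>x. x \<in> {s..t} \<Longrightarrow> norm (\<gamma>' x - v) \<le> B"
  shows "norm (\<gamma> t - \<gamma> s - (t - s) *\<^sub>R v) \<le> B * (t - s)"
proof -
  define g where "g x = \<gamma> x - x *\<^sub>R v" for x
  have "norm (g t - g s) \<le> B * norm (t - s)"
  proof (rule differentiable_bound)
    show "(g has_derivative (\<lambda>h. h *\<^sub>R (\<gamma>' x - v))) (at x within {s..t})" if "x \<in> {s..t}" for x
    proof -
      have "((\<lambda>x. x *\<^sub>R v) has_vector_derivative v) (at x within {s..t})"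
        unfolding has_vector_derivative_def by (auto intro!: derivative_eq_intros)
      then have "(g has_vector_derivative (\<gamma>' x - v)) (at x within {s..t})"
        unfolding g_def by (intro has_vector_derivative_diff deriv[OF that])
      then show ?thesis by (simp add: has_vector_derivative_def)
    qed
    show "onorm (\<lambda>h. h *\<^sub>R (\<gamma>' x - v)) \<le> B" if "x \<in> {s..t}" for x
      using mult_left_mono[OF bound[OF that] abs_ge_zero]
      by (intro onorm_le) (simp add: mult.commute)
  qed (use assms(1) in auto)
  then show ?thesis using assms(1) by (simp add: g_def algebra_simps)
qed

lemma C2_on_interval_strict_deriv:
  assumes "C2_on_interval p p' \<gamma>" "t0 \<in> {p..p'}"
  obtains v where "strict_deriv_on {p..p'} \<gamma> t0 v"
proof -
  obtain \<gamma>1 \<gamma>2 where d1: "\<And>x. x \<in> {p..p'} \<Longrightarrow> (\<gamma> has_vector_derivative \<gamma>1 x) (at x within {p..p'})"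
    and d2: "\<And>x. x \<in> {p..p'} \<Longrightarrow> (\<gamma>1 has_vector_derivative \<gamma>2 x) (at x within {p..p'})"
    using assms(1) unfolding C2_on_interval_def by blast
  have "continuous (at t0 within {p..p'}) \<gamma>1"
    using has_vector_derivative_continuous[OF d2[OF assms(2)]] .
  then have cont: "\<exists>d>0. \<forall>x\<in>{p..p'}. dist x t0 < d \<longrightarrow> dist (\<gamma>1 x) (\<gamma>1 t0) < e" if "e > 0" for e
    using that unfolding continuous_within_eps_delta by blast
  have "strict_deriv_on {p..p'} \<gamma> t0 (\<gamma>1 t0)"
    unfolding strict_deriv_on_def
  proof (intro allI impI)
    fix e :: real assume "e > 0"
    then obtain d where d: "d > 0" "\<And>x. x \<in> {p..p'} \<Longrightarrow> dist x t0 < d \<Longrightarrow> dist (\<gamma>1 x) (\<gamma>1 t0) < e"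
      using cont by blast
    show "\<exists>\<delta>>0. increments_near {p..p'} \<gamma> t0 (\<gamma>1 t0) e \<delta>"
    proof (intro exI[of _ d] conjI ballI impI d(1))
      fix s t assume st: "s \<in> {p..p'}" "t \<in> {p..p'}" "s \<le> t" "\<bar>s - t0\<bar> < d" "\<bar>t - t0\<bar> < d"
      have sub: "{s..t} \<subseteq> {p..p'}" using st by auto
      show "norm (\<gamma> t - \<gamma> s - (t - s) *\<^sub>R \<gamma>1 t0) \<le> e * (t - s)"
      proof (rule increment_bound[OF st(3)])
        fix x assume x: "x \<in> {s..t}"
        show "(\<gamma> has_vector_derivative \<gamma>1 x) (at x within {s..t})"
          using d1 x sub by (blast intro: has_vector_derivative_within_subset)
        have "dist x t0 < d" using x st by (auto simp: dist_real_def)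
        then show "norm (\<gamma>1 x - \<gamma>1 t0) \<le> e" using d(2)[of x] x sub by (auto simp: dist_norm)
      qed
    qed
  qed
  then show thesis by (rule that)
qed

lemma strict_deriv_on_local:
  assumes "strict_deriv_on S \<gamma> t0 v" and "r > 0" and "\<And>t. t \<in> S' \<Longrightarrow> \<bar>t - t0\<bar> < r \<Longrightarrow> t \<in> S"
  shows "strict_deriv_on S' \<gamma> t0 v"
  unfolding strict_deriv_on_def
proof (intro allI impI)
  fix e :: real assume "e > 0"
  then obtain d where d: "d > 0" "increments_near S \<gamma> t0 v e d"
    using assms(1) unfolding strict_deriv_on_def by blast
  then show "\<exists>\<delta>>0. increments_near S' \<gamma> t0 v e \<delta>"
    using assms(2,3) by (intro exI[of _ "min d r"]) auto
qed

lemma strict_deriv_on_has_vector_derivative: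
  assumes S: "strict_deriv_on S \<gamma> t0 v" and t0: "t0 \<in> S"
  shows "(\<gamma> has_vector_derivative v) (at t0 within S)"
  unfolding has_vector_derivative_def has_derivative_within_alt
proof (intro conjI allI impI)
  show "bounded_linear (\<lambda>x. x *\<^sub>R v)" by (rule bounded_linear_scaleR_left)
  fix e :: real assume "e > 0"
  then obtain d where d: "d > 0" "increments_near S \<gamma> t0 v e d"
    using S unfolding strict_deriv_on_def by blast
  show "\<exists>d>0. \<forall>y\<in>S. norm (y - t0) < d \<longrightarrow> norm (\<gamma> y - \<gamma> t0 - (y - t0) *\<^sub>R v) \<le> e * norm (y - t0)"
  proof (intro exI[of _ d] conjI ballI impI d(1))
    fix y assume y: "y \<in> S" "norm (y - t0) < d"
    have flip: "\<gamma> y - \<gamma> t0 - (y - t0) *\<^sub>R v = - (\<gamma> t0 - \<gamma> y - (t0 - y) *\<^sub>R v)"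
      by (simp add: algebra_simps)
    show "norm (\<gamma> y - \<gamma> t0 - (y - t0) *\<^sub>R v) \<le> e * norm (y - t0)"
    proof (cases "t0 \<le> y")
      case True
      then show ?thesis using d y t0 by auto
    next
      case False
      then show ?thesis unfolding flip norm_minus_cancel using d y t0 by auto
    qed
  qed
qed

lemma strict_deriv_on_right_deriv: "strict_deriv_on {t0..} \<gamma> t0 v \<Longrightarrow> right_deriv \<gamma> t0 = v"
  unfolding right_deriv_def
  by (rule vector_derivative_within, simp, rule has_vector_derivative_within_subset[OF strict_deriv_on_has_vector_derivative])
    auto

lemma strict_deriv_on_left_deriv: "strict_deriv_on {..t0} \<gamma> t0 v \<Longrightarrow> left_deriv \<gamma> t0 = v"
  unfolding left_deriv_def
  by (rule vector_derivative_within, simp, rule has_vector_derivative_within_subset[OF strict_deriv_on_has_vector_derivative])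
    auto

lemma strict_deriv_on_shift:
  assumes per: "\<And>t. \<gamma> (t + L) = \<gamma> t" and S: "strict_deriv_on S \<gamma> t0 v"
    and S': "\<And>t. t \<in> S' \<Longrightarrow> t - L \<in> S"
  shows "strict_deriv_on S' \<gamma> (t0 + L) v"
  unfolding strict_deriv_on_def
proof (intro allI impI)
  fix e :: real assume "e > 0"
  then obtain d where d: "d > 0" "increments_near S \<gamma> t0 v e d"
    using S unfolding strict_deriv_on_def by blast
  have g: "\<gamma> (t - L) = \<gamma> t" for t using per[of "t - L"] by simp
  show "\<exists>\<delta>>0. increments_near S' \<gamma> (t0 + L) v e \<delta>"
  proof (intro exI[of _ d] conjI ballI impI d(1))
    fix s t assume st: "s \<in> S'" "t \<in> S'" "s \<le> t" "\<bar>s - (t0 + L)\<bar> < d" "\<bar>t - (t0 + L)\<bar> < d"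
    have "norm (\<gamma> (t - L) - \<gamma> (s - L) - ((t - L) - (s - L)) *\<^sub>R v) \<le> e * ((t - L) - (s - L))"
      by (rule d(2)[rule_format]) (use S' st in auto)
    then show "norm (\<gamma> t - \<gamma> s - (t - s) *\<^sub>R v) \<le> e * (t - s)" by (simp add: g)
  qed
qed

text \<open>
  A local lower Lipschitz bound, with constants that may depend on \<open>t0\<close>.
\<close>
definition locally_expanding :: "real set \<Rightarrow> (real \<Rightarrow> real^2) \<Rightarrow> real \<Rightarrow> bool" where
  "locally_expanding J \<gamma> t0 \<longleftrightarrow>
     (\<exists>\<delta>>0. \<exists>\<mu>>0. \<forall>s\<in>J. \<forall>t\<in>J. s \<le> t \<longrightarrow> \<bar>s - t0\<bar> < \<delta> \<longrightarrow> \<bar>t - t0\<bar> < \<delta> \<longrightarrow>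
        \<mu> * (t - s) \<le> norm (\<gamma> t - \<gamma> s))"

lemma locally_expanding_subset: "locally_expanding J \<gamma> t0 \<Longrightarrow> J' \<subseteq> J \<Longrightarrow> locally_expanding J' \<gamma> t0"
  unfolding locally_expanding_def by blast

lemma locally_expanding_one_sided:
  assumes "strict_deriv_on S \<gamma> t0 v" "v \<noteq> 0"
  shows "locally_expanding S \<gamma> t0"
proof -
  have "norm v / 2 > 0" using assms(2) by simp
  then obtain d where d: "d > 0" "increments_near S \<gamma> t0 v (norm v / 2) d"
    using assms(1) unfolding strict_deriv_on_def by blast
  have "norm v / 2 * (t - s) \<le> norm (\<gamma> t - \<gamma> s)"
    if "s \<in> S" "t \<in> S" "s \<le> t" "\<bar>s - t0\<bar> < d" "\<bar>t - t0\<bar> < d" for s t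
  proof -
    have "norm ((t - s) *\<^sub>R v) - norm (\<gamma> t - \<gamma> s) \<le> norm (\<gamma> t - \<gamma> s - (t - s) *\<^sub>R v)"
      using norm_triangle_ineq2[of "(t - s) *\<^sub>R v" "\<gamma> t - \<gamma> s"] by (simp only: norm_minus_commute)
    also have "\<dots> \<le> norm v / 2 * (t - s)" using d(2) that by auto
    finally have "norm ((t - s) *\<^sub>R v) - norm (\<gamma> t - \<gamma> s) \<le> norm v / 2 * (t - s)" .
    moreover have "norm ((t - s) *\<^sub>R v) = (t - s) * norm v" using that(3) by simp
    ultimately show ?thesis by (simp add: algebra_simps)
  qed
  then show ?thesis unfolding locally_expanding_def using d(1) \<open>norm v / 2 > 0\<close> by blast
qed

text \<open>
  Without a cusp the convex combinations of the two one-sided derivatives avoid the origin, hence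
  stay away from it by compactness. An increment across \<open>t0\<close> is such a combination up to a small
  relative error.
\<close>
lemma locally_expanding_two_sided:
  assumes L: "strict_deriv_on {..t0} \<gamma> t0 vl" and R: "strict_deriv_on {t0..} \<gamma> t0 vr"
    and nz: "vl \<noteq> 0" "vr \<noteq> 0" and cusp: "\<And>c. c > 0 \<Longrightarrow> vl + c *\<^sub>R vr \<noteq> 0"
  shows "locally_expanding UNIV \<gamma> t0"
proof -
  have "continuous_on {0..1::real} (\<lambda>l. norm ((1 - l) *\<^sub>R vl + l *\<^sub>R vr))"
    by (intro continuous_intros)
  then obtain l0 where l0: "l0 \<in> {0..1::real}"
    and min: "\<And>l. l \<in> {0..1} \<Longrightarrow> norm ((1 - l0) *\<^sub>R vl + l0 *\<^sub>R vr) \<le> norm ((1 - l) *\<^sub>R vl + l *\<^sub>R vr)"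
    using continuous_attains_inf[of "{0..1::real}" "\<lambda>l. norm ((1 - l) *\<^sub>R vl + l *\<^sub>R vr)"] by auto
  (* The tolerance \<mu> / 2 used for the increments below leaves half of this expansion rate. *)
  define \<mu> where "\<mu> = norm ((1 - l0) *\<^sub>R vl + l0 *\<^sub>R vr)"
  have "(1 - l0) *\<^sub>R vl + l0 *\<^sub>R vr \<noteq> 0"
  proof (cases "l0 = 0 \<or> l0 = 1")
    case False
    then have l: "0 < l0" "l0 < 1" using l0 by auto
    have "(1 - l0) *\<^sub>R vl + l0 *\<^sub>R vr = (1 - l0) *\<^sub>R (vl + (l0 / (1 - l0)) *\<^sub>R vr)"
      using l by (simp add: scaleR_right_distrib)
    then show ?thesis using cusp[of "l0 / (1 - l0)"] l by simp
  qed (use nz in auto)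
  then have mu: "\<mu> > 0" by (simp add: \<mu>_def)
  have comb: "\<mu> * (p + q) \<le> norm (p *\<^sub>R vl + q *\<^sub>R vr)" if "0 \<le> p" "0 \<le> q" for p q
  proof (cases "p + q = 0")
    case True
    then show ?thesis using that by simp
  next
    case False
    then have pq: "p + q > 0" using that by simp
    have "\<mu> \<le> norm ((1 - q / (p + q)) *\<^sub>R vl + (q / (p + q)) *\<^sub>R vr)"
      unfolding \<mu>_def using that pq by (intro min) auto
    also have "1 - q / (p + q) = p / (p + q)" using pq by (simp add: field_simps)
    also have "(p / (p + q)) *\<^sub>R vl + (q / (p + q)) *\<^sub>R vr = (1 / (p + q)) *\<^sub>R (p *\<^sub>R vl + q *\<^sub>R vr)"
      by (simp add: scaleR_right_distrib)
    also have "norm ((1 / (p + q)) *\<^sub>R (p *\<^sub>R vl + q *\<^sub>R vr)) = norm (p *\<^sub>R vl + q *\<^sub>R vr) / (p + q)"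
      using pq by simp
    finally show ?thesis using pq by (simp only: pos_le_divide_eq)
  qed
  obtain d1 where d1: "d1 > 0" "increments_near {..t0} \<gamma> t0 vl (\<mu> / 2) d1"
    using L half_gt_zero[OF mu] unfolding strict_deriv_on_def by blast
  obtain d2 where d2: "d2 > 0" "increments_near {t0..} \<gamma> t0 vr (\<mu> / 2) d2"
    using R half_gt_zero[OF mu] unfolding strict_deriv_on_def by blast
  have "\<mu> / 2 * (t - s) \<le> norm (\<gamma> t - \<gamma> s)"
    if st: "s \<le> t" "\<bar>s - t0\<bar> < min d1 d2" "\<bar>t - t0\<bar> < min d1 d2" for s t
  proof -
    (* The increment is cut at t0; the parts are trivial if s and t lie on the same side. *)
    define s1 t1 s2 t2 where "s1 = min s t0" and "t1 = min t t0" and "s2 = max s t0" and "t2 = max t t0"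
    have e1: "norm (\<gamma> t1 - \<gamma> s1 - (t1 - s1) *\<^sub>R vl) \<le> \<mu> / 2 * (t1 - s1)"
      using d1 st by (auto simp: s1_def t1_def)
    have e2: "norm (\<gamma> t2 - \<gamma> s2 - (t2 - s2) *\<^sub>R vr) \<le> \<mu> / 2 * (t2 - s2)"
      using d2 st by (auto simp: s2_def t2_def)
    have len: "(t1 - s1) + (t2 - s2) = t - s" by (auto simp: s1_def t1_def s2_def t2_def)
    have dec: "\<gamma> t - \<gamma> s = (\<gamma> t1 - \<gamma> s1) + (\<gamma> t2 - \<gamma> s2)"
      using st(1) by (auto simp: s1_def t1_def s2_def t2_def min_def max_def)
    have "\<mu> * (t - s) \<le> norm ((t1 - s1) *\<^sub>R vl + (t2 - s2) *\<^sub>R vr)"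
      unfolding len[symmetric] using st(1) by (intro comb) (auto simp: s1_def t1_def s2_def t2_def)
    also have "\<dots> = norm ((\<gamma> t - \<gamma> s) - ((\<gamma> t1 - \<gamma> s1 - (t1 - s1) *\<^sub>R vl) + (\<gamma> t2 - \<gamma> s2 - (t2 - s2) *\<^sub>R vr)))"
      unfolding dec by (simp add: algebra_simps)
    also have "\<dots> \<le> norm (\<gamma> t - \<gamma> s) + (\<mu> / 2 * (t1 - s1) + \<mu> / 2 * (t2 - s2))"
      using norm_triangle_ineq4[of "\<gamma> t - \<gamma> s"
          "(\<gamma> t1 - \<gamma> s1 - (t1 - s1) *\<^sub>R vl) + (\<gamma> t2 - \<gamma> s2 - (t2 - s2) *\<^sub>R vr)"]
        norm_triangle_ineq[of "\<gamma> t1 - \<gamma> s1 - (t1 - s1) *\<^sub>R vl" "\<gamma> t2 - \<gamma> s2 - (t2 - s2) *\<^sub>R vr"]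
        e1 e2 by linarith
    also have "\<dots> = norm (\<gamma> t - \<gamma> s) + \<mu> / 2 * (t - s)"
      by (simp only: distrib_left[symmetric] len)
    finally show ?thesis by simp
  qed
  then show ?thesis unfolding locally_expanding_def
    using d1(1) d2(1) mu by (intro exI[of _ "min d1 d2"] conjI exI[of _ "\<mu> / 2"]) auto
qed

text \<open>
  If the quotient of chord and parameter distance had infimum zero, a minimizing sequence of pairs
  would accumulate at a pair with vanishing chord, hence on the diagonal, where the local bound
  forbids it.
\<close>
lemma locally_expanding_imp_expanding:
  assumes P: "compact P" "\<And>s t. (s, t) \<in> P \<Longrightarrow> s \<in> J \<and> t \<in> J \<and> s \<le> t"
    and inj: "\<And>s t. (s, t) \<in> P \<Longrightarrow> \<gamma> s = \<gamma> t \<Longrightarrow> s = t"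
    and cont: "continuous_on J \<gamma>" and loc: "\<And>t. t \<in> J \<Longrightarrow> locally_expanding J \<gamma> t"
  shows "\<exists>c>0. \<forall>(s, t)\<in>P. c * (t - s) \<le> norm (\<gamma> t - \<gamma> s)"
proof (rule ccontr)
  assume neg: "\<not> ?thesis"
  have ex: "\<exists>p\<in>P. norm (\<gamma> (snd p) - \<gamma> (fst p)) < c * (snd p - fst p)" if "c > 0" for c
  proof -
    have "\<not> (\<forall>(s, t)\<in>P. c * (t - s) \<le> norm (\<gamma> t - \<gamma> s))" using neg that by blast
    then show ?thesis by (force simp: not_le)
  qed
  have "\<exists>p\<in>P. norm (\<gamma> (snd p) - \<gamma> (fst p)) < 1 / real (Suc k) * (snd p - fst p)" for k
    by (rule ex) simp
  then obtain p where pP: "\<And>k. p k \<in> P"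
    and small: "\<And>k. norm (\<gamma> (snd (p k)) - \<gamma> (fst (p k))) < 1 / real (Suc k) * (snd (p k) - fst (p k))"
    by metis
  obtain l r where l: "l \<in> P" and r: "strict_mono r" and lim: "(p \<circ> r) \<longlonglongrightarrow> l"
    using P(1) pP unfolding compact_def by metis
  define s t where "s = (\<lambda>k. fst (p (r k)))" and "t = (\<lambda>k. snd (p (r k)))"
  obtain s0 t0 where st0: "l = (s0, t0)" by (cases l)
  have ls: "s \<longlonglongrightarrow> s0" and lt: "t \<longlonglongrightarrow> t0"
    using tendsto_fst[OF lim] tendsto_snd[OF lim] by (simp_all add: s_def t_def st0 comp_def)
  have mem: "s k \<in> J" "t k \<in> J" "s k \<le> t k" for k
    using P(2)[of "s k" "t k"] pP[of "r k"] by (simp_all add: s_def t_def)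
  have mem0: "s0 \<in> J" "t0 \<in> J" using P(2)[of s0 t0] l st0 by auto
  have zero: "(\<lambda>k. 1 / real (Suc (r k))) \<longlonglongrightarrow> 0"
    using LIMSEQ_subseq_LIMSEQ[OF LIMSEQ_inverse_real_of_nat r] by (simp add: comp_def inverse_eq_divide)
  have sm: "norm (\<gamma> (t k) - \<gamma> (s k)) < 1 / real (Suc (r k)) * (t k - s k)" for k
    using small[of "r k"] by (simp add: s_def t_def)
  have "(\<lambda>k. norm (\<gamma> (t k) - \<gamma> (s k))) \<longlonglongrightarrow> norm (\<gamma> t0 - \<gamma> s0)"
    using mem mem0 by (intro tendsto_intros continuous_on_tendsto_compose[OF cont] ls lt) auto
  moreover have "(\<lambda>k. 1 / real (Suc (r k)) * (t k - s k)) \<longlonglongrightarrow> 0 * (t0 - s0)"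
    by (intro tendsto_intros zero ls lt)
  ultimately have "norm (\<gamma> t0 - \<gamma> s0) \<le> 0 * (t0 - s0)"
    by (rule LIMSEQ_le) (use sm less_imp_le in blast)
  then have eq: "s0 = t0" using inj[of s0 t0] l st0 by simp
  obtain d m where dm: "d > 0" "m > 0" and exp: "\<And>s t. s \<in> J \<Longrightarrow> t \<in> J \<Longrightarrow> s \<le> t \<Longrightarrow> \<bar>s - t0\<bar> < d \<Longrightarrow> \<bar>t - t0\<bar> < d \<Longrightarrow>
        m * (t - s) \<le> norm (\<gamma> t - \<gamma> s)"
    using loc[OF mem0(2)] unfolding locally_expanding_def by metis
  have "\<forall>\<^sub>F k in sequentially. dist (s k) t0 < d" "\<forall>\<^sub>F k in sequentially. dist (t k) t0 < d"
    using tendstoD[OF ls dm(1)] tendstoD[OF lt dm(1)] eq by auto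
  moreover have "\<forall>\<^sub>F k in sequentially. 1 / real (Suc (r k)) < m"
    using order_tendstoD(2)[OF zero dm(2)] .
  ultimately have "\<forall>\<^sub>F k in sequentially. False"
  proof eventually_elim
    case (elim k)
    have "m * (t k - s k) \<le> norm (\<gamma> (t k) - \<gamma> (s k))"
      using elim mem by (intro exp) (auto simp: dist_real_def)
    with sm[of k] have lt: "m * (t k - s k) < 1 / real (Suc (r k)) * (t k - s k)" by linarith
    have "1 / real (Suc (r k)) * (t k - s k) \<le> m * (t k - s k)"
      using elim mem(3)[of k] by (intro mult_right_mono) auto
    with lt show False by linarith
  qed
  then show False by simp
qed

section \<open>Piecewise smooth boundary curves\<close>

lemma subinterval_right:
  fixes p :: "nat \<Rightarrow> real"
  shows "p 0 \<le> x \<Longrightarrow> x < p N \<Longrightarrow> \<exists>i<N. p i \<le> x \<and> x < p (Suc i)"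
proof (induction N)
  case (Suc N)
  then show ?case by (cases "x < p N") (auto intro: less_SucI)
qed simp

lemma subinterval_left:
  fixes p :: "nat \<Rightarrow> real"
  shows "p 0 < x \<Longrightarrow> x \<le> p N \<Longrightarrow> \<exists>i<N. p i < x \<and> x \<le> p (Suc i)"
proof (induction N)
  case (Suc N)
  then show ?case by (cases "x \<le> p N") (auto intro: less_SucI)
qed simp

lemma increasing_le:
  fixes p :: "nat \<Rightarrow> real"
  assumes "\<And>i. i < N \<Longrightarrow> p i < p (Suc i)" "i \<le> j" "j \<le> N"
  shows "p i \<le> p j"
  using assms(2,3)
proof (induction rule: dec_induct)
  case (step k)
  then show ?case using assms(1)[of k] by auto
qed simp

lemma increasing_less:
  fixes p :: "nat \<Rightarrow> real"
  assumes "\<And>i. i < N \<Longrightarrow> p i < p (Suc i)" "i < j" "j \<le> N"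
  shows "p i < p j"
  using assms(1)[of i] increasing_le[of N p "Suc i" j, OF assms(1)] assms(2,3) by auto

lemma piecewise_C2_one_sided:
  assumes "piecewise_C2 a b \<gamma>"
  shows "t \<in> {a..<b} \<Longrightarrow> strict_deriv_on {t..} \<gamma> t (right_deriv \<gamma> t)"
    and "t \<in> {a<..b} \<Longrightarrow> strict_deriv_on {..t} \<gamma> t (left_deriv \<gamma> t)"
proof -
  obtain N p where p: "p 0 = a" "p (N::nat) = b"
    and pC: "\<And>i. i < N \<Longrightarrow> C2_on_interval (p i) (p (Suc i)) \<gamma>"
    using assms unfolding piecewise_C2_def by blast
  show "strict_deriv_on {t..} \<gamma> t (right_deriv \<gamma> t)" if t: "t \<in> {a..<b}"
  proof -
    obtain i where i: "i < N" "p i \<le> t" "t < p (Suc i)" using subinterval_right[of p t N] p t by auto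
    obtain v where "strict_deriv_on {p i..p (Suc i)} \<gamma> t v"
      using C2_on_interval_strict_deriv[OF pC[OF i(1)], of t] i by auto
    then have "strict_deriv_on {t..} \<gamma> t v"
      by (rule strict_deriv_on_local[where r = "p (Suc i) - t"]) (use i in auto)
    with strict_deriv_on_right_deriv[OF this] show ?thesis by simp
  qed
  show "strict_deriv_on {..t} \<gamma> t (left_deriv \<gamma> t)" if t: "t \<in> {a<..b}"
  proof -
    obtain i where i: "i < N" "p i < t" "t \<le> p (Suc i)" using subinterval_left[of p t N] p t by auto
    obtain v where "strict_deriv_on {p i..p (Suc i)} \<gamma> t v"
      using C2_on_interval_strict_deriv[OF pC[OF i(1)], of t] i by auto
    then have "strict_deriv_on {..t} \<gamma> t v"
      by (rule strict_deriv_on_local[where r = "t - p i"]) (use i in auto)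
    with strict_deriv_on_left_deriv[OF this] show ?thesis by simp
  qed
qed

lemma piecewise_C2_lipschitz:
  assumes "piecewise_C2 a b \<gamma>" "a < b"
  obtains B where "B > 0" "\<And>s t. s \<in> {a..b} \<Longrightarrow> t \<in> {a..b} \<Longrightarrow> dist (\<gamma> s) (\<gamma> t) \<le> B * \<bar>s - t\<bar>"
proof -
  obtain N p where p: "p 0 = a" "p (N::nat) = b"
    and pC: "\<And>i. i < N \<Longrightarrow> C2_on_interval (p i) (p (Suc i)) \<gamma>"
    using assms unfolding piecewise_C2_def by blast
  have "\<exists>B\<ge>0. B-lipschitz_on {p i..p (Suc i)} \<gamma>" if iN: "i < N" for i
  proof -
    let ?I = "{p i..p (Suc i)}"
    obtain \<gamma>1 \<gamma>2 where d1: "\<And>x. x \<in> ?I \<Longrightarrow> (\<gamma> has_vector_derivative \<gamma>1 x) (at x within ?I)"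
      and d2: "\<And>x. x \<in> ?I \<Longrightarrow> (\<gamma>1 has_vector_derivative \<gamma>2 x) (at x within ?I)"
      using pC[OF iN] unfolding C2_on_interval_def by blast
    have "continuous_on ?I \<gamma>1"
      using d2 has_vector_derivative_continuous continuous_on_eq_continuous_within by blast
    then have "bounded (\<gamma>1 ` ?I)" by (intro compact_imp_bounded compact_continuous_image) auto
    then obtain B where B: "B > 0" "\<And>x. x \<in> ?I \<Longrightarrow> norm (\<gamma>1 x) \<le> B"
      unfolding bounded_pos by blast
    have "B-lipschitz_on ?I \<gamma>"
    proof (rule lipschitz_on_leI)
      fix s t assume st: "s \<in> ?I" "t \<in> ?I" "s \<le> t"
      have sub: "{s..t} \<subseteq> ?I" using st by auto
      have "norm (\<gamma> t - \<gamma> s - (t - s) *\<^sub>R 0) \<le> B * (t - s)"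
        by (rule increment_bound[OF st(3), where \<gamma>' = \<gamma>1])
          (use B sub has_vector_derivative_within_subset[OF d1 sub] in auto)
      then show "dist (\<gamma> s) (\<gamma> t) \<le> B * dist s t"
        using st(3) by (simp add: dist_norm norm_minus_commute[of "\<gamma> s"])
    qed (use B in simp)
    then show ?thesis using B by (intro exI[of _ B]) simp
  qed
  then obtain B where B: "\<And>i. i < N \<Longrightarrow> B i \<ge> 0" "\<And>i. i < N \<Longrightarrow> (B i)-lipschitz_on {p i..p (Suc i)} \<gamma>"
    by metis
  define C where "C = (\<Sum>i<N. B i)"
  have "C-lipschitz_on {a..b} \<gamma>"
  proof (rule lipschitz_on_closed_Union[where I = "{..<N}" and U = "\<lambda>i. {p i..p (Suc i)}"])
    fix i assume i: "i \<in> {..<N}"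
    have "B i \<le> C" unfolding C_def by (rule member_le_sum) (use i B in auto)
    then show "C-lipschitz_on {p i..p (Suc i)} \<gamma>" using B(2)[of i] i by (auto intro: lipschitz_on_le)
  next
    show "C \<ge> 0" unfolding C_def using B by (intro sum_nonneg) auto
    show "{a..b} \<subseteq> (\<Union>i\<in>{..<N}. {p i..p (Suc i)})"
    proof
      fix t assume t: "t \<in> {a..b}"
      then consider "a \<le> t" "t < b" | "a < t" "t \<le> b" using \<open>a < b\<close> by fastforce
      then show "t \<in> (\<Union>i\<in>{..<N}. {p i..p (Suc i)})"
      proof cases
        case 1
        then show ?thesis using subinterval_right[of p t N] p by force
      next
        case 2
        then show ?thesis using subinterval_left[of p t N] p by force
      qed
    qed
  qed auto
  then have "dist (\<gamma> s) (\<gamma> t) \<le> (C + 1) * \<bar>s - t\<bar>" if "s \<in> {a..b}" "t \<in> {a..b}" for s t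
    using lipschitz_onD[OF _ that, of C] by (fastforce simp: dist_real_def distrib_right)
  moreover have "C \<ge> 0" unfolding C_def using B by (intro sum_nonneg) auto
  then have "C + 1 > 0" by simp
  ultimately show thesis using that by blast
qed


text \<open>
  The parameter length of the shorter of the arcs between two points. Since the path is injective
  up to its end points, \<open>\<gamma> a = \<gamma> b\<close> holds precisely for closed curves, where there are two arcs.
\<close>
definition arc_gap :: "(real \<Rightarrow> real^2) \<Rightarrow> real \<Rightarrow> real \<Rightarrow> real \<Rightarrow> real \<Rightarrow> real" where
  "arc_gap \<gamma> a b s t = (if \<gamma> a = \<gamma> b then min \<bar>s - t\<bar> (b - a - \<bar>s - t\<bar>) else \<bar>s - t\<bar>)"

lemma arc_gap_commute: "arc_gap \<gamma> a b s t = arc_gap \<gamma> a b t s"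
  by (simp add: arc_gap_def abs_minus_commute)

lemma boundary_curve_inj:
  assumes "boundary_curve \<Omega> \<Gamma> \<gamma> a b" "s \<in> {a..b}" "t \<in> {a..b}" "s \<le> t" "\<gamma> s = \<gamma> t"
  shows "s = t \<or> (s = a \<and> t = b)"
proof (cases "\<Gamma> = frontier \<Omega>")
  case True
  then have inj: "inj_on \<gamma> {a..<b}" and ab: "\<gamma> a = \<gamma> b" "a < b"
    using assms(1) by (auto simp: boundary_curve_def bij_betw_def)
  show ?thesis
  proof (cases "t < b")
    case True
    then show ?thesis using inj_onD[OF inj assms(5)] assms by auto
  next
    case False
    then have t: "t = b" using assms by auto
    then show ?thesis using inj_onD[OF inj, of s a] assms ab by fastforce
  qed
next
  case False
  then have "inj_on \<gamma> {a..b}" using assms(1) by (auto simp: boundary_curve_def bij_betw_def)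
  then show ?thesis using inj_onD assms by metis
qed

lemma boundary_curve_closed_ends:
  assumes "boundary_curve \<Omega> \<Gamma> \<gamma> a b" "\<Gamma> = frontier \<Omega>"
  shows "\<gamma> a = \<gamma> b"
  using assms(1) unfolding boundary_curve_def if_P[OF assms(2)] by blast

text \<open>
  At interior points the one-sided derivatives of both sides enter. At the two ends of an open
  curve only one of them exists, and it suffices because all chords lie on one side.
\<close>
lemma chord_arc_open:
  assumes curve: "boundary_curve \<Omega> \<Gamma> \<gamma> a b" and "\<Gamma> \<noteq> frontier \<Omega>"
  shows "\<exists>c>0. \<forall>s\<in>{a..b}. \<forall>t\<in>{a..b}. s \<le> t \<longrightarrow> c * (t - s) \<le> norm (\<gamma> t - \<gamma> s)"
proof -
  have pw: "piecewise_C2 a b \<gamma>" and ab: "a < b" and inj: "inj_on \<gamma> {a..b}"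
    and nl: "\<And>t. t \<in> {a<..b} \<Longrightarrow> left_deriv \<gamma> t \<noteq> 0" and nr: "\<And>t. t \<in> {a..<b} \<Longrightarrow> right_deriv \<gamma> t \<noteq> 0"
    and cusp: "\<And>t c. t \<in> {a<..<b} \<Longrightarrow> c > 0 \<Longrightarrow> left_deriv \<gamma> t + c *\<^sub>R right_deriv \<gamma> t \<noteq> 0"
    using assms by (auto simp: boundary_curve_def bij_betw_def)
  note R = piecewise_C2_one_sided(1)[OF pw] and L = piecewise_C2_one_sided(2)[OF pw]
  define P where "P = ({a..b} \<times> {a..b}) \<inter> {p. fst p \<le> snd p}"
  have "closed {p :: real \<times> real. fst p \<le> snd p}"
    by (intro closed_Collect_le continuous_intros)
  then have "compact P" unfolding P_def by (intro compact_Int_closed compact_Times) auto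
  have "\<exists>c>0. \<forall>(s, t)\<in>P. c * (t - s) \<le> norm (\<gamma> t - \<gamma> s)"
  proof (rule locally_expanding_imp_expanding[where J = "{a..b}"])
    show "continuous_on {a..b} \<gamma>" using pw by (simp add: piecewise_C2_def)
    show "locally_expanding {a..b} \<gamma> t" if t: "t \<in> {a..b}" for t
    proof -
      consider "t = a" | "t = b" | "t \<in> {a<..<b}" using t by fastforce
      then show ?thesis
      proof cases
        case 1
        have "locally_expanding {a..} \<gamma> a" using locally_expanding_one_sided[OF R nr] ab by simp
        then show ?thesis unfolding 1 by (rule locally_expanding_subset) auto
      next
        case 2
        have "locally_expanding {..b} \<gamma> b" using locally_expanding_one_sided[OF L nl] ab by simp
        then show ?thesis unfolding 2 by (rule locally_expanding_subset) auto
      next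
        case 3
        then have "locally_expanding UNIV \<gamma> t"
          using L R nl nr cusp by (intro locally_expanding_two_sided[of t \<gamma> "left_deriv \<gamma> t" "right_deriv \<gamma> t"]) auto
        then show ?thesis by (rule locally_expanding_subset) auto
      qed
    qed
    show "s = t" if "(s, t) \<in> P" "\<gamma> s = \<gamma> t" for s t
      using inj_onD[OF inj that(2)] that(1) by (auto simp: P_def)
  qed (use \<open>compact P\<close> in \<open>auto simp: P_def\<close>)
  then obtain c where c: "c > 0" "\<And>s t. (s, t) \<in> P \<Longrightarrow> c * (t - s) \<le> norm (\<gamma> t - \<gamma> s)" by blast
  have "(s, t) \<in> P" if "s \<in> {a..b}" "t \<in> {a..b}" "s \<le> t" for s t using that by (simp add: P_def)
  with c show ?thesis by blast
qed

text \<open>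
  On a closed curve the period is unrolled: pairs at parameter distance at most half a period are
  separated by the injectivity of the path, and the longer way round is replaced by the shorter one.
\<close>
lemma chord_arc_closed:
  assumes curve: "boundary_curve \<Omega> \<Gamma> \<gamma> a b" and closed: "\<Gamma> = frontier \<Omega>"
  shows "\<exists>c>0. \<forall>s\<in>{a..b}. \<forall>t\<in>{a..b}. s \<le> t \<longrightarrow> c * min (t - s) (b - a - (t - s)) \<le> norm (\<gamma> t - \<gamma> s)"
proof -
  define L where "L = b - a"
  have pw: "piecewise_C2 a b \<gamma>" and ab: "a < b" and inj: "inj_on \<gamma> {a..<b}"
    and per: "\<And>t. \<gamma> (t + L) = \<gamma> t"
    and nl: "\<And>t. t \<in> {a<..b} \<Longrightarrow> left_deriv \<gamma> t \<noteq> 0" and nr: "\<And>t. t \<in> {a..<b} \<Longrightarrow> right_deriv \<gamma> t \<noteq> 0"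
    and cusp: "\<And>t c. t \<in> {a..b} \<Longrightarrow> c > 0 \<Longrightarrow> left_deriv \<gamma> t + c *\<^sub>R right_deriv \<gamma> t \<noteq> 0"
    using assms by (auto simp: boundary_curve_def bij_betw_def L_def)
  have L: "L > 0" using ab by (simp add: L_def)
  have per': "\<gamma> (t - L) = \<gamma> t" for t using per[of "t - L"] by simp
  note right = piecewise_C2_one_sided(1)[OF pw] and left = piecewise_C2_one_sided(2)[OF pw]
  (* The missing one-sided derivatives at a and b are those at the other end of the period. *)
  have "strict_deriv_on {b..} \<gamma> (a + L) (right_deriv \<gamma> a)"
    by (rule strict_deriv_on_shift[OF per right]) (use ab in \<open>auto simp: L_def\<close>)
  then have right_b: "strict_deriv_on {b..} \<gamma> b (right_deriv \<gamma> a)" by (simp add: L_def)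
  have "\<gamma> (t + - L) = \<gamma> t" for t using per'[of t] by simp
  then have "strict_deriv_on {..a} \<gamma> (b + - L) (left_deriv \<gamma> b)"
    by (rule strict_deriv_on_shift[OF _ left]) (use ab in \<open>auto simp: L_def\<close>)
  then have left_a: "strict_deriv_on {..a} \<gamma> a (left_deriv \<gamma> b)" by (simp add: L_def)
  have eq: "right_deriv \<gamma> b = right_deriv \<gamma> a" "left_deriv \<gamma> a = left_deriv \<gamma> b"
    using strict_deriv_on_right_deriv[OF right_b] strict_deriv_on_left_deriv[OF left_a] by auto
  have exp0: "locally_expanding UNIV \<gamma> t" if "t \<in> {a..b}" for t
  proof (rule locally_expanding_two_sided)
    show "strict_deriv_on {..t} \<gamma> t (left_deriv \<gamma> t)"
      using left[of t] left_a eq that by (cases "t = a") auto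
    show "strict_deriv_on {t..} \<gamma> t (right_deriv \<gamma> t)"
      using right[of t] right_b eq that by (cases "t = b") auto
    show "left_deriv \<gamma> t \<noteq> 0" using nl[of t] nl[of b] eq that ab by (cases "t = a") auto
    show "right_deriv \<gamma> t \<noteq> 0" using nr[of t] nr[of a] eq that ab by (cases "t = b") auto
    show "\<And>c. c > 0 \<Longrightarrow> left_deriv \<gamma> t + c *\<^sub>R right_deriv \<gamma> t \<noteq> 0" using cusp that by blast
  qed
  have shift: "locally_expanding UNIV \<gamma> (t + L)" if loc: "locally_expanding UNIV \<gamma> t" for t
  proof -
    obtain d m where dm: "d > 0" "m > 0" and e: "\<And>s t'. s \<le> t' \<Longrightarrow> \<bar>s - t\<bar> < d \<Longrightarrow> \<bar>t' - t\<bar> < d \<Longrightarrow>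
        m * (t' - s) \<le> norm (\<gamma> t' - \<gamma> s)"
      using loc unfolding locally_expanding_def by blast
    have "m * (t' - s) \<le> norm (\<gamma> t' - \<gamma> s)" if "s \<le> t'" "\<bar>s - (t + L)\<bar> < d" "\<bar>t' - (t + L)\<bar> < d" for s t'
    proof -
      have "m * ((t' - L) - (s - L)) \<le> norm (\<gamma> (t' - L) - \<gamma> (s - L))" by (rule e) (use that in auto)
      then show ?thesis by (simp add: per')
    qed
    then show ?thesis unfolding locally_expanding_def using dm by blast
  qed
  define J where "J = {a..b + L}"
  have exp: "locally_expanding J \<gamma> t" if "t \<in> J" for t
  proof -
    have "locally_expanding UNIV \<gamma> t"
      using exp0[of t] shift[OF exp0[of "t - L"]] that ab by (cases "t \<le> b") (auto simp: J_def L_def)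
    then show ?thesis by (rule locally_expanding_subset) simp
  qed
  have cont: "continuous_on J \<gamma>"
  proof -
    have c: "continuous_on {a..b} \<gamma>" using pw by (simp add: piecewise_C2_def)
    have "continuous_on {b..b + L} (\<gamma> \<circ> (\<lambda>t. t - L))"
      by (rule continuous_on_compose) (auto intro!: continuous_intros continuous_on_subset[OF c] simp: L_def)
    then have c': "continuous_on {b..b + L} \<gamma>" by (simp add: comp_def per')
    have "J = {a..b} \<union> {b..b + L}" using ab L by (auto simp: J_def)
    then show ?thesis using continuous_on_closed_Un[OF _ _ c c'] by simp
  qed
  define P where "P = (J \<times> J) \<inter> {p. fst p \<le> snd p} \<inter> {p. snd p \<le> fst p + L / 2}"
  have "closed {p :: real \<times> real. fst p \<le> snd p}" "closed {p :: real \<times> real. snd p \<le> fst p + L / 2}"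
    by (intro closed_Collect_le continuous_intros)+
  then have "compact P" unfolding P_def J_def by (intro compact_Int_closed compact_Times) auto
  have reduce: "\<exists>k::int. t - of_int k * L \<in> {a..<b} \<and> \<gamma> (t - of_int k * L) = \<gamma> t" if tJ: "t \<in> J" for t
  proof -
    consider "t < b" | "b \<le> t" "t < b + L" | "t = b + L" using tJ by (fastforce simp: J_def)
    then show ?thesis
    proof cases
      case 1
      then show ?thesis using tJ by (intro exI[of _ 0]) (auto simp: J_def)
    next
      case 2
      then show ?thesis using per' by (intro exI[of _ 1]) (auto simp: L_def)
    next
      case 3
      then have "t - of_int 2 * L = a" "\<gamma> t = \<gamma> a"
        using per[of b] per[of a] by (auto simp: L_def)
      then show ?thesis using ab by (intro exI[of _ 2]) simp
    qed
  qed
  have "\<exists>c>0. \<forall>(s, t)\<in>P. c * (t - s) \<le> norm (\<gamma> t - \<gamma> s)"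
  proof (rule locally_expanding_imp_expanding[where J = J, OF \<open>compact P\<close> _ _ cont exp])
    fix s t assume st: "(s, t) \<in> P" "\<gamma> s = \<gamma> t"
    obtain k :: int where k: "s - of_int k * L \<in> {a..<b}" "\<gamma> (s - of_int k * L) = \<gamma> s"
      using reduce[of s] st by (auto simp: P_def)
    obtain l :: int where l: "t - of_int l * L \<in> {a..<b}" "\<gamma> (t - of_int l * L) = \<gamma> t"
      using reduce[of t] st by (auto simp: P_def)
    have "s - of_int k * L = t - of_int l * L"
      by (rule inj_onD[OF inj]) (use k l st in auto)
    then have d: "t - s = of_int (l - k) * L" by (simp add: algebra_simps)
    have "0 \<le> t - s" "t - s < L" using st L by (auto simp: P_def)
    then have "0 * L \<le> of_int (l - k) * L" "of_int (l - k) * L < 1 * L" by (simp_all only: d mult_zero_left mult_1_left)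
    then have "0 \<le> real_of_int (l - k)" "real_of_int (l - k) < 1"
      by (simp_all only: mult_le_cancel_right_pos[OF L] mult_less_cancel_right_pos[OF L])
    then have "l - k = 0" by linarith
    then show "s = t" using d by simp
  qed (auto simp: P_def)
  then obtain c where c: "c > 0" "\<And>s t. (s, t) \<in> P \<Longrightarrow> c * (t - s) \<le> norm (\<gamma> t - \<gamma> s)" by blast
  have "c * min (t - s) (b - a - (t - s)) \<le> norm (\<gamma> t - \<gamma> s)"
    if st: "s \<in> {a..b}" "t \<in> {a..b}" "s \<le> t" for s t
  proof (cases "t - s \<le> L / 2")
    case True
    then have "c * (t - s) \<le> norm (\<gamma> t - \<gamma> s)" using st L by (intro c(2)) (auto simp: P_def J_def)
    moreover have "c * min (t - s) (b - a - (t - s)) \<le> c * (t - s)" using c(1) by simp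
    ultimately show ?thesis by linarith
  next
    case False
    then have "s + L \<le> t + L / 2" by linarith
    moreover have "t \<le> s + L" using st by (simp add: L_def)
    ultimately have "(t, s + L) \<in> P" using st L by (simp add: P_def J_def)
    then have "c * (s + L - t) \<le> norm (\<gamma> (s + L) - \<gamma> t)" by (rule c(2))
    moreover have "s + L - t = b - a - (t - s)" by (simp add: L_def)
    ultimately have "c * (b - a - (t - s)) \<le> norm (\<gamma> t - \<gamma> s)"
      by (simp only: per norm_minus_commute[of "\<gamma> s"])
    moreover have "c * min (t - s) (b - a - (t - s)) \<le> c * (b - a - (t - s))" using c(1) by simp
    ultimately show ?thesis by linarith
  qed
  with c(1) show ?thesis by blast
qed

lemma chord_arc:
  assumes curve: "boundary_curve \<Omega> \<Gamma> \<gamma> a b"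
  obtains c where "c > 0"
    "\<And>s t. s \<in> {a..b} \<Longrightarrow> t \<in> {a..b} \<Longrightarrow> c * arc_gap \<gamma> a b s t \<le> dist (\<gamma> s) (\<gamma> t)"
proof -
  have "\<exists>c>0. \<forall>s\<in>{a..b}. \<forall>t\<in>{a..b}. s \<le> t \<longrightarrow> c * arc_gap \<gamma> a b s t \<le> norm (\<gamma> t - \<gamma> s)"
  proof (cases "\<Gamma> = frontier \<Omega>")
    case True
    then have "\<gamma> a = \<gamma> b" using boundary_curve_closed_ends[OF curve] by blast
    then have gap: "arc_gap \<gamma> a b s t = min (t - s) (b - a - (t - s))" if "s \<le> t" for s t
      using that by (simp add: arc_gap_def)
    obtain c where "c > 0"
      "\<forall>s\<in>{a..b}. \<forall>t\<in>{a..b}. s \<le> t \<longrightarrow> c * min (t - s) (b - a - (t - s)) \<le> norm (\<gamma> t - \<gamma> s)"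
      using chord_arc_closed[OF curve True] by blast
    then show ?thesis by (intro exI[of _ c] conjI ballI impI) (simp_all only: gap)
  next
    case False
    then have inj: "inj_on \<gamma> {a..b}" and "a < b"
      using curve by (auto simp: boundary_curve_def bij_betw_def)
    then have "\<gamma> a \<noteq> \<gamma> b" using inj_onD[OF inj, of a b] by auto
    then have gap: "arc_gap \<gamma> a b s t = t - s" if "s \<le> t" for s t
      using that by (simp add: arc_gap_def)
    obtain c where "c > 0" "\<forall>s\<in>{a..b}. \<forall>t\<in>{a..b}. s \<le> t \<longrightarrow> c * (t - s) \<le> norm (\<gamma> t - \<gamma> s)"
      using chord_arc_open[OF curve False] by blast
    then show ?thesis by (intro exI[of _ c] conjI ballI impI) (simp_all only: gap)
  qed
  then obtain c where c: "c > 0"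
    "\<And>s t. s \<in> {a..b} \<Longrightarrow> t \<in> {a..b} \<Longrightarrow> s \<le> t \<Longrightarrow> c * arc_gap \<gamma> a b s t \<le> norm (\<gamma> t - \<gamma> s)" by blast
  have "c * arc_gap \<gamma> a b s t \<le> dist (\<gamma> s) (\<gamma> t)" if st: "s \<in> {a..b}" "t \<in> {a..b}" for s t
  proof (cases "s \<le> t")
    case True
    then show ?thesis using c(2)[OF st] by (simp only: dist_norm norm_minus_commute[of "\<gamma> s"])
  next
    case False
    then have "t \<le> s" by simp
    then show ?thesis using c(2)[OF st(2,1)] by (simp only: dist_norm arc_gap_commute[of _ _ _ s])
  qed
  with c(1) show thesis by (rule that)
qed

section \<open>Arclength\<close>

lemma norm_vector_derivative_bounds:
  fixes \<gamma> :: "real \<Rightarrow> real^2"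
  assumes deriv: "(\<gamma> has_vector_derivative v) (at t within {a..b})" and t: "a \<le> t" "t < b" and r: "r > 0"
    and low: "\<And>s. s \<in> {a..b} \<Longrightarrow> \<bar>s - t\<bar> < r \<Longrightarrow> c * \<bar>s - t\<bar> \<le> norm (\<gamma> s - \<gamma> t)"
    and up: "\<And>s. s \<in> {a..b} \<Longrightarrow> norm (\<gamma> s - \<gamma> t) \<le> C * \<bar>s - t\<bar>"
  shows "c \<le> norm v" "norm v \<le> C"
proof -
  have "c \<le> norm v + e \<and> norm v \<le> C + e" if e: "e > 0" for e
  proof -
    obtain d where d: "d > 0" "\<And>s. s \<in> {a..b} \<Longrightarrow> norm (s - t) < d \<Longrightarrow>
        norm (\<gamma> s - \<gamma> t - (s - t) *\<^sub>R v) \<le> e * norm (s - t)"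
      using deriv e unfolding has_vector_derivative_def has_derivative_within_alt by blast
    define m where "m = min (min d r) (b - t)"
    have m: "m > 0" "m \<le> d" "m \<le> r" "m \<le> b - t" using t d(1) r by (auto simp: m_def)
    (* A point to the right of t that is near enough for all three estimates. *)
    define s where "s = t + m / 2"
    have s: "s \<in> {a..b}" "s > t" "\<bar>s - t\<bar> < d" "\<bar>s - t\<bar> < r" using t m by (auto simp: s_def)
    define x where "x = s - t"
    have x: "x > 0" using s by (simp add: x_def)
    have err: "norm ((\<gamma> s - \<gamma> t) - x *\<^sub>R v) \<le> e * x" using d(2)[of s] s by (simp add: x_def)
    have nx: "norm (x *\<^sub>R v) = x * norm v" using x by simp
    have "c * x \<le> norm (\<gamma> s - \<gamma> t)" using low[of s] s by (simp add: x_def)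
    also have "\<dots> \<le> x * norm v + e * x"
      using err nx norm_triangle_ineq2[of "\<gamma> s - \<gamma> t" "x *\<^sub>R v"] by linarith
    finally have "c * x \<le> (norm v + e) * x" by (simp add: algebra_simps)
    moreover have "x * norm v \<le> norm (\<gamma> s - \<gamma> t) + e * x"
      using err nx norm_triangle_ineq3[of "\<gamma> s - \<gamma> t" "x *\<^sub>R v"] by linarith
    moreover have "norm (\<gamma> s - \<gamma> t) \<le> C * x" using up[of s] s by (simp add: x_def)
    ultimately have "c * x \<le> (norm v + e) * x" "norm v * x \<le> (C + e) * x" by (simp_all add: algebra_simps)
    then show ?thesis using x by simp
  qed
  then show "c \<le> norm v" "norm v \<le> C" by (auto intro: field_le_epsilon)
qed

text \<open>
  The exceptional set consists of the break points. Off these points the speed is continuous, which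
  makes it measurable although nothing is known at the break points.
\<close>
lemma piecewise_C2_derivative:
  assumes "piecewise_C2 a b \<gamma>"
  obtains X where "finite X" "a \<in> X" "b \<in> X"
    "\<And>t. t \<in> {a..b} - X \<Longrightarrow>
      (\<gamma> has_vector_derivative vector_derivative \<gamma> (at t within {a..b})) (at t within {a..b})"
    "(\<lambda>t. norm (vector_derivative \<gamma> (at t within {a..b}))) \<in> borel_measurable (restrict_space lborel {a..b})"
proof -
  obtain N p where p: "p 0 = a" "p (N::nat) = b"
    and inc: "\<And>i. i < N \<Longrightarrow> p i < p (Suc i)"
    and pC: "\<And>i. i < N \<Longrightarrow> C2_on_interval (p i) (p (Suc i)) \<gamma>"
    using assms unfolding piecewise_C2_def by blast
  define X where "X = p ` {..N}"
  define U where "U i = {p i<..<p (Suc i)}" for i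
  define g where "g t = (if t \<in> {a..b} then norm (vector_derivative \<gamma> (at t within {a..b})) else 0)" for t
  have Uab: "U i \<subseteq> {a<..<b}" if "i < N" for i
    using increasing_le[of N p 0 i, OF inc] increasing_le[of N p "Suc i" N, OF inc] that p
    by (auto simp: U_def)
  have cover: "\<exists>i<N. t \<in> U i" if t: "t \<in> {a..b} - X" for t
  proof -
    have "t \<noteq> p N" using t unfolding X_def by blast
    then have "p 0 \<le> t" "t < p N" using t p by auto
    then obtain i where i: "i < N" "p i \<le> t" "t < p (Suc i)" using subinterval_right by blast
    have "t \<noteq> p i" using t i unfolding X_def by fastforce
    with i show ?thesis by (auto simp: U_def)
  qed
  have piece: "\<exists>\<gamma>1. continuous_on (U i) \<gamma>1 \<and>
      (\<forall>t\<in>U i. (\<gamma> has_vector_derivative \<gamma>1 t) (at t within {a..b}) \<and> g t = norm (\<gamma>1 t))" if i: "i < N" for i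
  proof -
    let ?I = "{p i..p (Suc i)}"
    obtain \<gamma>1 \<gamma>2 where d1: "\<And>x. x \<in> ?I \<Longrightarrow> (\<gamma> has_vector_derivative \<gamma>1 x) (at x within ?I)"
      and d2: "\<And>x. x \<in> ?I \<Longrightarrow> (\<gamma>1 has_vector_derivative \<gamma>2 x) (at x within ?I)"
      using pC[OF i] unfolding C2_on_interval_def by blast
    have "continuous_on ?I \<gamma>1"
      using d2 has_vector_derivative_continuous continuous_on_eq_continuous_within by blast
    then have "continuous_on (U i) \<gamma>1" by (rule continuous_on_subset) (auto simp: U_def)
    moreover have "(\<gamma> has_vector_derivative \<gamma>1 t) (at t within {a..b}) \<and> g t = norm (\<gamma>1 t)" if t: "t \<in> U i" for t
    proof -
      have "at t within ?I = at t" using t by (intro at_within_interior) (simp add: U_def)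
      then have "(\<gamma> has_vector_derivative \<gamma>1 t) (at t)" using d1[of t] t by (auto simp: U_def)
      then have 1: "(\<gamma> has_vector_derivative \<gamma>1 t) (at t within {a..b})"
        by (rule has_vector_derivative_at_within)
      have "t \<in> {a<..<b}" using Uab[OF i] t by blast
      then have "vector_derivative \<gamma> (at t within {a..b}) = \<gamma>1 t"
        using 1 at_within_interior[of t "{a..b}"] by (intro vector_derivative_within) auto
      with 1 \<open>t \<in> {a<..<b}\<close> show ?thesis by (simp add: g_def)
    qed
    ultimately show ?thesis by blast
  qed
  have deriv: "(\<gamma> has_vector_derivative vector_derivative \<gamma> (at t within {a..b})) (at t within {a..b})"
    if "t \<in> {a..b} - X" for t
    using cover[OF that] piece differentiableI_vector vector_derivative_works by metis
  have "continuous_on (- X) g"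
  proof -
    have finX: "finite X" by (simp add: X_def)
    have ends: "a \<in> X" "b \<in> X" using p unfolding X_def by auto
    have "isCont g t" if t: "t \<in> - X" for t
    proof (cases "t \<in> {a..b}")
      case True
      then obtain i where i: "i < N" "t \<in> U i" using cover[of t] t by blast
      obtain \<gamma>1 :: "real \<Rightarrow> real^2"
        where c: "continuous_on (U i) \<gamma>1" and e: "\<forall>t\<in>U i. g t = norm (\<gamma>1 t)"
        using piece[OF i(1)] by blast
      have "continuous_on (U i) (\<lambda>t. norm (\<gamma>1 t))" using c by (intro continuous_intros)
      then have "continuous_on (U i) g" using e by (simp cong: continuous_on_cong)
      then show ?thesis using i(2) continuous_on_eq_continuous_at[of "U i" g] by (auto simp: U_def)
    next
      case False
      have "continuous_on (- {a..b}) (\<lambda>_. 0 :: real)" by (rule continuous_on_const)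
      then have "continuous_on (- {a..b}) g" by (rule continuous_on_eq) (auto simp: g_def)
      moreover have "open (- {a..b})" by (rule open_Compl) simp
      ultimately show ?thesis using False continuous_on_eq_continuous_at by blast
    qed
    then show ?thesis by (simp add: continuous_at_imp_continuous_on)
  qed
  then have "g \<in> borel_measurable borel"
    by (intro borel_measurable_continuous_countable_exceptions[of X]) (auto simp: X_def countable_finite)
  then have "g \<in> borel_measurable (restrict_space lborel {a..b})"
    by (intro measurable_restrict_space1) simp
  then have "(\<lambda>t. norm (vector_derivative \<gamma> (at t within {a..b}))) \<in> borel_measurable (restrict_space lborel {a..b})"
    by (subst measurable_cong[where g = g]) (auto simp: g_def space_restrict_space)
  moreover have "finite X" "a \<in> X" "b \<in> X" using p unfolding X_def by auto
  ultimately show thesis using deriv that by blast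
qed

lemma sets_arclength: "sets (arclength \<gamma> a b) = sets (restrict_space borel (\<gamma> ` {a..b}))"
  by (simp add: arclength_def)

lemma space_arclength: "space (arclength \<gamma> a b) = \<gamma> ` {a..b}"
  by (simp add: arclength_def space_restrict_space)

text \<open>
  Chord-arc and Lipschitz bounds pass to the limit of difference quotients, so the speed of the
  path lies between two positive constants, and arclength is equivalent to the length of the
  parameter set.
\<close>
lemma arclength_bounds:
  assumes curve: "boundary_curve \<Omega> \<Gamma> \<gamma> a b" and c: "c > 0" and C: "C > 0"
    and low: "\<And>s t. s \<in> {a..b} \<Longrightarrow> t \<in> {a..b} \<Longrightarrow> c * arc_gap \<gamma> a b s t \<le> dist (\<gamma> s) (\<gamma> t)"
    and up: "\<And>s t. s \<in> {a..b} \<Longrightarrow> t \<in> {a..b} \<Longrightarrow> dist (\<gamma> s) (\<gamma> t) \<le> C * \<bar>s - t\<bar>"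
    and A: "A \<in> sets (arclength \<gamma> a b)"
  shows "\<gamma> -` A \<inter> {a..b} \<in> sets lborel"
    and "ennreal c * emeasure lborel (\<gamma> -` A \<inter> {a..b}) \<le> emeasure (arclength \<gamma> a b) A"
    and "emeasure (arclength \<gamma> a b) A \<le> ennreal C * emeasure lborel (\<gamma> -` A \<inter> {a..b})"
proof -
  have pw: "piecewise_C2 a b \<gamma>" and ab: "a < b" using curve unfolding boundary_curve_def by blast+
  define f where "f t = norm (vector_derivative \<gamma> (at t within {a..b}))" for t
  define R where "R = restrict_space lborel {a..b}"
  obtain X where X: "finite X" "a \<in> X" "b \<in> X"
    and deriv: "\<And>t. t \<in> {a..b} - X \<Longrightarrow>
      (\<gamma> has_vector_derivative vector_derivative \<gamma> (at t within {a..b})) (at t within {a..b})"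
    and fm: "f \<in> borel_measurable R"
    using piecewise_C2_derivative[OF pw] unfolding f_def R_def by blast
  have spR: "space R = {a..b}" by (simp add: R_def space_restrict_space)
  have cont: "continuous_on {a..b} \<gamma>" using pw by (simp add: piecewise_C2_def)
  have "\<gamma> \<in> restrict_space borel {a..b} \<rightarrow>\<^sub>M borel"
    by (rule borel_measurable_continuous_on_restrict[OF cont])
  moreover have sR: "sets R = sets (restrict_space borel {a..b})"
    unfolding R_def by (rule sets_restrict_space_cong) simp
  ultimately have "\<gamma> \<in> R \<rightarrow>\<^sub>M borel" by (simp cong: measurable_cong_sets)
  then have gm: "\<gamma> \<in> R \<rightarrow>\<^sub>M restrict_space borel (\<gamma> ` {a..b})"
    by (intro measurable_restrict_space2) (auto simp: spR)
  have Am: "A \<in> sets (restrict_space borel (\<gamma> ` {a..b}))" using A by (simp add: sets_arclength)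
  define B where "B = \<gamma> -` A \<inter> {a..b}"
  have BR: "B \<in> sets R" using measurable_sets[OF gm Am] by (simp add: B_def spR)
  then have "B \<in> sets lborel"
    unfolding R_def by (subst (asm) sets_restrict_space_iff) auto
  then show "\<gamma> -` A \<inter> {a..b} \<in> sets lborel" by (simp add: B_def)
  have eB: "emeasure R B = emeasure lborel B"
    unfolding R_def by (rule emeasure_restrict_space) (auto simp: B_def)
  have eM: "emeasure (arclength \<gamma> a b) A = (\<integral>\<^sup>+t. ennreal (f t) * indicator B t \<partial>R)"
  proof -
    have "emeasure (arclength \<gamma> a b) A = emeasure (density R (\<lambda>t. ennreal (f t))) (\<gamma> -` A \<inter> space (density R (\<lambda>t. ennreal (f t))))"
      unfolding arclength_def R_def[symmetric] f_def[symmetric]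
      using gm Am by (intro emeasure_distr) auto
    also have "\<dots> = emeasure (density R (\<lambda>t. ennreal (f t))) B" by (simp add: B_def spR)
    also have "\<dots> = (\<integral>\<^sup>+t. ennreal (f t) * indicator B t \<partial>R)"
      using fm BR by (intro emeasure_density) auto
    finally show ?thesis .
  qed
  have bound: "c \<le> f t \<and> f t \<le> C" if t: "t \<in> {a..b} - X" for t
  proof -
    have t': "a \<le> t" "t < b" using t X by (auto simp: less_le)
    have "c * \<bar>s - t\<bar> \<le> norm (\<gamma> s - \<gamma> t)" if "s \<in> {a..b}" "\<bar>s - t\<bar> < (b - a) / 2" for s
    proof -
      have "arc_gap \<gamma> a b s t = \<bar>s - t\<bar>" using that by (auto simp: arc_gap_def)
      then show ?thesis using low[of s t] that t by (simp add: dist_norm)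
    qed
    then show ?thesis
      unfolding f_def using t ab up[of _ t]
      by (intro conjI norm_vector_derivative_bounds[OF deriv[OF t] t', where r = "(b - a) / 2" and c = c and C = C])
        (auto simp: dist_norm)
  qed
  have "AE t in lborel. t \<notin> X" using X(1) by (intro AE_not_in finite_imp_null_set_lborel)
  then have "AE t in lborel. t \<in> {a..b} \<longrightarrow> c \<le> f t \<and> f t \<le> C"
    by eventually_elim (use bound in auto)
  then have ae: "AE t in R. c \<le> f t \<and> f t \<le> C"
    unfolding R_def by (subst AE_restrict_space_iff) auto
  have const: "(\<integral>\<^sup>+t. ennreal k * indicator B t \<partial>R) = ennreal k * emeasure lborel B" for k
    using BR by (simp add: nn_integral_cmult_indicator eB)
  have "ennreal c * emeasure lborel B \<le> emeasure (arclength \<gamma> a b) A"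
    unfolding eM const[symmetric] using ae
    by (intro nn_integral_mono_AE, eventually_elim) (auto simp: indicator_def ennreal_leI)
  then show "ennreal c * emeasure lborel (\<gamma> -` A \<inter> {a..b}) \<le> emeasure (arclength \<gamma> a b) A" by (simp add: B_def)
  have "emeasure (arclength \<gamma> a b) A \<le> ennreal C * emeasure lborel B"
    unfolding eM const[symmetric] using ae
    by (intro nn_integral_mono_AE, eventually_elim) (auto simp: indicator_def ennreal_leI)
  then show "emeasure (arclength \<gamma> a b) A \<le> ennreal C * emeasure lborel (\<gamma> -` A \<inter> {a..b})" by (simp add: B_def)
qed

section \<open>Meshes are graded partitions\<close>

lemma card_subset_image_list: "S \<subseteq> f ` set xs \<Longrightarrow> card S \<le> length xs"
  using surj_card_le[of "set xs" S f] card_length[of xs] by (force intro: order_trans)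

lemma card_le_4: "S \<subseteq> f ` {i, j, k, l} \<Longrightarrow> card S \<le> 4"
  using card_subset_image_list[of S f "[i, j, k, l]"] by (simp add: numeral_eq_Suc)

text \<open>
  The constants \<open>c\<close> and \<open>C\<close> of the chord-arc and Lipschitz bounds are parameters, so that they are
  chosen once for the curve and do not depend on the mesh.
\<close>
locale curve_mesh =
  fixes \<Omega> \<Gamma> :: "(real^2) set" and \<gamma> :: "real \<Rightarrow> real^2" and a b :: real and z :: "nat \<Rightarrow> real" and n :: nat
    and c C :: real
  assumes curve: "boundary_curve \<Omega> \<Gamma> \<gamma> a b" and mesh: "is_mesh \<Omega> \<Gamma> \<gamma> a b z n"
    and c: "c > 0" and C: "C > 0"
    and low: "\<And>s t. s \<in> {a..b} \<Longrightarrow> t \<in> {a..b} \<Longrightarrow> c * arc_gap \<gamma> a b s t \<le> dist (\<gamma> s) (\<gamma> t)"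
    and up: "\<And>s t. s \<in> {a..b} \<Longrightarrow> t \<in> {a..b} \<Longrightarrow> dist (\<gamma> s) (\<gamma> t) \<le> C * \<bar>s - t\<bar>"
begin

abbreviation "M \<equiv> arclength \<gamma> a b"
abbreviation "I j \<equiv> {z (j - 1)..z j}"
abbreviation "T j \<equiv> \<gamma> ` I j"
abbreviation "\<T> \<equiv> mesh_elements \<gamma> z n"
abbreviation "\<kappa> \<equiv> shape_regularity M \<T>"

lemma ab: "a < b" using curve unfolding boundary_curve_def by blast

lemma ends: "z 0 = a" "z n = b" and step: "\<And>j. j < n \<Longrightarrow> z j < z (Suc j)"
  using mesh unfolding is_mesh_def by blast+

lemma n_pos: "0 < n" using ends ab by (cases n) auto

lemma z_le: "i \<le> j \<Longrightarrow> j \<le> n \<Longrightarrow> z i \<le> z j"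
  using increasing_le[of n z i j] step by blast

lemma z_less: "i < j \<Longrightarrow> j \<le> n \<Longrightarrow> z i < z j"
  using increasing_less[of n z i j] step by blast

lemma z_le_pred: "i < k \<Longrightarrow> k \<le> n \<Longrightarrow> z i \<le> z (k - 1)"
  by (rule z_le) auto

lemma z_le_iff: "i \<le> n \<Longrightarrow> j \<le> n \<Longrightarrow> z i \<le> z j \<longleftrightarrow> i \<le> j"
  using z_le[of i j] z_less[of j i] by (cases "i \<le> j") auto

lemma z_range: "i \<le> n \<Longrightarrow> z i \<in> {a..b}"
  using z_le[of 0 i] z_le[of i n] ends by auto

lemma I_subset: "j \<le> n \<Longrightarrow> I j \<subseteq> {a..b}"
  using z_range[of "j - 1"] z_range[of j] by auto

lemma same_point:
  assumes "s \<in> {a..b}" "t \<in> {a..b}" "\<gamma> s = \<gamma> t"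
  shows "s = t \<or> (s = a \<and> t = b) \<or> (s = b \<and> t = a)"
proof (cases "s \<le> t")
  case True
  then show ?thesis using boundary_curve_inj[OF curve assms(1,2) _ assms(3)] by blast
next
  case False
  then show ?thesis using boundary_curve_inj[OF curve assms(2,1) _ assms(3)[symmetric]] by force
qed

lemma elements_eq: "\<T> = T ` {1..n}" by (simp add: mesh_elements_def)

lemma elementE:
  assumes "S \<in> \<T>"
  obtains j where "j \<in> {1..n}" "S = T j"
  using assms unfolding elements_eq by (rule imageE)

text \<open>
  Parameters outside the interval of the element occur only where a closed curve meets itself: the
  end point \<open>a\<close> is mapped into the last element and \<open>b\<close> into the first.
\<close>
lemma preimage_element:
  assumes "j \<in> {1..n}" "t \<in> {a..b}" "\<gamma> t \<in> T j"
  shows "t \<in> I j \<or> (t = a \<and> j = n) \<or> (t = b \<and> j = 1)"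
proof -
  obtain s where s: "s \<in> I j" "\<gamma> t = \<gamma> s" using assms(3) by auto
  have sab: "s \<in> {a..b}" using s(1) I_subset[of j] assms(1) by auto
  consider "t = s" | "t = a" "s = b" | "t = b" "s = a" using same_point[OF assms(2) sab s(2)] by blast
  then show ?thesis
  proof cases
    case 2
    then have "z n \<le> z j" using s(1) ends by auto
    then have "j = n" using z_le_iff[of n j] assms(1) by auto
    with 2 show ?thesis by simp
  next
    case 3
    then have "z (j - 1) \<le> z 0" using s(1) ends by auto
    then have "j = 1" using z_le_iff[of "j - 1" 0] assms(1) by auto
    with 3 show ?thesis by simp
  qed (use s in auto)
qed

lemma element_sets_M:
  assumes "j \<in> {1..n}"
  shows "T j \<in> sets M"
proof -
  have "continuous_on {a..b} \<gamma>" using curve unfolding boundary_curve_def piecewise_C2_def by blast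
  then have "continuous_on (I j) \<gamma>" using I_subset[of j] assms by (auto intro: continuous_on_subset)
  then have "compact (T j)" by (intro compact_continuous_image) auto
  then have "T j \<in> sets borel" by (intro borel_closed compact_imp_closed)
  moreover have "T j \<subseteq> \<gamma> ` {a..b}" using I_subset[of j] assms by auto
  ultimately have "\<gamma> ` {a..b} \<inter> T j \<in> sets (restrict_space borel (\<gamma> ` {a..b}))"
    by (auto simp: sets_restrict_space)
  moreover have "\<gamma> ` {a..b} \<inter> T j = T j" using \<open>T j \<subseteq> \<gamma> ` {a..b}\<close> by blast
  ultimately show ?thesis by (simp add: sets_arclength)
qed

lemma finite_M: "finite_measure M"
proof
  have sp: "space M \<in> sets M" by simp
  have "\<gamma> -` space M \<inter> {a..b} = {a..b}" by (auto simp: space_arclength)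
  then have "emeasure M (space M) \<le> ennreal C * ennreal (b - a)"
    using arclength_bounds(3)[OF curve c C low up sp] ab by simp
  also have "\<dots> < \<infinity>" by (simp add: ennreal_mult_less_top)
  finally show "emeasure M (space M) \<noteq> \<infinity>" by simp
qed

lemma borel_id_M: "(\<lambda>x. x) \<in> M \<rightarrow>\<^sub>M borel"
proof -
  have "(\<lambda>x. x) \<in> restrict_space borel (\<gamma> ` {a..b}) \<rightarrow>\<^sub>M borel"
    by (intro measurable_restrict_space1) simp
  then show ?thesis by (simp cong: measurable_cong_sets add: sets_arclength)
qed

lemma element_length:
  assumes j: "j \<in> {1..n}"
  shows "c * (z j - z (j - 1)) \<le> measure M (T j)" "measure M (T j) \<le> C * (z j - z (j - 1))"
    "0 < measure M (T j)"
proof -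
  interpret finite_measure M by (rule finite_M)
  let ?B = "\<gamma> -` T j \<inter> {a..b}"
  have len: "z (j - 1) < z j" using z_less[of "j - 1" j] j by auto
  note bounds = arclength_bounds[OF curve c C low up element_sets_M[OF j]]
  have Bm: "?B \<in> sets lborel" by (rule bounds(1))
  have "I j \<subseteq> ?B" using I_subset[of j] j by auto
  then have "emeasure lborel (I j) \<le> emeasure lborel ?B" using Bm by (rule emeasure_mono)
  then have "ennreal c * ennreal (z j - z (j - 1)) \<le> ennreal c * emeasure lborel ?B"
    using len by (intro mult_left_mono) auto
  also have "\<dots> \<le> ennreal (measure M (T j))" using bounds(2) by (simp add: emeasure_eq_measure)
  finally show 1: "c * (z j - z (j - 1)) \<le> measure M (T j)"
    using c len by (simp add: ennreal_mult[symmetric])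
  have "?B \<subseteq> I j \<union> {a, b}" using preimage_element[OF j] by blast
  then have "emeasure lborel ?B \<le> emeasure lborel (I j \<union> {a, b})" by (rule emeasure_mono) auto
  also have "\<dots> \<le> emeasure lborel (I j) + emeasure lborel {a, b}" by (rule emeasure_subadditive) auto
  also have "\<dots> = ennreal (z j - z (j - 1))"
    using len by (simp add: emeasure_lborel_countable)
  finally have "ennreal C * emeasure lborel ?B \<le> ennreal C * ennreal (z j - z (j - 1))"
    by (intro mult_left_mono) auto
  then have "ennreal (measure M (T j)) \<le> ennreal C * ennreal (z j - z (j - 1))"
    using bounds(3) by (auto simp: emeasure_eq_measure intro: order_trans)
  then show "measure M (T j) \<le> C * (z j - z (j - 1))"
    using C len by (simp add: ennreal_mult[symmetric])
  have "0 < c * (z j - z (j - 1))" using c len by simp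
  with 1 show "0 < measure M (T j)" by linarith
qed

lemma finite_ratios: "finite {measure M S / measure M S' | S S'. S \<in> \<T> \<and> S' \<in> \<T> \<and> S \<inter> S' \<noteq> {}}"
proof -
  have "{measure M S / measure M S' | S S'. S \<in> \<T> \<and> S' \<in> \<T> \<and> S \<inter> S' \<noteq> {}}
    \<subseteq> (\<lambda>(S, S'). measure M S / measure M S') ` (\<T> \<times> \<T>)" by auto
  moreover have "finite (\<T> \<times> \<T>)" by (simp add: elements_eq)
  ultimately show ?thesis by (meson finite_imageI finite_subset)
qed

lemma ratio_le:
  assumes "S \<in> \<T>" "S' \<in> \<T>" "S \<inter> S' \<noteq> {}"
  shows "measure M S \<le> \<kappa> * measure M S'"
proof -
  have "measure M S / measure M S' \<le> \<kappa>"
    unfolding shape_regularity_def by (rule Max_ge[OF finite_ratios]) (use assms in blast)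
  moreover have "0 < measure M S'" using element_length(3) elementE[OF assms(2)] by metis
  ultimately show ?thesis by (simp add: pos_divide_le_eq)
qed

lemma kappa_ge_1: "1 \<le> \<kappa>"
proof -
  have "T 1 \<in> \<T>" unfolding elements_eq by (rule imageI) (use n_pos in auto)
  moreover have "T 1 \<noteq> {}" "0 < measure M (T 1)" using n_pos z_le[of 0 1] element_length(3)[of 1] by auto
  ultimately show ?thesis using ratio_le[of "T 1" "T 1"] by simp
qed

lemma right_neighbour: "1 \<le> j \<Longrightarrow> j < n \<Longrightarrow> T j \<inter> T (Suc j) \<noteq> {}"
proof -
  assume j: "1 \<le> j" "j < n"
  have "\<gamma> (z j) \<in> T j" by (rule imageI) (use z_le[of "j - 1" j] j in simp)
  moreover have "\<gamma> (z j) \<in> T (Suc j)" by (rule imageI) (use z_le[of j "Suc j"] j in simp)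
  ultimately show ?thesis by blast
qed

lemma ends_neighbours:
  assumes "\<gamma> a = \<gamma> b"
  shows "T 1 \<inter> T n \<noteq> {}"
proof -
  have "\<gamma> (z 0) \<in> T 1" by (rule imageI) (use z_le[of 0 1] n_pos in simp)
  moreover have "\<gamma> (z n) \<in> T n" by (rule imageI) (use z_le[of "n - 1" n] in simp)
  ultimately show ?thesis using assms ends by auto
qed

text \<open>
  The arc from \<open>s\<close> to \<open>t\<close> leaves the element of \<open>s\<close> through one of its end points and then covers
  the neighbour there completely. On a closed curve this holds for both arcs.
\<close>
lemma arc_gap_ge_neighbour_ordered:
  assumes j: "j \<in> {1..n}" and k: "k \<in> {1..n}" and jk: "j < k" and disj: "T j \<inter> T k = {}"
    and s: "s \<in> I j" and t: "t \<in> I k"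
  shows "\<exists>l\<in>{1..n}. T j \<inter> T l \<noteq> {} \<and> z l - z (l - 1) \<le> arc_gap \<gamma> a b s t"
    and "\<exists>l\<in>{1..n}. T k \<inter> T l \<noteq> {} \<and> z l - z (l - 1) \<le> arc_gap \<gamma> a b s t"
proof -
  have jn: "1 \<le> j" "j < n" "1 \<le> k - 1" "k - 1 < n" "k \<le> n" using j k jk by auto
  have kk: "Suc (k - 1) = k" using jn by simp
  have right: "T j \<inter> T (Suc j) \<noteq> {}" by (rule right_neighbour[OF jn(1,2)])
  have left: "T k \<inter> T (k - 1) \<noteq> {}" using right_neighbour[OF jn(3,4)] kk by (metis Int_commute)
  have sj: "z (j - 1) \<le> s" "s \<le> z j" and tk: "z (k - 1) \<le> t" "t \<le> z k" using s t by auto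
  have st: "s \<le> t" using z_le_pred[OF jk jn(5)] sj tk by linarith
  have "k \<noteq> Suc j" using right disj by metis
  then have "Suc j < k" "j < k - 1" using jk by auto
  then have "z (Suc j) \<le> z (k - 1)" "z j \<le> z (k - 1 - 1)"
    using z_le_pred[of "Suc j" k] z_le_pred[of j "k - 1"] jn by auto
  then have inner: "z (Suc j) - z (Suc j - 1) \<le> \<bar>s - t\<bar>" "z (k - 1) - z (k - 1 - 1) \<le> \<bar>s - t\<bar>"
    using sj tk by auto
  have mem: "Suc j \<in> {1..n}" "k - 1 \<in> {1..n}" using jn by auto
  have outer: "\<exists>l\<in>{1..n}. T j \<inter> T l \<noteq> {} \<and> z l - z (l - 1) \<le> b - a - \<bar>s - t\<bar>"
    "\<exists>l\<in>{1..n}. T k \<inter> T l \<noteq> {} \<and> z l - z (l - 1) \<le> b - a - \<bar>s - t\<bar>" if closed: "\<gamma> a = \<gamma> b"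
  proof -
    note n1 = ends_neighbours[OF closed]
    have sa: "a \<le> s" "t \<le> b" using s t I_subset[of j] I_subset[of k] j k by auto
    show "\<exists>l\<in>{1..n}. T j \<inter> T l \<noteq> {} \<and> z l - z (l - 1) \<le> b - a - \<bar>s - t\<bar>"
    proof (cases "j = 1")
      case True
      then have "k \<noteq> n" using n1 disj by metis
      then have "z k \<le> z (n - 1)" using z_le_pred[of k n] jn by simp
      then have "z n - z (n - 1) \<le> b - a - \<bar>s - t\<bar>" using sa tk st ends by linarith
      then show ?thesis using n1 n_pos unfolding True by (intro bexI[of _ n] conjI) simp_all
    next
      case False
      then have j1: "1 \<le> j - 1" "j - 1 < n" "Suc (j - 1) = j" using jn by auto
      have "T j \<inter> T (j - 1) \<noteq> {}" using right_neighbour[OF j1(1,2)] j1(3) by (metis Int_commute)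
      moreover have "z 0 \<le> z (j - 1 - 1)" by (rule z_le) (use jn in auto)
      then have "z (j - 1) - z (j - 1 - 1) \<le> b - a - \<bar>s - t\<bar>" using sa sj st ends by linarith
      moreover have "j - 1 \<in> {1..n}" using j1 by auto
      ultimately show ?thesis by metis
    qed
    show "\<exists>l\<in>{1..n}. T k \<inter> T l \<noteq> {} \<and> z l - z (l - 1) \<le> b - a - \<bar>s - t\<bar>"
    proof (cases "k = n")
      case True
      then have "j \<noteq> 1" using n1 disj by metis
      then have "z 1 \<le> z (j - 1)" using z_le_pred[of 1 j] jn by simp
      then have len: "z 1 - z (1 - 1) \<le> b - a - \<bar>s - t\<bar>" using sa sj st ends by simp
      have "T k \<inter> T 1 \<noteq> {}" using n1 True by (metis Int_commute)
      moreover have "1 \<in> {1..n}" using n_pos by simp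
      ultimately show ?thesis using len by metis
    next
      case False
      then have kn: "1 \<le> k" "k < n" using jn by auto
      have "z (Suc k) \<le> z n" by (rule z_le) (use kn in auto)
      then have "z (Suc k) - z (Suc k - 1) \<le> b - a - \<bar>s - t\<bar>" using sa tk st ends by simp
      moreover have "Suc k \<in> {1..n}" using kn by simp
      ultimately show ?thesis using right_neighbour[OF kn] by metis
    qed
  qed
  have gap: "arc_gap \<gamma> a b s t = \<bar>s - t\<bar> \<or> (\<gamma> a = \<gamma> b \<and> arc_gap \<gamma> a b s t = b - a - \<bar>s - t\<bar>)"
    by (simp add: arc_gap_def min_def)
  show "\<exists>l\<in>{1..n}. T j \<inter> T l \<noteq> {} \<and> z l - z (l - 1) \<le> arc_gap \<gamma> a b s t"
    using gap
  proof (elim disjE conjE)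
    assume "arc_gap \<gamma> a b s t = \<bar>s - t\<bar>"
    then show ?thesis using right inner(1) mem(1) by metis
  next
    assume "\<gamma> a = \<gamma> b" "arc_gap \<gamma> a b s t = b - a - \<bar>s - t\<bar>"
    with outer(1) show ?thesis by simp
  qed
  show "\<exists>l\<in>{1..n}. T k \<inter> T l \<noteq> {} \<and> z l - z (l - 1) \<le> arc_gap \<gamma> a b s t"
    using gap
  proof (elim disjE conjE)
    assume "arc_gap \<gamma> a b s t = \<bar>s - t\<bar>"
    then show ?thesis using left inner(2) mem(2) by metis
  next
    assume "\<gamma> a = \<gamma> b" "arc_gap \<gamma> a b s t = b - a - \<bar>s - t\<bar>"
    with outer(2) show ?thesis by simp
  qed
qed

lemma arc_gap_ge_neighbour:
  assumes jk: "j \<in> {1..n}" "k \<in> {1..n}" and disj: "T j \<inter> T k = {}" and s: "s \<in> I j" and t: "t \<in> I k"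
  shows "\<exists>l\<in>{1..n}. T j \<inter> T l \<noteq> {} \<and> z l - z (l - 1) \<le> arc_gap \<gamma> a b s t"
proof -
  have "\<gamma> s \<in> T j" using s by (rule imageI)
  then have "j \<noteq> k" using disj by (metis Int_absorb empty_iff)
  then consider "j < k" | "k < j" by linarith
  then show ?thesis
  proof cases
    case 1
    then show ?thesis by (rule arc_gap_ge_neighbour_ordered(1)[OF jk _ disj s t])
  next
    case 2
    have "T k \<inter> T j = {}" using disj by (metis Int_commute)
    from arc_gap_ge_neighbour_ordered(2)[OF jk(2,1) 2 this t s] show ?thesis
      by (simp only: arc_gap_commute[of _ _ _ t s])
  qed
qed

text \<open>
  A neighbour lies between two disjoint elements, and its length is comparable with that of the
  first one by shape regularity.
\<close>
lemma separated_elements: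
  assumes jk: "j \<in> {1..n}" "k \<in> {1..n}" "T j \<inter> T k = {}" and x: "x \<in> T j" and y: "y \<in> T k"
  shows "c / (C * \<kappa>) * measure M (T j) \<le> dist x y"
proof -
  obtain s where s: "s \<in> I j" "x = \<gamma> s" using x by auto
  obtain t where t: "t \<in> I k" "y = \<gamma> t" using y by auto
  obtain l where l: "l \<in> {1..n}" "T j \<inter> T l \<noteq> {}" "z l - z (l - 1) \<le> arc_gap \<gamma> a b s t"
    using arc_gap_ge_neighbour[OF jk s(1) t(1)] by blast
  have "measure M (T j) \<le> \<kappa> * measure M (T l)"
    using l jk by (intro ratio_le) (auto simp: elements_eq)
  also have "\<dots> \<le> \<kappa> * (C * (z l - z (l - 1)))"
    using element_length(2)[OF l(1)] kappa_ge_1 by (intro mult_left_mono) auto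
  also have "\<dots> \<le> \<kappa> * (C * arc_gap \<gamma> a b s t)"
    using l(3) kappa_ge_1 C by (intro mult_left_mono) auto
  finally have "c / (C * \<kappa>) * measure M (T j) \<le> c / (C * \<kappa>) * (\<kappa> * (C * arc_gap \<gamma> a b s t))"
    using c C kappa_ge_1 by (intro mult_left_mono) auto
  also have "\<dots> = c * arc_gap \<gamma> a b s t" using C kappa_ge_1 by simp
  also have "\<dots> \<le> dist x y"
    unfolding s(2) t(2) using s(1) t(1) I_subset[of j] I_subset[of k] jk by (intro low) auto
  finally show ?thesis .
qed

text \<open>
  By the chord-arc bound the parameters of a ball of radius \<open>R\<close> around \<open>\<gamma> s\<close> lie within \<open>R / c\<close> of
  \<open>s\<close>, or within that distance of one of the ends \<open>a\<close> and \<open>b\<close> if the short arc runs through the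
  closing point.
\<close>
lemma upper_regular_M:
  assumes x: "x \<in> space M" and R: "0 < R"
  shows "emeasure M (cball x R \<inter> space M) \<le> ennreal (4 * C / c * R)"
proof -
  obtain s where s: "s \<in> {a..b}" "x = \<gamma> s" using x by (auto simp: space_arclength)
  define r where "r = R / c"
  have r: "0 < r" using R c by (simp add: r_def)
  define A where "A = cball x R \<inter> space M"
  have "(\<lambda>y. y) -` cball x R \<inter> space M \<in> sets M" by (intro measurable_sets[OF borel_id_M]) auto
  then have A: "A \<in> sets M" by (simp add: A_def)
  note bounds = arclength_bounds[OF curve c C low up A]
  have "\<gamma> -` A \<inter> {a..b} \<subseteq> {s - r..s + r} \<union> ({a..a + r} \<union> {b - r..b})"
  proof
    fix t assume t: "t \<in> \<gamma> -` A \<inter> {a..b}"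
    then have "dist (\<gamma> s) (\<gamma> t) \<le> R" by (auto simp: A_def s)
    then have "c * arc_gap \<gamma> a b s t \<le> R" using low[OF s(1), of t] t by auto
    then have "arc_gap \<gamma> a b s t \<le> r" using c by (simp add: r_def pos_le_divide_eq mult.commute)
    then have "\<bar>s - t\<bar> \<le> r \<or> b - a - \<bar>s - t\<bar> \<le> r" by (auto simp: arc_gap_def split: if_splits)
    then show "t \<in> {s - r..s + r} \<union> ({a..a + r} \<union> {b - r..b})" using s(1) t by auto
  qed
  then have "emeasure lborel (\<gamma> -` A \<inter> {a..b}) \<le> emeasure lborel ({s - r..s + r} \<union> ({a..a + r} \<union> {b - r..b}))"
    by (rule emeasure_mono) auto
  also have "\<dots> \<le> emeasure lborel {s - r..s + r} + emeasure lborel ({a..a + r} \<union> {b - r..b})"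
    by (rule emeasure_subadditive) auto
  also have "\<dots> \<le> emeasure lborel {s - r..s + r} + (emeasure lborel {a..a + r} + emeasure lborel {b - r..b})"
    by (intro add_left_mono emeasure_subadditive) auto
  also have "\<dots> = ennreal (4 * r)" using r by (simp add: ennreal_plus[symmetric] del: ennreal_plus)
  finally have "ennreal C * emeasure lborel (\<gamma> -` A \<inter> {a..b}) \<le> ennreal C * ennreal (4 * r)"
    by (intro mult_left_mono) auto
  with bounds(3) have "emeasure M A \<le> ennreal C * ennreal (4 * r)" by (rule order_trans)
  also have "\<dots> = ennreal (C * (4 * r))" using C r by (intro ennreal_mult[symmetric]) auto
  also have "C * (4 * r) = 4 * C / c * R" by (simp add: r_def)
  finally show ?thesis by (simp add: A_def)
qed

text \<open>
  A parameter lies in at most two of the intervals. The first and the last element are added for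
  the sake of the closing point of a closed curve.
\<close>
lemma few_elements:
  assumes "x \<in> space M"
  shows "card {S \<in> \<T>. x \<in> S} \<le> 4"
proof -
  obtain s where s: "s \<in> {a..b}" "x = \<gamma> s" using assms by (auto simp: space_arclength)
  (* The index n is listed for the parameter b, which lies in no half-open interval of the mesh. *)
  obtain i where i: "\<And>j. j \<in> {1..n} \<Longrightarrow> s \<in> I j \<Longrightarrow> j \<in> {i, Suc i, n}"
  proof (cases "s < b")
    case True
    then obtain i where i: "i < n" "z i \<le> s" "s < z (Suc i)"
      using subinterval_right[of z s n] s ends by auto
    have "j \<in> {i, Suc i}" if j: "j \<in> {1..n}" "s \<in> I j" for j
    proof -
      have "i \<le> j" using z_le_iff[of i j] i j by auto
      moreover have "j - 1 < Suc i" using z_le_iff[of "Suc i" "j - 1"] i j by fastforce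
      ultimately show ?thesis by auto
    qed
    then show thesis using that[of i] by blast
  next
    case False
    then have "s = b" using s by auto
    have "j = n" if "j \<in> {1..n}" "s \<in> I j" for j
      using z_le_iff[of n j] that \<open>s = b\<close> ends by auto
    then show thesis using that[of n] by blast
  qed
  have "{S \<in> \<T>. x \<in> S} \<subseteq> T ` {i, Suc i, 1, n}"
  proof
    fix S assume "S \<in> {S \<in> \<T>. x \<in> S}"
    then obtain j where j: "j \<in> {1..n}" "S = T j" "x \<in> T j" using elementE by blast
    have "j \<in> {i, Suc i, 1, n}" using preimage_element[OF j(1) s(1)] j(3) s(2) i[OF j(1)] by auto
    then show "S \<in> T ` {i, Suc i, 1, n}" unfolding j(2) by (rule imageI)
  qed
  then show ?thesis by (rule card_le_4)
qed

lemma few_nodes_element: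
  assumes j: "j \<in> {1..n}"
  shows "card {v \<in> mesh_nodes \<gamma> z n. v \<in> T j} \<le> 4"
proof -
  have "{v \<in> mesh_nodes \<gamma> z n. v \<in> T j} \<subseteq> (\<lambda>i. \<gamma> (z i)) ` {j - 1, j, 0, n}"
  proof
    fix v assume "v \<in> {v \<in> mesh_nodes \<gamma> z n. v \<in> T j}"
    then obtain i where i: "i \<le> n" "v = \<gamma> (z i)" "\<gamma> (z i) \<in> T j" by (auto simp: mesh_nodes_def)
    have "z i \<in> I j \<or> z i = a \<or> z i = b" using preimage_element[OF j z_range[OF i(1)] i(3)] by blast
    then have "i \<in> {j - 1, j, 0, n}"
    proof (elim disjE)
      assume zi: "z i \<in> I j"
      have "j - 1 \<le> n" "j \<le> n" using j by auto
      then have "j - 1 \<le> i" "i \<le> j" using z_le_iff[of "j - 1" i] z_le_iff[of i j] i(1) zi by simp_all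
      then have "i = j - 1 \<or> i = j" by linarith
      then show ?thesis by blast
    next
      assume "z i = a"
      then have "z i \<le> z 0" using ends by simp
      then show ?thesis using z_le_iff[of i 0] i(1) by simp
    next
      assume "z i = b"
      then have "z n \<le> z i" using ends by simp
      then show ?thesis using z_le_iff[of n i] i(1) by simp
    qed
    then show "v \<in> (\<lambda>i. \<gamma> (z i)) ` {j - 1, j, 0, n}" unfolding i(2) by (rule imageI)
  qed
  then show ?thesis by (rule card_le_4)
qed

text \<open>
  Distinct parameter intervals share at most an end point, and the closing point of a closed curve
  is a node as well.
\<close>
lemma meet_in_node_ordered:
  assumes jk: "j \<in> {1..n}" "k \<in> {1..n}" "j < k" and x: "x \<in> T j" "x \<in> T k"
  shows "x \<in> mesh_nodes \<gamma> z n"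
proof -
  obtain s where s: "x = \<gamma> s" "s \<in> I j" using x(1) by (rule imageE)
  have sab: "s \<in> {a..b}" using s I_subset[of j] jk by auto
  have "\<gamma> s \<in> T k" using x(2) unfolding s(1) .
  from preimage_element[OF jk(2) sab this] have "s \<in> I k \<or> s = a \<or> s = b" by argo
  then have "\<exists>i\<le>n. s = z i"
  proof (elim disjE)
    assume "s \<in> I k"
    then have "s = z j" using s(2) z_le_pred[of j k] jk by auto
    then show ?thesis using jk by (intro exI[of _ j]) auto
  qed (use s ends in auto)
  then show ?thesis unfolding s(1) mesh_nodes_def by auto
qed

lemma meet_in_node_M:
  assumes jk: "j \<in> {1..n}" "k \<in> {1..n}" and "T j \<inter> T k \<noteq> {}"
  shows "\<exists>v\<in>mesh_nodes \<gamma> z n. v \<in> T j \<inter> T k"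
proof (cases "j = k")
  case True
  have "\<gamma> (z j) \<in> T j" using z_le[of "j - 1" j] jk by auto
  moreover have "\<gamma> (z j) \<in> mesh_nodes \<gamma> z n" using jk by (auto simp: mesh_nodes_def)
  ultimately show ?thesis using True by blast
next
  case False
  obtain x where x: "x \<in> T j" "x \<in> T k" using assms(3) by blast
  have "x \<in> mesh_nodes \<gamma> z n"
  proof (cases "j < k")
    case True
    then show ?thesis by (rule meet_in_node_ordered[OF jk _ x])
  next
    case nless: False
    then have "k < j" using False by simp
    then show ?thesis by (rule meet_in_node_ordered[OF jk(2,1) _ x(2,1)])
  qed
  then show ?thesis using x by blast
qed

lemma diameter_element:
  assumes j: "j \<in> {1..n}" and x: "x \<in> T j" "y \<in> T j"
  shows "dist x y \<le> C / c * measure M (T j)"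
proof -
  obtain s t where st: "s \<in> I j" "x = \<gamma> s" "t \<in> I j" "y = \<gamma> t" using x by blast
  have "dist x y \<le> C * \<bar>s - t\<bar>"
    unfolding st(2,4) using st I_subset[of j] j by (intro up) auto
  also have "\<dots> \<le> C * (z j - z (j - 1))" using st C by (intro mult_left_mono) auto
  also have "\<dots> = C / c * (c * (z j - z (j - 1)))" using c by simp
  also have "\<dots> \<le> C / c * measure M (T j)"
    using element_length(1)[OF j] c C by (intro mult_left_mono) auto
  finally show ?thesis .
qed

sublocale graded_partition M \<T> "mesh_nodes \<gamma> z n" 4 \<kappa> "C / c" "c / (C * \<kappa>)" "4 * C / c"
proof -
  interpret finite_measure M by (rule finite_M)
  show "graded_partition M \<T> (mesh_nodes \<gamma> z n) 4 \<kappa> (C / c) (c / (C * \<kappa>)) (4 * C / c)"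
  proof
    show "(\<lambda>x. x) \<in> M \<rightarrow>\<^sub>M borel" by (rule borel_id_M)
    show "finite \<T>" "finite (mesh_nodes \<gamma> z n)" by (auto simp: elements_eq mesh_nodes_def)
    show "S \<in> sets M" "0 < measure M S" if "S \<in> \<T>" for S
      using elementE[OF that] element_sets_M element_length(3) by metis+
    show "space M \<subseteq> \<Union>\<T>"
    proof
      fix x assume "x \<in> space M"
      then obtain s where s: "s \<in> {a..b}" "x = \<gamma> s" by (auto simp: space_arclength)
      have "\<exists>i<n. z i \<le> s \<and> s \<le> z (Suc i)"
      proof (cases "s < b")
        case True
        then show ?thesis using subinterval_right[of z s n] s ends by fastforce
      next
        case False
        then show ?thesis using subinterval_left[of z s n] s ends ab by fastforce
      qed
      then obtain i where i: "i < n" "z i \<le> s" "s \<le> z (Suc i)" by blast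
      then have "x \<in> T (Suc i)" using s(2) by auto
      moreover have "T (Suc i) \<in> \<T>" unfolding elements_eq by (rule imageI) (use i in auto)
      ultimately show "x \<in> \<Union>\<T>" by blast
    qed
    show "mesh_nodes \<gamma> z n \<subseteq> space M" using z_range by (auto simp: mesh_nodes_def space_arclength)
    show "card {S \<in> \<T>. x \<in> S} \<le> 4" if "x \<in> space M" for x by (rule few_elements[OF that])
    show "card {v \<in> mesh_nodes \<gamma> z n. v \<in> S} \<le> 4" if "S \<in> \<T>" for S
      using elementE[OF that] few_nodes_element by metis
    show "\<exists>v\<in>mesh_nodes \<gamma> z n. v \<in> S \<inter> S'" if S: "S \<in> \<T>" "S' \<in> \<T>" "S \<inter> S' \<noteq> {}" for S S'
    proof -
      obtain j k where jk: "j \<in> {1..n}" "k \<in> {1..n}" "S = T j" "S' = T k"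
        using elementE[OF S(1)] elementE[OF S(2)] by metis
      show ?thesis using meet_in_node_M[OF jk(1,2)] S(3) unfolding jk(3,4) by blast
    qed
    show "measure M S \<le> \<kappa> * measure M S'" if "S \<in> \<T>" "S' \<in> \<T>" "S \<inter> S' \<noteq> {}" for S S'
      by (rule ratio_le[OF that])
    show "dist x y \<le> C / c * measure M S" if S: "S \<in> \<T>" "x \<in> S" "y \<in> S" for S x y
    proof -
      obtain j where "j \<in> {1..n}" "S = T j" using S(1) by (rule elementE)
      then show ?thesis using diameter_element S by blast
    qed
    show "c / (C * \<kappa>) * measure M S \<le> dist x y"
      if S: "S \<in> \<T>" "S' \<in> \<T>" "S \<inter> S' = {}" "x \<in> S" "y \<in> S'" for S S' x y
    proof -
      obtain j k where jk: "j \<in> {1..n}" "k \<in> {1..n}" "S = T j" "S' = T k"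
        using elementE[OF S(1)] elementE[OF S(2)] by metis
      show ?thesis using separated_elements[OF jk(1,2)] S unfolding jk(3,4) by blast
    qed
    show "emeasure M (cball x R \<inter> space M) \<le> ennreal (4 * C / c * R)" if "x \<in> space M" "0 < R" for x R
      by (rule upper_regular_M[OF that])
    show "1 \<le> \<kappa>" by (rule kappa_ge_1)
    show "0 \<le> C / c" "0 < c / (C * \<kappa>)" "0 \<le> 4 * C / c" using c C kappa_ge_1 by auto
  qed
qed

end

section \<open>Efficiency and reliability\<close>

context graded_partition begin

text \<open>
  The estimator is a sum of real numbers and the preceding estimates are about extended ones; both
  agree as long as no summand is infinite.
\<close>
lemma error_estimator_eq:
  assumes "(\<Sum>z\<in>\<N>. node_seminorm_sq u z) < \<infinity>"
  shows "error_estimator M \<T> \<N> u = sqrt (enn2real (\<Sum>z\<in>\<N>. node_seminorm_sq u z))"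
proof -
  have "node_seminorm_sq u z < \<infinity>" if "z \<in> \<N>" for z
    using assms that finite_nodes by (simp add: less_top[symmetric])
  then have "enn2real (\<Sum>z\<in>\<N>. node_seminorm_sq u z) = (\<Sum>z\<in>\<N>. enn2real (node_seminorm_sq u z))"
    by (subst enn2real_sum) (auto simp: less_top)
  then show ?thesis by (simp add: error_estimator_def H12_seminorm_def)
qed

lemma sum_node_seminorms_finite:
  assumes u: "u \<in> H12_space M"
  shows "(\<Sum>z\<in>\<N>. node_seminorm_sq u z) < \<infinity>"
proof -
  have m: "u \<in> borel_measurable M" and fin: "H12_semi_sq M u < \<infinity>"
    using u by (auto simp: H12_space_iff L2_space_def)
  have "of_nat (N * N) * H12_semi_sq M u < \<infinity>"
    using fin unfolding ennreal_of_nat_eq_real_of_nat by (simp add: ennreal_mult_less_top del: of_nat_mult)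
  with sum_node_patches_le[OF m] show ?thesis by (rule order_le_less_trans)
qed

lemma error_estimator_le_H12_norm:
  assumes u: "u \<in> H12_space M"
  shows "error_estimator M \<T> \<N> u \<le> real N * H12_norm M u"
proof -
  have m: "u \<in> borel_measurable M" and fin: "L2_sq M u + H12_semi_sq M u < \<infinity>"
    using u by (auto simp: H12_space_def L2_space_def)
  have "(\<Sum>z\<in>\<N>. node_seminorm_sq u z) \<le> of_nat (N * N) * (L2_sq M u + H12_semi_sq M u)"
    by (rule order_trans[OF sum_node_patches_le[OF m]]) (intro mult_left_mono, auto)
  then have "enn2real (\<Sum>z\<in>\<N>. node_seminorm_sq u z) \<le> enn2real (of_nat (N * N) * (L2_sq M u + H12_semi_sq M u))"
    using fin unfolding ennreal_of_nat_eq_real_of_nat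
    by (intro enn2real_mono) (auto simp add: ennreal_mult_less_top simp del: of_nat_mult)
  also have "\<dots> = real (N * N) * enn2real (L2_sq M u + H12_semi_sq M u)"
    by (simp add: enn2real_mult ennreal_of_nat_eq_real_of_nat del: of_nat_mult)
  finally have "sqrt (enn2real (\<Sum>z\<in>\<N>. node_seminorm_sq u z))
      \<le> sqrt (real N * real N * enn2real (L2_sq M u + H12_semi_sq M u))"
    by (intro real_sqrt_le_mono) simp
  then show ?thesis
    unfolding error_estimator_eq[OF sum_node_seminorms_finite[OF u]] H12_norm_def
    by (simp add: real_sqrt_mult)
qed

lemma H12_norm_le_error_estimator:
  assumes u: "u \<in> H12_space M" and q: "0 < q"
    and far: "\<And>T. T \<in> \<T> \<Longrightarrow> \<exists>S. T \<subseteq> S \<and> S \<subseteq> elem_patch \<T> m T \<and>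
      far_from_constants M q u S"
    and K: "real (N * N) + (measure M (space M) + 16 * real N * A / \<delta>) * (oscillation_const N \<kappa> D m / q) \<le> K"
  shows "H12_norm M u \<le> sqrt K * error_estimator M \<T> \<N> u"
proof -
  define K' where "K' = real (N * N) + (measure M (space M) + 16 * real N * A / \<delta>) * (oscillation_const N \<kappa> D m / q)"
  have "0 \<le> K'"
    using regular_const delta q kappa oscillation_const_nonneg[of \<kappa> N D m] by (simp add: K'_def)
  then have K0: "0 \<le> K" using K by (simp add: K'_def)
  have m: "u \<in> borel_measurable M" using u by (auto simp: H12_space_iff L2_space_def)
  define S where "S = (\<Sum>z\<in>\<N>. node_seminorm_sq u z)"
  have fin: "S < \<infinity>" unfolding S_def by (rule sum_node_seminorms_finite[OF u])
  have "L2_sq M u + H12_semi_sq M u \<le> ennreal K' * S"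
    unfolding K'_def S_def by (rule H12_norm_sq_le_node_patches[OF m q far])
  also have "\<dots> \<le> ennreal K * S"
    using K by (intro mult_right_mono ennreal_leI) (auto simp: K'_def)
  finally have "enn2real (L2_sq M u + H12_semi_sq M u) \<le> enn2real (ennreal K * S)"
    using fin by (intro enn2real_mono) (auto simp: ennreal_mult_less_top)
  also have "\<dots> = K * enn2real S" using K0 by (simp add: enn2real_mult)
  finally have "H12_norm M u \<le> sqrt (K * enn2real S)"
    unfolding H12_norm_def by (rule real_sqrt_le_mono)
  then show ?thesis
    unfolding error_estimator_eq[OF sum_node_seminorms_finite[OF u]] by (simp add: real_sqrt_mult S_def)
qed

text \<open>
  The support of \<open>\<psi> T\<close> serves as the set on which the residual, being orthogonal to \<open>\<psi> T\<close>, is far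
  from constants.
\<close>
lemma galerkin_residual_far_from_constants:
  assumes r: "residual M V f p \<in> H12_space M" and L2: "f \<in> L2_space M" "V (L2_to_dual M p) \<in> L2_space M"
    and X: "X \<subseteq> L2_space M" and gal: "galerkin_solution M V f X p"
    and A1: "assumption_A1 M \<T> X m \<psi>" and A2: "assumption_A2 M \<T> q \<psi>" and q: "q \<le> 1" and T: "T \<in> \<T>"
  shows "\<exists>S. T \<subseteq> S \<and> S \<subseteq> elem_patch \<T> m T \<and>
      far_from_constants M q (residual M V f p) S"
proof -
  define S where "S = ess_supp M (\<psi> T)"
  have psi: "\<psi> T \<in> X" "T \<subseteq> S" "S \<subseteq> elem_patch \<T> m T"
    using A1 T unfolding assumption_A1_def S_def by auto
  have "S \<in> sets M" unfolding S_def by (rule ess_supp_measurable[OF borel_id])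
  then have "measure M T \<le> measure M S" using psi(2) by (intro finite_measure_mono)
  then have pos: "0 < measure M S" using element_pos[OF T] by linarith
  have "L2_sq (restrict_space M S) (\<lambda>x. 1 - \<psi> T x) \<le> ennreal ((1 - q) * measure M S)"
    using A2 T unfolding assumption_A2_def S_def by auto
  then have "far_from_constants M q (residual M V f p) S"
    using H12_subset_L2[OF r] psi(1) X galerkin_orthogonality[OF L2 X gal psi(1)] pos q
    by (intro allI orthogonal_far_from_constants[OF finite_measure_axioms borel_id, where \<psi> = "\<psi> T"])
      (auto simp: S_def)
  with psi show ?thesis by blast
qed

end

theorem theorem3p1:
  fixes \<Omega> \<Gamma> :: "(real^2) set" and \<gamma> :: "real \<Rightarrow> real^2" and a b :: real
    and M :: "(real^2) measure"
    and V :: "((real^2 \<Rightarrow> real) \<Rightarrow> real) \<Rightarrow> real^2 \<Rightarrow> real"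
  assumes "boundary_curve \<Omega> \<Gamma> \<gamma> a b"
    and "M = arclength \<gamma> a b"
    and "elliptic_isomorphism M V"
  shows "\<exists>Ceff :: real. \<exists>Crel :: nat \<Rightarrow> real \<Rightarrow> real \<Rightarrow> real.
    0 < Ceff \<and> (\<forall>m \<kappa> q. 0 < Crel m \<kappa> q) \<and>
    (\<forall>f \<phi> z n X \<phi>h \<T> \<eta>.
       f \<in> H12_space M \<longrightarrow> weak_solution M V f \<phi> \<longrightarrow>
       is_mesh \<Omega> \<Gamma> \<gamma> a b z n \<longrightarrow> \<T> = mesh_elements \<gamma> z n \<longrightarrow>
       discrete_subspace M X \<longrightarrow> galerkin_solution M V f X \<phi>h \<longrightarrow>
       \<eta> = error_estimator M \<T> (mesh_nodes \<gamma> z n) (residual M V f \<phi>h) \<longrightarrow>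
       \<eta> \<le> Ceff * dual_norm M (dual_diff M \<phi> (L2_to_dual M \<phi>h)) \<and>
       (\<forall>m q. 0 < q \<longrightarrow> q \<le> 1 \<longrightarrow>
          (\<exists>\<psi>. assumption_A1 M \<T> X m \<psi> \<and> assumption_A2 M \<T> q \<psi>) \<longrightarrow>
          dual_norm M (dual_diff M \<phi> (L2_to_dual M \<phi>h)) \<le> Crel m (shape_regularity M \<T>) q * \<eta>))"
proof -
  have ab: "a < b" and pw: "piecewise_C2 a b \<gamma>" using assms(1) unfolding boundary_curve_def by blast+
  obtain c where c: "c > 0"
    and low: "\<And>s t. s \<in> {a..b} \<Longrightarrow> t \<in> {a..b} \<Longrightarrow> c * arc_gap \<gamma> a b s t \<le> dist (\<gamma> s) (\<gamma> t)"
    using chord_arc[OF assms(1)] by blast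
  obtain C where C: "C > 0"
    and up: "\<And>s t. s \<in> {a..b} \<Longrightarrow> t \<in> {a..b} \<Longrightarrow> dist (\<gamma> s) (\<gamma> t) \<le> C * \<bar>s - t\<bar>"
    using piecewise_C2_lipschitz[OF pw ab] by blast
  obtain CV where CV: "\<And>F. F \<in> dual_space M \<Longrightarrow> H12_norm M (V F) \<le> CV * dual_norm M F"
    using assms(3) unfolding elliptic_isomorphism_def by blast
  obtain CI where CI: "\<And>F. F \<in> dual_space M \<Longrightarrow> dual_norm M F \<le> CI * H12_norm M (V F)"
    using assms(3) unfolding elliptic_isomorphism_def by blast
  (* The factor 4 bounds the elements through a point and the nodes of an element. Absolute values
     and added ones make the constants positive for all arguments, including meaningless ones. *)
  define Ceff where "Ceff = 4 * (\<bar>CV\<bar> + 1)"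
  define K where "K m \<kappa> q = real (4 * 4) + (measure M (space M) + 16 * real 4 * (4 * C / c) / (c / (C * \<kappa>)))
    * (oscillation_const 4 \<kappa> (C / c) m / q)" for m \<kappa> q
  define Crel where "Crel m \<kappa> q = (\<bar>CI\<bar> + 1) * sqrt (\<bar>K m \<kappa> q\<bar> + 1)" for m \<kappa> q
  show ?thesis
  proof (intro exI[of _ Ceff] exI[of _ Crel] conjI allI impI)
    show "0 < Ceff" by (simp add: Ceff_def)
    show "0 < Crel m \<kappa> q" for m \<kappa> q
      unfolding Crel_def by (intro mult_pos_pos) (auto intro: add_nonneg_pos)
  next
    fix f \<phi> z n X p \<T> \<eta>
    assume f: "f \<in> H12_space M" and phi: "weak_solution M V f \<phi>" and mesh: "is_mesh \<Omega> \<Gamma> \<gamma> a b z n"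
      and \<T>: "\<T> = mesh_elements \<gamma> z n" and X: "discrete_subspace M X" and gal: "galerkin_solution M V f X p"
      and \<eta>: "\<eta> = error_estimator M \<T> (mesh_nodes \<gamma> z n) (residual M V f p)"
    interpret curve_mesh \<Omega> \<Gamma> \<gamma> a b z n c C
      by unfold_locales (fact assms(1) mesh c C low up)+
    note \<M> = assms(2)
    define r where "r = residual M V f p"
    define e where "e = dual_diff M \<phi> (L2_to_dual M p)"
    note \<eta>_def = \<eta>[folded r_def]
    have XL2: "X \<subseteq> L2_space M" using X by (simp add: discrete_subspace_def)
    have p: "p \<in> L2_space M" using gal XL2 by (auto simp: galerkin_solution_def)
    interpret S: sigma_finite_borel M unfolding \<M> by (rule sigma_finite_borel_axioms)
    note err = S.operator_error_eq_residual[OF assms(3) f phi p, folded e_def r_def]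
    have norm_eq: "H12_norm M (V e) = H12_norm M r" by (rule H12_norm_cong_AE[OF err(2)])
    have e0: "0 \<le> dual_norm M e" by (rule dual_norm_nonneg[OF err(1)])
    have \<eta>0: "0 \<le> \<eta>" unfolding \<eta>_def error_estimator_def by (intro real_sqrt_ge_zero sum_nonneg) simp
    have "\<eta> \<le> 4 * H12_norm M r"
      using error_estimator_le_H12_norm[OF err(3)[unfolded \<M>]] unfolding \<eta>_def \<T> \<M> by simp
    also have "\<dots> \<le> 4 * (CV * dual_norm M e)" using CV[OF err(1)] norm_eq by simp
    also have "\<dots> \<le> 4 * ((\<bar>CV\<bar> + 1) * dual_norm M e)"
      using e0 by (intro mult_left_mono mult_right_mono) auto
    finally have eff: "\<eta> \<le> Ceff * dual_norm M e" by (simp only: Ceff_def mult.assoc)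
    have rel: "dual_norm M e \<le> Crel m (shape_regularity M \<T>) q * \<eta>"
      if q: "0 < q" "q \<le> 1" and A: "assumption_A1 M \<T> X m \<psi>" "assumption_A2 M \<T> q \<psi>" for m q \<psi>
    proof -
      define k where "k = \<bar>K m (shape_regularity M \<T>) q\<bar> + 1"
      have VL2: "V (L2_to_dual M p) \<in> L2_space M"
        using S.dual_spaceI_L2[OF p] assms(3) H12_subset_L2 unfolding elliptic_isomorphism_def by blast
      have "H12_norm M r \<le> sqrt k * \<eta>"
        unfolding \<eta>_def \<T> \<M>
      proof (rule H12_norm_le_error_estimator[OF _ q(1)])
        show "r \<in> H12_space (arclength \<gamma> a b)" using err(3) by (simp add: \<M>)
        show "\<exists>S. T \<subseteq> S \<and> S \<subseteq> elem_patch (mesh_elements \<gamma> z n) m T \<and>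
          far_from_constants (arclength \<gamma> a b) q r S" if "T \<in> mesh_elements \<gamma> z n" for T
          using galerkin_residual_far_from_constants[of V f p X m \<psi> q T] err(3) H12_subset_L2[OF f] VL2 XL2 gal A q(2) that
          unfolding r_def \<T> \<M> by blast
        show "real (4 * 4) + (measure (arclength \<gamma> a b) (space (arclength \<gamma> a b))
            + 16 * real 4 * (4 * C / c) / (c / (C * shape_regularity (arclength \<gamma> a b) (mesh_elements \<gamma> z n))))
          * (oscillation_const 4 (shape_regularity (arclength \<gamma> a b) (mesh_elements \<gamma> z n)) (C / c) m / q) \<le> k"
          unfolding k_def K_def \<T> \<M> by linarith
      qed
      moreover have "dual_norm M e \<le> CI * H12_norm M r" using CI[OF err(1)] norm_eq by simp
      moreover have "CI * H12_norm M r \<le> (\<bar>CI\<bar> + 1) * H12_norm M r"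
        by (rule mult_right_mono) (auto simp: H12_norm_def)
      moreover have "(\<bar>CI\<bar> + 1) * H12_norm M r \<le> (\<bar>CI\<bar> + 1) * (sqrt k * \<eta>)"
        using calculation(1) by (rule mult_left_mono) simp
      ultimately show ?thesis by (simp add: Crel_def k_def mult.assoc)
    qed
    show "\<eta> \<le> Ceff * dual_norm M (dual_diff M \<phi> (L2_to_dual M p))" using eff by (simp only: e_def)
    show "dual_norm M (dual_diff M \<phi> (L2_to_dual M p)) \<le> Crel m (shape_regularity M \<T>) q * \<eta>"
      if "0 < q" "q \<le> 1" "\<exists>\<psi>. assumption_A1 M \<T> X m \<psi> \<and> assumption_A2 M \<T> q \<psi>" for m q
      using rel that by (auto simp only: e_def)
  qed
qed

end
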